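(* Let $C(\varepsilon)=C+\varepsilon\tilde C$ with $\tilde C=\mathrm{diag}(\tilde c_i:i\in\mathcal S)$, and assume $\tilde c_i>0$ for all $i\in\mathcal S_0$; write $\mathcal S_\oplus$ for $\mathcal S_0$, so that $\tilde C$ has diagonal blocks $\tilde C_+,\tilde C_\oplus,\tilde C_-$. For small $\varepsilon>0$ let $$\boldsymbol\Psi(\varepsilon)=\begin{bmatrix}\Psi_{+-}(\varepsilon)\\ \Psi_{\oplus-}(\varepsilon)\end{bmatrix}$$ be the matrix of first return probabilities to the initial level from above of the model with phase generator $A$ and rate matrix $C(\varepsilon)$, that is, the minimal nonnegative solution of $$\begin{bmatrix}C_++\varepsilon\tilde C_+&0\\0&\varepsilon\tilde C_\oplus\end{bmatrix}^{-1}\left(\begin{bmatrix}A_{+-}\\ A_{\oplus-}\end{bmatrix}+\begin{bmatrix}A_{++}&A_{+\oplus}\\ A_{\oplus+}&A_{\oplus\oplus}\end{bmatrix}X\right)+X|C_-+\varepsilon\tilde C_-|^{-1}\left(A_{--}+\begin{bmatrix}A_{-+}&A_{-\oplus}\end{bmatrix}X\right)=0 .$$ Then $\boldsymbol\Psi(\varepsilon)$ is analytic near zero and may be written as $\boldsymbol\Psi(\varepsilon)=\overline\Psi+\varepsilon\Psi^{(1)}+O(\varepsilon^2)$, where $$\overline\Psi=\begin{bmatrix}\Psi\\ \Psi_{\oplus-}\end{bmatrix},\qquad \Psi^{(1)}=\begin{bmatrix}\Psi^{(1)}_{+-}\\ \Psi^{(1)}_{\oplus-}\end{bmatrix},$$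 $\Psi$ is the matrix of first return probabilities of the unperturbed model, $\Psi_{\oplus-}=(-A_{\oplus\oplus}^{-1})(A_{\oplus-}+A_{\oplus+}\Psi)$, $\Psi^{(1)}_{+-}$ is the unique solution $X$ of the Sylvester equation $$KX+XU=-\Psi|C_-^{-1}|\tilde C_-U-C_+^{-1}\tilde C_+\Psi U-P_\oplus U,$$ and $$\Psi^{(1)}_{\oplus-}=(-A_{\oplus\oplus}^{-1})\tilde C_\oplus\Psi_{\oplus-}U+(-A_{\oplus\oplus}^{-1})A_{\oplus+}\Psi^{(1)}_{+-}.$$ Here $$P_\oplus=K_{+\oplus}(-A_{\oplus\oplus}^{-1})\tilde C_\oplus(-A_{\oplus\oplus}^{-1})(A_{\oplus-}+A_{\oplus+}\Psi),\qquad K_{+\oplus}=C_+^{-1}A_{+\oplus}+\Psi|C_-^{-1}|A_{-\oplus}.$$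
   Context: Markov modulated fluid model: $\varphi(t)$ is a continuous-time Markov chain (the phase process) on a finite set $\mathcal S$ with generator $A$, and $Y(t)=Y(0)+\int_0^t c_{\varphi(s)}\,\mathrm ds$ with real rates $c_i$, $i\in\mathcal S$. Partition $\mathcal S=\mathcal S_+\cup\mathcal S_0\cup\mathcal S_-$ according to $c_i>0$, $c_i=0$, $c_i<0$; matrices indexed by phases are partitioned accordingly into blocks $A_{++},A_{+0},A_{+-}$, etc. (with index $\oplus$ in place of $0$ in the claim, so $A_{\oplus\oplus}=A_{00}$, $A_{+\oplus}=A_{+0}$, etc.). Put $C_+=\mathrm{diag}(c_i:i\in\mathcal S_+)$, $C_-=\mathrm{diag}(c_i:i\in\mathcal S_-)$, and let $C$ be the block-diagonal matrix with diagonal blocks $C_+,0,C_-$; $|\cdot|$ denotes entrywise absolute value and $\mathbf 1$ is the column vector of ones. Standing assumption (positive recurrence): $\boldsymbol\xi C\mathbf 1<0$, where $\boldsymbol\xi$ is the stationary probability vector of the phase process, the unique solution of $\boldsymbol\xi A=0$, $\boldsymbol\xi\mathbf 1=1$. First return probabilities from above: for a phase $i$ of positive rate and a phase $j$ of negative rate, the $(i,j)$ entry is $\mathbb P[\tau_-<\infty,\ \varphi(\tau_-)=j\mid Y(0)=0,\varphi(0)=i]$ with $\tau_-=\inf\{t>0:Y(t)<0\}$. For the unperturbed model this is the $|\mathcal S_+|\times|\mathcal S_-|$ matrix $\Psi$, which is known (Rogers) to be the minimal nonnegative solution of $C_+^{-1}Q_{+-}+C_+^{-1}Q_{++}X+X|C_-^{-1}|Q_{--}+X|C_-^{-1}|Q_{-+}X=0$,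 with $$\begin{bmatrix}Q_{++}&Q_{+-}\\ Q_{-+}&Q_{--}\end{bmatrix}=\begin{bmatrix}A_{++}&A_{+-}\\ A_{-+}&A_{--}\end{bmatrix}+\begin{bmatrix}A_{+0}\\ A_{-0}\end{bmatrix}(-A_{00}^{-1})\begin{bmatrix}A_{0+}&A_{0-}\end{bmatrix}.$$ Define $$U=|C_-^{-1}|Q_{--}+|C_-^{-1}|Q_{-+}\Psi,\qquad K=C_+^{-1}Q_{++}+\Psi|C_-^{-1}|Q_{-+}.$$ It is assumed that $\varepsilon$ is small enough that the diagonal elements of $C_++\varepsilon\tilde C_+$ are strictly positive and those of $C_-+\varepsilon\tilde C_-$ are strictly negative. In the perturbed model the phases of positive rate are $\mathcal S_+\cup\mathcal S_\oplus$. "Analytic near zero" means that $\boldsymbol\Psi(\varepsilon)$, defined for small $\varepsilon>0$, coincides there with a matrix function analytic in a neighbourhood of $\varepsilon=0$. *)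

theory Defs
  imports "HOL-Analysis.Analysis" "HOL-Library.Landau_Symbols"
begin

text \<open>
  The phase space is a finite type \<open>'s\<close>. A matrix with rows indexed by \<open>R\<close> and columns indexed by
  \<open>S\<close> (both sets of phases, possibly empty) is represented by the \<open>'s\<close>-indexed square matrix that
  carries its entries on \<open>R \<times> S\<close> and is zero elsewhere. Sums and products of blocks are then
  ordinary sums and products, and stacking two matrices with disjoint row sets \<open>R\<close>, \<open>R'\<close> is their sum.
  The order and the absolute value on \<open>real ^ 's ^ 's\<close> are the entrywise ones, and
  \<open>1 :: real ^ 's\<close> is the vector of ones.
\<close>

type_synonym 's rmat = "real ^ 's ^ 's"

definition diag :: "real ^ 's \<Rightarrow> 's::finite rmat"
  where "diag v = (\<chi> i j. if i = j then v $ i else 0)"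

definition block :: "'s set \<Rightarrow> 's set \<Rightarrow> 's::finite rmat \<Rightarrow> 's rmat"
  where "block R S M = (\<chi> i j. if i \<in> R \<and> j \<in> S then M $ i $ j else 0)"

definition is_block :: "'s set \<Rightarrow> 's set \<Rightarrow> 's::finite rmat \<Rightarrow> bool"
  where "is_block R S M \<longleftrightarrow> (\<forall>i j. \<not> (i \<in> R \<and> j \<in> S) \<longrightarrow> M $ i $ j = 0)"

text \<open>The inverse of the square submatrix of \<open>M\<close> on \<open>S \<times> S\<close>;
  \<open>block S S (mat 1)\<close> is the identity matrix of that size.\<close>

definition block_inv :: "'s set \<Rightarrow> 's::finite rmat \<Rightarrow> 's rmat"
  where "block_inv S M = (THE B. is_block S S B \<and>
     block S S M ** B = block S S (mat 1) \<and> B ** block S S M = block S S (mat 1))"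

definition generator :: "'s::finite rmat \<Rightarrow> bool"
  where "generator A \<longleftrightarrow> (\<forall>i j. i \<noteq> j \<longrightarrow> 0 \<le> A $ i $ j) \<and> A *v 1 = 0"

definition stationary_vector :: "'s::finite rmat \<Rightarrow> real ^ 's \<Rightarrow> bool"
  where "stationary_vector A \<xi> \<longleftrightarrow> 0 \<le> \<xi> \<and> \<xi> v* A = 0 \<and> \<xi> \<bullet> 1 = 1 \<and>
     (\<forall>\<eta>. \<eta> v* A = 0 \<and> \<eta> \<bullet> 1 = 1 \<longrightarrow> \<eta> = \<xi>)"

definition minimal_nonneg_solution ::
    "'s set \<Rightarrow> 's set \<Rightarrow> ('s::finite rmat \<Rightarrow> 's rmat) \<Rightarrow> 's rmat \<Rightarrow> bool"
  where "minimal_nonneg_solution R S F X \<longleftrightarrow> is_block R S X \<and> 0 \<le> X \<and> F X = 0 \<and>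
     (\<forall>Y. is_block R S Y \<and> 0 \<le> Y \<and> F Y = 0 \<longrightarrow> X \<le> Y)"

text \<open>A function defined for small positive arguments only is analytic near zero if it coincides
  there with a function that is analytic, entry by entry, in a complex neighbourhood of zero.\<close>

definition analytic_near_zero :: "(real \<Rightarrow> 's::finite rmat) \<Rightarrow> bool"
  where "analytic_near_zero M \<longleftrightarrow> (\<exists>F :: complex \<Rightarrow> complex ^ 's ^ 's.
     (\<forall>i j. (\<lambda>z. F z $ i $ j) analytic_on {0}) \<and>
     (\<forall>\<^sub>F \<epsilon> in at_right 0. \<forall>i j. complex_of_real (M \<epsilon> $ i $ j) = F (of_real \<epsilon>) $ i $ j))"

text \<open>
  In the names below \<open>p\<close>, \<open>z\<close>, \<open>m\<close> stand for the phases \<open>i\<close> with \<open>c $ i\<close> positive, zero, negative;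
  the set of zero phases, which acquire a positive rate under the perturbation, is also the index
  set written as a circled plus. The vectors \<open>c\<close> and \<open>ct\<close> are the diagonals of \<open>C\<close> and of the
  perturbation direction. The first return probability matrices \<open>Psi\<close> and \<open>Psi_eps\<close> are taken as the
  minimal nonnegative solutions of their Riccati equations.
\<close>

locale perturbed_fluid_notation =
  fixes A :: "'s::finite rmat" and c ct :: "real ^ 's"
begin

abbreviation p :: "'s set" where "p \<equiv> {i. c $ i > 0}"
abbreviation z :: "'s set" where "z \<equiv> {i. c $ i = 0}"
abbreviation m :: "'s set" where "m \<equiv> {i. c $ i < 0}"

abbreviation "App \<equiv> block p p A"
abbreviation "Apz \<equiv> block p z A"
abbreviation "Apm \<equiv> block p m A"
abbreviation "Azp \<equiv> block z p A"
abbreviation "Azm \<equiv> block z m A"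
abbreviation "Amp \<equiv> block m p A"
abbreviation "Amz \<equiv> block m z A"
abbreviation "Amm \<equiv> block m m A"

abbreviation "N \<equiv> - block_inv z A"  \<comment> \<open>minus the inverse of the block of \<open>A\<close> on the zero phases\<close>

abbreviation "Cp_inv \<equiv> block_inv p (diag c)"
abbreviation "abs_Cm_inv \<equiv> \<bar>block_inv m (diag c)\<bar>"
abbreviation "Ctp \<equiv> block p p (diag ct)"
abbreviation "Ctz \<equiv> block z z (diag ct)"
abbreviation "Ctm \<equiv> block m m (diag ct)"

definition "Qpp = App + Apz ** N ** Azp"
definition "Qpm = Apm + Apz ** N ** Azm"
definition "Qmp = Amp + Amz ** N ** Azp"
definition "Qmm = Amm + Amz ** N ** Azm"

definition riccati :: "'s rmat \<Rightarrow> 's rmat"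
  where "riccati X = Cp_inv ** Qpm + Cp_inv ** Qpp ** X + X ** abs_Cm_inv ** Qmm
     + X ** abs_Cm_inv ** Qmp ** X"

definition Psi :: "'s rmat"
  where "Psi = (THE X. minimal_nonneg_solution p m riccati X)"

definition "U = abs_Cm_inv ** Qmm + abs_Cm_inv ** Qmp ** Psi"
definition "K = Cp_inv ** Qpp + Psi ** abs_Cm_inv ** Qmp"

definition C_eps :: "real \<Rightarrow> 's rmat"
  where "C_eps \<epsilon> = diag c + \<epsilon> *\<^sub>R diag ct"

definition riccati_eps :: "real \<Rightarrow> 's rmat \<Rightarrow> 's rmat"
  where "riccati_eps \<epsilon> X =
     block_inv (p \<union> z) (C_eps \<epsilon>) ** (block (p \<union> z) m A + block (p \<union> z) (p \<union> z) A ** X)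
     + X ** block_inv m \<bar>C_eps \<epsilon>\<bar> ** (Amm + block m (p \<union> z) A ** X)"

definition Psi_eps :: "real \<Rightarrow> 's rmat"
  where "Psi_eps \<epsilon> = (THE X. minimal_nonneg_solution (p \<union> z) m (riccati_eps \<epsilon>) X)"

definition "Psi_z = N ** (Azm + Azp ** Psi)"

definition "Psi_bar = Psi + Psi_z"  \<comment> \<open>\<open>Psi\<close> stacked on \<open>Psi_z\<close>\<close>

definition "Kpz = Cp_inv ** Apz + Psi ** abs_Cm_inv ** Amz"
definition "Pz = Kpz ** N ** Ctz ** N ** (Azm + Azp ** Psi)"

definition sylvester_solution :: "'s rmat \<Rightarrow> bool"
  where "sylvester_solution X \<longleftrightarrow> is_block p m X \<and>
     K ** X + X ** U = - (Psi ** abs_Cm_inv ** Ctm ** U) - Cp_inv ** Ctp ** Psi ** U - Pz ** U"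

definition Psi1_p :: "'s rmat"
  where "Psi1_p = (THE X. sylvester_solution X)"

definition "Psi1_z = N ** Ctz ** Psi_z ** U + N ** Azp ** Psi1_p"

definition "Psi1 = Psi1_p + Psi1_z"  \<comment> \<open>\<open>Psi1_p\<close> stacked on \<open>Psi1_z\<close>\<close>

end

end

theory Submission
  imports Defs "HOL-Complex_Analysis.Cauchy_Integral_Formula"
begin

text \<open>Multiplying the Riccati equation of the perturbed model by the rates of the phases in
\<open>p \<union> z\<close> removes the factor \<open>1 / \<epsilon>\<close>. The resulting equation
\<open>scaled_riccati \<epsilon> X = 0\<close> is quadratic in \<open>X\<close> with coefficients that are analytic at \<open>\<epsilon> = 0\<close>. At
\<open>\<epsilon> = 0\<close> its rows in \<open>z\<close> are linear and determine these rows of \<open>X\<close> from the rows in \<open>p\<close>; what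
remains for the latter is the Riccati equation of the unperturbed model
(\<open>limit_equation_iff\<close>). The theorem is thus an application of the implicit function theorem,
for which three points have to be settled.

The first is that the minimal solutions converge to \<open>Psi_bar\<close>, so that they lie on the analytic
branch through \<open>Psi_bar\<close>. Minimal solutions are limits of a monotone iteration that preserves
substochastic matrices (\<open>minimal_solution_exists\<close>), hence they stay in a compact set, and every
limit point is a substochastic solution of the limiting equation. Under negative drift there is
only one: for a substochastic solution \<open>X\<close> a left null vector of \<open>K\<close> would extend to an
invariant measure of the censored phase process whose drift is nonnegative
(\<open>Kfull_left_injective\<close>); since \<open>K (1 - X 1) = 0\<close>, all row sums of \<open>X\<close> are one, and the minimal
solution, which lies below \<open>X\<close> and has the same row sums, is equal to \<open>X\<close>
(\<open>substochastic_solution_unique\<close>).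

The second is that the linearization at \<open>Psi_bar\<close> is invertible. Eliminating the rows in \<open>z\<close>
turns it into \<open>H \<mapsto> K H + H U\<close> (\<open>linearized_eq_iff\<close>), and this operator is injective because
there is a positive row vector \<open>y\<close> with \<open>y K < 0\<close>, while \<open>U\<close> has nonnegative off-diagonal entries
and row sums zero (\<open>sylvester_injective\<close>). The vector \<open>y\<close> comes from killing the process at a
small rate \<open>s\<close>: the deficits of the row sums of the killed first return probabilities, divided
by \<open>s\<close>, converge to a nonnegative vector on which \<open>K\<close> is negative (\<open>K_decreased_vector\<close>).

The third is the analytic implicit function theorem itself. Since the equation is quadratic in
\<open>X\<close> and rational in \<open>\<epsilon>\<close>, its increments factor exactly through secant operators that depend continuously on all
arguments. The contraction principle yields the branch over complex parameters, and dividing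
increments along the branch by increments of the parameter shows that the branch is holomorphic
and gives its derivative (\<open>analytic_solution_branch\<close>). The equation for the derivative at zero
is solved by \<open>Psi1\<close> (\<open>linearized_Psi1\<close>), and Taylor's theorem gives the remainder.\<close>

section \<open>Matrix algebra\<close>

lemma matrix_add_rdistrib: "(A + B) ** C = A ** C + B ** (C :: 'a::semiring_1 ^ 'n ^ 'm)"
  by (simp add: vec_eq_iff matrix_matrix_mult_def sum.distrib distrib_right)

lemma matrix_diff_ldistrib: "A ** (B - C) = A ** B - A ** (C :: 'a::ring_1 ^ 'n ^ 'm)"
  by (simp add: vec_eq_iff matrix_matrix_mult_def sum_subtractf right_diff_distrib)

lemma matrix_diff_rdistrib: "(A - B) ** C = A ** C - B ** (C :: 'a::ring_1 ^ 'n ^ 'm)"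
  by (simp add: vec_eq_iff matrix_matrix_mult_def sum_subtractf left_diff_distrib)

lemma matrix_minus_left: "(- A) ** B = - (A ** (B :: 'a::ring_1 ^ 'n ^ 'm))"
  by (simp add: vec_eq_iff matrix_matrix_mult_def sum_negf)

lemma matrix_minus_right: "A ** (- B) = - (A ** (B :: 'a::ring_1 ^ 'n ^ 'm))"
  by (simp add: vec_eq_iff matrix_matrix_mult_def sum_negf)

lemma matrix_zero_left: "0 ** B = (0 :: 'a::semiring_1 ^ 'n ^ 'm)"
  by (simp add: vec_eq_iff matrix_matrix_mult_def)

lemma matrix_zero_right: "B ** 0 = (0 :: 'a::semiring_1 ^ 'n ^ 'm)"
  by (simp add: vec_eq_iff matrix_matrix_mult_def)

lemma matrix_scaleR_left: "(r *\<^sub>R A) ** B = r *\<^sub>R (A ** (B :: 'a::real_algebra_1 ^ 'n ^ 'm))"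
  by (simp add: vec_eq_iff matrix_matrix_mult_def scaleR_sum_right)

lemma matrix_scaleR_right: "A ** (r *\<^sub>R B) = r *\<^sub>R (A ** (B :: 'a::real_algebra_1 ^ 'n ^ 'm))"
  by (simp add: vec_eq_iff matrix_matrix_mult_def scaleR_sum_right)

lemmas matrix_algebra = matrix_add_ldistrib matrix_add_rdistrib matrix_diff_ldistrib
  matrix_diff_rdistrib matrix_minus_left matrix_minus_right matrix_zero_left matrix_zero_right
  matrix_scaleR_left matrix_scaleR_right matrix_mul_assoc

lemma matrix_vector_minus_left: "(- A) *v x = - (A *v (x :: 'a::ring_1 ^ 'n))"
  by (simp add: vec_eq_iff matrix_vector_mult_def sum_negf)

lemma matrix_vector_scaleR_left: "(r *\<^sub>R A) *v x = r *\<^sub>R (A *v (x :: 'a::real_algebra_1 ^ 'n))"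
  by (simp add: vec_eq_iff matrix_vector_mult_def scaleR_sum_right)

lemmas matrix_vector_algebra = matrix_vector_right_distrib matrix_vector_mult_diff_distrib
  matrix_vector_mult_add_rdistrib matrix_vector_mult_diff_rdistrib matrix_vector_mult_scaleR
  matrix_vector_minus_left matrix_vector_scaleR_left matrix_vector_mul_assoc[symmetric]

lemma vector_matrix_minus_right: "x v* (- A) = - (x v* (A :: 'a::ring_1 ^ 'n ^ 'm))"
  by (simp add: vec_eq_iff vector_matrix_mult_def sum_negf)

lemma mat_mult_nth: "(mat a ** (X :: 'a::semiring_1 ^ 'n ^ 'm)) $ i $ j = a * X $ i $ j"
proof -
  have "(mat a ** X) $ i $ j = (\<Sum>k\<in>UNIV. if k = i then a * X $ i $ j else 0)"
    unfolding matrix_matrix_mult_def mat_def vec_lambda_beta by (rule sum.cong) auto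
  then show ?thesis by simp
qed

lemma mat_mult_commute: "mat a ** X = X ** (mat a :: 'a::comm_semiring_1 ^ 'n ^ 'n)"
proof -
  have "(X ** mat a) $ i $ j = (\<Sum>k\<in>UNIV. if k = j then X $ i $ j * a else 0)" for i j
    unfolding matrix_matrix_mult_def mat_def vec_lambda_beta by (rule sum.cong) auto
  then show ?thesis by (simp add: vec_eq_iff mat_mult_nth mult.commute)
qed

lemma mat_mult_left_commute: "B ** (mat a ** X) = mat a ** (B ** (X :: 'a::comm_semiring_1 ^ 'k ^ 'n))"
  unfolding matrix_mul_assoc mat_mult_commute[of a B] ..

lemma matrix_nonneg_mult:
  assumes "0 \<le> X" "0 \<le> (Y :: real ^ 'n ^ 'm)"
  shows "0 \<le> (X :: real ^ 'm ^ 'k) ** Y"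
  using assms by (auto simp: less_eq_vec_def matrix_matrix_mult_def intro!: sum_nonneg)

lemma matrix_vector_nonneg_mult:
  assumes "0 \<le> X" "0 \<le> (v :: real ^ 'm)"
  shows "0 \<le> (X :: real ^ 'm ^ 'k) *v v"
  using assms by (auto simp: less_eq_vec_def matrix_vector_mult_def intro!: sum_nonneg)

lemma matrix_vector_mono:
  assumes "0 \<le> X" "v \<le> (w :: real ^ 'm)"
  shows "(X :: real ^ 'm ^ 'k) *v v \<le> X *v w"
  using assms by (auto simp: less_eq_vec_def matrix_vector_mult_def intro!: sum_mono mult_left_mono)

lemma linear_matrix_mult_left: "linear (\<lambda>B. A ** (B :: 'a::real_algebra_1 ^ 'n ^ 'm))"
  by (rule linearI) (simp_all add: matrix_algebra)

lemma linear_matrix_mult_right: "linear (\<lambda>A. A ** (B :: 'a::real_algebra_1 ^ 'n ^ 'm))"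
  by (rule linearI) (simp_all add: matrix_algebra)

lemma bounded_bilinear_matrix_mult:
  "bounded_bilinear ((**) :: 'a::{euclidean_space,real_algebra_1} ^ 'm ^ 'k \<Rightarrow> 'a ^ 'n ^ 'm \<Rightarrow> _)"
  unfolding bilinear_conv_bounded_bilinear[symmetric] bilinear_def
  using linear_matrix_mult_left linear_matrix_mult_right by blast

lemma bounded_bilinear_matrix_vector_mult:
  "bounded_bilinear ((*v) :: 'a::{euclidean_space,real_algebra_1} ^ 'm ^ 'k \<Rightarrow> 'a ^ 'm \<Rightarrow> _)"
  unfolding bilinear_conv_bounded_bilinear[symmetric] bilinear_def
  by (auto intro!: linearI simp: matrix_vector_algebra)

lemmas tendsto_matrix_mult [tendsto_intros] =
  bounded_bilinear.tendsto[OF bounded_bilinear_matrix_mult]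
lemmas tendsto_matrix_vector_mult [tendsto_intros] =
  bounded_bilinear.tendsto[OF bounded_bilinear_matrix_vector_mult]
lemmas continuous_on_matrix_mult [continuous_intros] =
  bounded_bilinear.continuous_on[OF bounded_bilinear_matrix_mult]

section \<open>Block matrices\<close>

lemma block_nth: "block R S X $ i $ j = (if i \<in> R \<and> j \<in> S then X $ i $ j else 0)"
  by (simp add: block_def)

lemma is_blockD: "is_block R S X \<Longrightarrow> i \<notin> R \<or> j \<notin> S \<Longrightarrow> X $ i $ j = 0"
  by (auto simp: is_block_def)

lemma is_block_block [simp]: "is_block R S (block R S X)"
  by (simp add: is_block_def block_nth)

lemma block_eq_iff: "block R S X = X \<longleftrightarrow> is_block R S X"
  by (auto simp: is_block_def block_def vec_eq_iff)

lemma block_id: "is_block R S X \<Longrightarrow> block R S X = X"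
  by (simp add: block_eq_iff)

lemma is_block_add: "is_block R S X \<Longrightarrow> is_block R S Y \<Longrightarrow> is_block R S (X + Y)"
  by (simp add: is_block_def)

lemma is_block_diff: "is_block R S X \<Longrightarrow> is_block R S Y \<Longrightarrow> is_block R S (X - Y)"
  by (simp add: is_block_def)

lemma is_block_minus: "is_block R S X \<Longrightarrow> is_block R S (- X)"
  by (simp add: is_block_def)

lemma is_block_scaleR: "is_block R S X \<Longrightarrow> is_block R S (r *\<^sub>R X)"
  by (simp add: is_block_def)

lemma is_block_zero: "is_block R S 0"
  by (simp add: is_block_def)

lemma is_block_mult: "is_block R S X \<Longrightarrow> is_block T V Y \<Longrightarrow> is_block R V (X ** Y)"
  by (auto simp: is_block_def matrix_matrix_mult_def intro!: sum.neutral)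

lemma is_block_mono: "is_block R S X \<Longrightarrow> R \<subseteq> R' \<Longrightarrow> S \<subseteq> S' \<Longrightarrow> is_block R' S' X"
  by (auto simp: is_block_def)

lemmas is_block_intros = is_block_add is_block_diff is_block_minus is_block_scaleR
  is_block_zero is_block_mult is_block_block

lemma block_mult_disjoint:
  "is_block R S X \<Longrightarrow> is_block T V Y \<Longrightarrow> S \<inter> T = {} \<Longrightarrow> X ** Y = 0"
  by (fastforce simp: is_block_def matrix_matrix_mult_def vec_eq_iff intro!: sum.neutral)

lemma diag_nth: "diag v $ i $ j = (if i = j then v $ i else 0)"
  by (simp add: diag_def)

lemma block_add_eq_0:
  assumes "is_block R S X" "is_block R' S' Y" "R \<inter> R' = {}" "X + Y = 0"
  shows "X = 0" "Y = 0"
proof -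
  have "X $ i $ j = 0 \<and> Y $ i $ j = 0" for i j
  proof -
    have "X $ i $ j + Y $ i $ j = 0" using assms(4) by (simp add: vec_eq_iff)
    moreover have "X $ i $ j = 0 \<or> Y $ i $ j = 0"
      using assms(1-3) unfolding is_block_def by blast
    ultimately show ?thesis by auto
  qed
  then show "X = 0" "Y = 0" by (simp_all add: vec_eq_iff)
qed

lemma one_nth: "(1 :: real ^ 'n) $ i = 1"
  by (simp add: one_vec_def)

lemma block_mult_vector_outside: "is_block R S X \<Longrightarrow> i \<notin> R \<Longrightarrow> (X *v v) $ i = 0"
  by (simp add: is_block_def matrix_vector_mult_def)

lemma block_diag_mult_left: "(block R R (diag v) ** X) $ i $ j = (if i \<in> R then v $ i * X $ i $ j else 0)"
proof -
  have "(block R R (diag v) ** X) $ i $ j = (\<Sum>k\<in>UNIV. if k = i then (if i \<in> R then v $ i * X $ i $ j else 0) else 0)"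
    unfolding matrix_matrix_mult_def block_def diag_def vec_lambda_beta by (rule sum.cong) auto
  then show ?thesis by simp
qed

lemma block_diag_mult_right: "(X ** block R R (diag v)) $ i $ j = (if j \<in> R then X $ i $ j * v $ j else 0)"
proof -
  have "(X ** block R R (diag v)) $ i $ j = (\<Sum>k\<in>UNIV. if k = j then (if j \<in> R then X $ i $ j * v $ j else 0) else 0)"
    unfolding matrix_matrix_mult_def block_def diag_def vec_lambda_beta by (rule sum.cong) auto
  then show ?thesis by simp
qed

lemma mat_1_eq_diag: "mat 1 = diag 1"
  by (simp add: mat_def diag_def vec_eq_iff one_nth)

lemma is_block_mat_mult_left: "is_block R S X \<Longrightarrow> block R R (mat 1) ** X = X"
  by (auto simp: is_block_def mat_1_eq_diag vec_eq_iff block_diag_mult_left one_nth)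

lemma is_block_mat_mult_right: "is_block R S X \<Longrightarrow> X ** block S S (mat 1) = X"
  by (auto simp: is_block_def mat_1_eq_diag vec_eq_iff block_diag_mult_right one_nth)

lemma block_Un_cols: "S \<inter> S' = {} \<Longrightarrow> block R (S \<union> S') X = block R S X + block R S' X"
  by (auto simp: block_def vec_eq_iff)

lemma linear_block: "linear (block R S)"
  by (rule linearI) (auto simp: block_def vec_eq_iff)

lemma block_inv_eqI:
  assumes "is_block S S B" "block S S X ** B = block S S (mat 1)" "B ** block S S X = block S S (mat 1)"
  shows "block_inv S X = B"
  unfolding block_inv_def
proof (rule the_equality)
  fix B'
  assume *: "is_block S S B' \<and> block S S X ** B' = block S S (mat 1) \<and> B' ** block S S X = block S S (mat 1)"
  have "B' = B' ** (block S S X ** B)"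
    using * assms is_block_mat_mult_right[of S S B'] by simp
  also have "\<dots> = B"
    unfolding matrix_mul_assoc using * is_block_mat_mult_left[OF assms(1)] by simp
  finally show "B' = B" .
qed (use assms in auto)

definition ind :: "'n set \<Rightarrow> real ^ 'n"
  where "ind S = (\<chi> i. if i \<in> S then 1 else 0)"

lemma ind_nth [simp]: "ind S $ i = (if i \<in> S then 1 else 0)"
  by (simp add: ind_def)

lemma is_block_mult_ind: "is_block R S X \<Longrightarrow> X *v ind S = X *v 1"
  by (auto simp: is_block_def matrix_vector_mult_def vec_eq_iff one_nth intro!: sum.cong)

lemma vector_block_diag: "(x v* block R R (diag v)) $ j = (if j \<in> R then x $ j * v $ j else 0)"
proof -
  have "(x v* block R R (diag v)) $ j = (\<Sum>k\<in>UNIV. if k = j then (if j \<in> R then x $ j * v $ j else 0) else 0)"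
    unfolding vector_matrix_mult_def block_def diag_def vec_lambda_beta by (rule sum.cong) auto
  then show ?thesis by simp
qed

lemma vector_mult_supported:
  assumes "\<And>i. i \<notin> R \<Longrightarrow> x $ i = 0"
  shows "x v* A = x v* block R UNIV A"
  using assms by (auto simp: vec_eq_iff vector_matrix_mult_def block_nth intro!: sum.cong)

lemma vector_mult_block_outside:
  assumes "is_block R S X" "j \<notin> S"
  shows "(x v* X) $ j = 0"
  using assms by (auto simp: is_block_def vector_matrix_mult_def)

lemma block_diag_mult_diag:
  "block S S (diag v) ** block S S (diag w) = block S S (diag (\<chi> i. v $ i * w $ i))"
  by (simp add: vec_eq_iff block_diag_mult_left) (simp add: block_nth diag_def)

lemma block_inv_diag:
  assumes "\<And>i. i \<in> S \<Longrightarrow> v $ i \<noteq> 0"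
  shows "block_inv S (diag v) = block S S (diag (\<chi> i. 1 / v $ i))"
proof -
  have "block S S (diag (\<chi> i. v $ i * (1 / v $ i))) = block S S (mat 1)"
    using assms by (auto simp: block_def diag_def mat_def vec_eq_iff)
  then show ?thesis
    by (intro block_inv_eqI) (simp_all add: block_diag_mult_diag mult.commute)
qed

section \<open>Metzler matrices\<close>

definition metzler :: "real ^ 'n ^ 'n \<Rightarrow> bool"
  where "metzler T \<longleftrightarrow> (\<forall>i j. i \<noteq> j \<longrightarrow> 0 \<le> T $ i $ j)"

lemma metzler_add_nonneg: "metzler T \<Longrightarrow> 0 \<le> S \<Longrightarrow> metzler (T + S)"
  by (simp add: metzler_def less_eq_vec_def)

lemma inner_one: "(x :: real ^ 'n) \<bullet> 1 = (\<Sum>i\<in>UNIV. x $ i)"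
  by (simp add: inner_vec_def one_nth)

lemma matrix_vector_one_nth: "(X *v (1 :: real ^ 'n)) $ i = (\<Sum>j\<in>UNIV. X $ i $ j)"
  by (simp add: matrix_vector_mult_def one_nth)

lemma nonneg_inner_nonpos_imp_zero:
  fixes u h :: "real ^ 'n"
  assumes "0 \<le> u" "\<And>i. 0 < h $ i" "u \<bullet> h \<le> 0"
  shows "u = 0"
proof -
  have nonneg: "0 \<le> u $ i * h $ i" for i
    using assms(1) assms(2)[of i] by (simp add: less_eq_vec_def)
  have "(\<Sum>i\<in>UNIV. u $ i * h $ i) = 0"
    using assms(3) sum_nonneg[of UNIV "\<lambda>i. u $ i * h $ i"] nonneg by (simp add: inner_vec_def)
  then have "u $ i * h $ i = 0" for i
    using sum_nonneg_eq_0_iff[of UNIV "\<lambda>i. u $ i * h $ i"] nonneg by simp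
  then show ?thesis
    using assms(2) by (metis less_irrefl mult_eq_0_iff vec_eq_iff zero_index)
qed

lemma inner_nonneg_mono:
  fixes u v w :: "real ^ 'n"
  assumes "0 \<le> u" "v \<le> w"
  shows "u \<bullet> v \<le> u \<bullet> w"
  using assms by (auto simp: inner_vec_def less_eq_vec_def intro!: sum_mono mult_left_mono)

text \<open>In a column \<open>j\<close> with \<open>x $ j \<ge> 0\<close> the negative part of \<open>x\<close> meets only off-diagonal entries of \<open>T\<close>,
and in the other columns passing to the negative part can only increase \<open>(- x) v* T\<close>.\<close>

lemma metzler_negative_part:
  assumes T: "metzler T" and x: "x v* T \<le> 0"
  shows "0 \<le> (\<chi> i. max (- (x $ i)) 0) v* T"
proof -
  have "0 \<le> (\<Sum>i\<in>UNIV. T $ i $ j * max (- (x $ i)) 0)" for j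
  proof (cases "x $ j < 0")
    case True
    have "(\<Sum>i\<in>UNIV. T $ i $ j * x $ i) \<le> 0"
      using x by (auto simp: less_eq_vec_def vector_matrix_mult_def mult.commute)
    then have "0 \<le> (\<Sum>i\<in>UNIV. T $ i $ j * - (x $ i))"
      by (simp add: sum_negf)
    also have "\<dots> \<le> (\<Sum>i\<in>UNIV. T $ i $ j * max (- (x $ i)) 0)"
    proof (rule sum_mono)
      fix i
      show "T $ i $ j * - (x $ i) \<le> T $ i $ j * max (- (x $ i)) 0"
      proof (cases "i = j")
        case False
        then show ?thesis
          using T by (intro mult_left_mono) (auto simp: metzler_def)
      qed (use True in simp)
    qed
    finally show ?thesis .
  next
    case False
    have "0 \<le> T $ i $ j * max (- (x $ i)) 0" for i
      using T False by (cases "i = j") (auto simp: metzler_def)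
    then show ?thesis by (rule sum_nonneg)
  qed
  then show ?thesis
    by (simp add: less_eq_vec_def vector_matrix_mult_def mult.commute)
qed

text \<open>The inverse of a nonsingular M-matrix is nonnegative. Negative parts prove this without spectral
theory: for a row \<open>x\<close> of the inverse, the negative part \<open>u\<close> satisfies \<open>0 \<le> u v* T\<close>, whereas pairing
with the positive vector \<open>h\<close> gives at most zero; hence \<open>u v* T = 0\<close> and \<open>u = 0\<close>. Strict
inequality in \<open>T *v h \<le> 0\<close> is replaced by injectivity, which also covers generators restricted to a
set of transient phases, with \<open>h = 1\<close>.\<close>

lemma metzler_inverse_nonneg:
  fixes T :: "real ^ 'n ^ 'n"
  assumes T: "metzler T" and h: "\<And>i. 0 < h $ i" "T *v h \<le> 0"
    and inj: "\<And>x. x v* T = 0 \<Longrightarrow> x = 0"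
  obtains N where "0 \<le> N" "T ** N = - mat 1" "N ** T = - mat 1"
proof -
  obtain B where "B ** transpose T = mat 1"
    using inj matrix_left_invertible_ker[of "transpose T"] by auto
  then have TB: "T ** transpose B = mat 1"
    by (metis matrix_transpose_mul transpose_mat transpose_transpose)
  define N where "N = - transpose B"
  have TN: "T ** N = - mat 1"
    by (simp add: N_def matrix_minus_right TB)
  have NT: "N ** T = - mat 1"
    using TB by (simp add: N_def matrix_minus_left matrix_left_right_inverse)
  have "0 \<le> N $ i $ j" for i j
  proof -
    define x where "x = axis i 1 v* N"
    define u where "u = (\<chi> k. max (- (x $ k)) 0)"
    have "x v* T = axis i 1 v* (- mat 1)"
      by (simp add: x_def vector_matrix_mul_assoc NT)
    also have "\<dots> = - axis i 1"
      by (simp add: vec_eq_iff vector_matrix_mult_def mat_def axis_def sum_negf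
          if_distrib[where f = "\<lambda>x. x * _"] if_distrib[where f = "\<lambda>x. _ * x"] cong: if_cong)
    finally have "x v* T \<le> 0"
      by (simp add: less_eq_vec_def axis_def)
    then have uT: "0 \<le> u v* T"
      unfolding u_def by (rule metzler_negative_part[OF T])
    have u0: "0 \<le> u" by (simp add: u_def less_eq_vec_def)
    have "(u v* T) \<bullet> h \<le> 0"
      using inner_nonneg_mono[OF u0 h(2)] by (simp add: dot_lmul_matrix)
    then have "u v* T = 0"
      by (rule nonneg_inner_nonpos_imp_zero[OF uT h(1)])
    then have "u = 0" by (rule inj)
    then have "max (- (x $ j)) 0 = 0"
      unfolding u_def vec_eq_iff by simp
    then have "0 \<le> x $ j" by simp
    then show ?thesis
      by (simp add: x_def vector_matrix_mult_def axis_def if_distrib[where f = "\<lambda>x. x * _"] cong: if_cong)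
  qed
  then show ?thesis
    using that[of N] TN NT by (simp add: less_eq_vec_def)
qed

lemma metzler_positive_right:
  assumes "metzler T" "0 \<le> h" "(T *v h) $ i < 0"
  shows "0 < h $ i"
proof (rule ccontr)
  assume "\<not> 0 < h $ i"
  then have "h $ i = 0" using assms(2) by (simp add: less_eq_vec_def order.antisym)
  then have "0 \<le> T $ i $ k * h $ k" for k
    using assms by (cases "k = i") (auto simp: metzler_def less_eq_vec_def)
  then have "0 \<le> (T *v h) $ i"
    by (simp add: matrix_vector_mult_def sum_nonneg)
  then show False using assms(3) by simp
qed

lemma metzler_transpose: "metzler T \<Longrightarrow> metzler (transpose T)"
  by (auto simp: metzler_def transpose_def)

section \<open>Perturbation of linear equations and of zeros\<close>

text \<open>In finite dimension, pointwise convergence of linear maps is convergence in operator norm, because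
it suffices to look at a basis.\<close>

lemma eventually_linear_close:
  fixes \<Lambda> :: "'a \<Rightarrow> 'v::euclidean_space \<Rightarrow> 'w::real_normed_vector"
  assumes lin: "\<And>x. linear (\<Lambda> x)" "linear L"
    and lim: "\<And>H. ((\<lambda>x. \<Lambda> x H) \<longlongrightarrow> L H) F" and e: "0 < e"
  shows "\<forall>\<^sub>F x in F. \<forall>H. norm (\<Lambda> x H - L H) \<le> e * norm H"
proof -
  have "((\<lambda>x. \<Sum>b\<in>Basis. norm (\<Lambda> x b - L b)) \<longlongrightarrow> (\<Sum>b\<in>(Basis::'v set). norm (L b - L b))) F"
    by (intro tendsto_intros lim)
  then have "\<forall>\<^sub>F x in F. (\<Sum>b\<in>Basis. norm (\<Lambda> x b - L b)) < e"
    using e by (auto dest!: order_tendstoD(2)[where a = e])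
  then show ?thesis
  proof eventually_elim
    case (elim x)
    show ?case
    proof
      fix H :: 'v
      interpret l: linear "\<lambda>H. \<Lambda> x H - L H"
        using lin by (intro linear_compose_sub) auto
      have "\<Lambda> x H - L H = (\<Sum>b\<in>Basis. (H \<bullet> b) *\<^sub>R (\<Lambda> x b - L b))"
        using l.sum[of "\<lambda>b. (H \<bullet> b) *\<^sub>R b" Basis] by (simp add: l.scale euclidean_representation)
      also have "norm \<dots> \<le> (\<Sum>b\<in>Basis. norm H * norm (\<Lambda> x b - L b))"
        by (intro sum_norm_le) (simp add: Basis_le_norm mult_right_mono)
      also have "\<dots> \<le> norm H * e"
        unfolding sum_distrib_left[symmetric] using elim by (intro mult_left_mono) auto
      finally show "norm (\<Lambda> x H - L H) \<le> e * norm H" by (simp add: mult.commute)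
    qed
  qed
qed

lemma eventually_lower_bound:
  fixes \<Lambda> :: "'a \<Rightarrow> 'v::euclidean_space \<Rightarrow> 'w::euclidean_space"
  assumes lin: "\<And>x. linear (\<Lambda> x)" "linear L"
    and lim: "\<And>H. ((\<lambda>x. \<Lambda> x H) \<longlongrightarrow> L H) F" and inj: "\<And>H. L H = 0 \<Longrightarrow> H = 0"
  obtains \<kappa> where "0 < \<kappa>" "\<forall>\<^sub>F x in F. \<forall>H. \<kappa> * norm H \<le> norm (\<Lambda> x H)"
proof -
  have "inj L"
    using inj linear_injective_0[OF lin(2)] by blast
  then obtain B where B: "0 < B" "\<And>H. B * norm H \<le> norm (L H)"
    using linear_inj_bounded_below_pos[OF lin(2)] by blast
  have "\<forall>\<^sub>F x in F. \<forall>H. norm (\<Lambda> x H - L H) \<le> B/2 * norm H"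
    by (rule eventually_linear_close[OF lin lim]) (use B in auto)
  then have "\<forall>\<^sub>F x in F. \<forall>H. B/2 * norm H \<le> norm (\<Lambda> x H)"
  proof eventually_elim
    case (elim x)
    show ?case
    proof
      fix H
      have "norm (L H) \<le> norm (\<Lambda> x H) + norm (\<Lambda> x H - L H)"
        using norm_triangle_sub[of "L H" "\<Lambda> x H"] by (simp add: norm_minus_commute)
      then show "B/2 * norm H \<le> norm (\<Lambda> x H)"
        using B(2)[of H] elim[rule_format, of H] by simp
    qed
  qed
  then show ?thesis using that[of "B/2"] B(1) by simp
qed

text \<open>Solutions of linear equations depend continuously on the operator and the right-hand side as
soon as the limiting operator is injective; boundedness of the solutions does not have to be
known beforehand. Both limits of difference quotients below, in the killing rate and in the complex
parameter, are obtained in this way.\<close>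

lemma linear_solution_tendsto:
  fixes \<Lambda> :: "'a \<Rightarrow> 'v::euclidean_space \<Rightarrow> 'w::euclidean_space"
  assumes lin: "\<And>x. linear (\<Lambda> x)" "linear L"
    and lim: "\<And>H. ((\<lambda>x. \<Lambda> x H) \<longlongrightarrow> L H) F" and inj: "\<And>H. L H = 0 \<Longrightarrow> H = 0"
    and rhs: "((\<lambda>x. \<Lambda> x (v x)) \<longlongrightarrow> L v0) F"
  shows "(v \<longlongrightarrow> v0) F"
proof -
  obtain \<kappa> where \<kappa>: "0 < \<kappa>" "\<forall>\<^sub>F x in F. \<forall>H. \<kappa> * norm H \<le> norm (\<Lambda> x H)"
    using eventually_lower_bound[OF lin lim inj] by metis
  have "((\<lambda>x. \<Lambda> x (v x) - \<Lambda> x v0) \<longlongrightarrow> 0) F"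
    using tendsto_diff[OF rhs lim[of v0]] by simp
  then have "((\<lambda>x. norm (\<Lambda> x (v x) - \<Lambda> x v0) / \<kappa>) \<longlongrightarrow> norm (0::'w) / \<kappa>) F"
    by (intro tendsto_intros) (use \<kappa> in auto)
  then have "((\<lambda>x. v x - v0) \<longlongrightarrow> 0) F"
  proof (rule Lim_null_comparison[rotated, OF tendsto_eq_rhs])
    show "\<forall>\<^sub>F x in F. norm (v x - v0) \<le> norm (\<Lambda> x (v x) - \<Lambda> x v0) / \<kappa>"
      using \<kappa>(2)
    proof eventually_elim
      case (elim x)
      then have "\<kappa> * norm (v x - v0) \<le> norm (\<Lambda> x (v x - v0))" by blast
      then show ?case
        using \<kappa>(1) lin(1) by (simp add: linear_diff field_simps)
    qed
  qed simp
  then show ?thesis by (simp add: LIM_zero_iff)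
qed

text \<open>Zeros of \<open>\<Phi> t\<close> that stay in a compact set can accumulate, as \<open>t\<close> tends to zero, only at zeros of
\<open>\<Phi> 0\<close>. In the proof, the parameters of the zeros outside a neighbourhood \<open>V\<close> of \<open>l\<close> form a compact
set that does not contain zero.\<close>

lemma tendsto_unique_zero_in_compact:
  fixes \<Phi> :: "real \<Rightarrow> 'v::metric_space \<Rightarrow> 'w::real_normed_vector"
  assumes S: "compact S" and e: "0 < e"
    and cont: "continuous_on ({0..e} \<times> S) (\<lambda>(t, y). \<Phi> t y)"
    and unique: "\<And>y. y \<in> S \<Longrightarrow> \<Phi> 0 y = 0 \<Longrightarrow> y = l"
    and f: "\<And>t. 0 < t \<Longrightarrow> t \<le> e \<Longrightarrow> f t \<in> S \<and> \<Phi> t (f t) = 0"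
  shows "(f \<longlongrightarrow> l) (at_right 0)"
proof (rule topological_tendstoI)
  fix V assume V: "open V" "l \<in> V"
  define Z where "Z = {x \<in> {0..e} \<times> S. (case x of (t, y) \<Rightarrow> \<Phi> t y) = 0} \<inter> (UNIV \<times> - V)"
  have cS: "compact ({0..e} \<times> S)" using S by (simp add: compact_Times)
  then have "closed {x \<in> {0..e} \<times> S. (case x of (t, y) \<Rightarrow> \<Phi> t y) = 0}"
    by (intro continuous_closed_preimage_constant[OF cont] compact_imp_closed)
  moreover have "closed ((UNIV::real set) \<times> - V)"
    using V(1) by (intro closed_Times) auto
  ultimately have "closed Z" unfolding Z_def by (rule closed_Int)
  then have "compact (({0..e} \<times> S) \<inter> Z)"
    using cS by (simp add: compact_Int_closed)
  moreover have "({0..e} \<times> S) \<inter> Z = Z"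
    unfolding Z_def by blast
  ultimately have "compact Z" by simp
  then have "compact (fst ` Z)"
    by (intro compact_continuous_image continuous_on_fst continuous_on_id)
  then have "open (- (fst ` Z))" by (simp add: compact_imp_closed open_Compl)
  moreover have "0 \<in> - (fst ` Z)"
    using unique V(2) by (auto simp: Z_def)
  ultimately obtain d where d: "0 < d" "ball 0 d \<subseteq> - (fst ` Z)"
    by (meson open_contains_ball)
  have "f t \<in> V" if "0 < t" "t < min d e" for t
  proof (rule ccontr)
    assume "f t \<notin> V"
    then have "(t, f t) \<in> Z" using f[of t] that by (auto simp: Z_def)
    then have "t \<in> fst ` Z" by force
    then show False using d that by (auto simp: subset_iff dist_norm)
  qed
  then show "\<forall>\<^sub>F t in at_right 0. f t \<in> V"
    unfolding eventually_at_right_field using d(1) e by (intro exI[of _ "min d e"]) auto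
qed

section \<open>Riccati equations of fluid queues\<close>

lemma minimal_nonneg_solution_unique:
  "minimal_nonneg_solution R S F X \<Longrightarrow> minimal_nonneg_solution R S F Y \<Longrightarrow> X = Y"
  unfolding minimal_nonneg_solution_def by (blast intro: order.antisym)

lemma nonneg_row_sums_eq_imp_eq:
  assumes "X \<le> (Y :: real ^ 'n ^ 'm)" "X *v 1 = Y *v 1"
  shows "X = Y"
proof -
  have "Y $ i $ j - X $ i $ j = 0" for i j
  proof -
    have "(\<Sum>j\<in>UNIV. Y $ i $ j - X $ i $ j) = 0"
      using assms(2) by (simp add: sum_subtractf vec_eq_iff matrix_vector_one_nth)
    then show ?thesis
      using assms(1) by (subst (asm) sum_nonneg_eq_0_iff) (auto simp: less_eq_vec_def)
  qed
  then show ?thesis by (simp add: vec_eq_iff)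
qed

text \<open>The a priori bound on first return probabilities: all solutions considered below are found in
this compact set.\<close>

definition substochastic :: "'s set \<Rightarrow> 's set \<Rightarrow> (real ^ 's ^ 's::finite) set"
  where "substochastic R S = {X. is_block R S X \<and> 0 \<le> X \<and> X *v 1 \<le> 1}"

lemma compact_substochastic: "compact (substochastic R S)"
proof -
  have "substochastic R S \<subseteq> {0..\<chi> i j. 1}"
  proof
    fix X assume X: "X \<in> substochastic R S"
    have "X $ i $ j \<le> 1" for i j
    proof -
      have "X $ i $ j \<le> (\<Sum>j\<in>UNIV. X $ i $ j)"
        using X by (intro member_le_sum) (auto simp: substochastic_def less_eq_vec_def)
      also have "\<dots> \<le> 1"
        using X by (auto simp: substochastic_def less_eq_vec_def matrix_vector_one_nth one_nth)
      finally show ?thesis .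
    qed
    then show "X \<in> {0..\<chi> i j. 1}"
      using X by (auto simp: substochastic_def less_eq_vec_def)
  qed
  then have "bounded (substochastic R S)"
    by (rule bounded_subset[OF bounded_closed_interval])
  moreover have "substochastic R S = (\<Inter>i. \<Inter>j. {X. \<not> (i \<in> R \<and> j \<in> S) \<longrightarrow> X $ i $ j = 0})
      \<inter> (\<Inter>i. \<Inter>j. {X. 0 \<le> X $ i $ j}) \<inter> (\<Inter>i. {X. (\<Sum>j\<in>UNIV. X $ i $ j) \<le> 1})"
    by (auto simp: substochastic_def is_block_def less_eq_vec_def matrix_vector_one_nth one_nth)
  moreover have "closed \<dots>"
    by (intro closed_Int closed_INT ballI closed_Collect_imp closed_Collect_eq closed_Collect_le
        continuous_intros open_Collect_const) 
  ultimately show ?thesis by (simp add: compact_eq_bounded_closed)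
qed

text \<open>The nonsymmetric algebraic Riccati equation of a fluid queue whose rates are all \<open>1\<close> on \<open>P\<close> and \<open>-1\<close> on
\<open>M\<close>, after a change of time that absorbs the modulus of the rates into the generator with blocks \<open>D\<close>,
\<open>E\<close>, \<open>F\<close>, \<open>G\<close>. Row sums may be negative, which corresponds to killing.\<close>

locale nare_blocks =
  fixes P M :: "'s::finite set" and D E F G :: "real ^ 's ^ 's"
  assumes disjoint: "P \<inter> M = {}"
    and blocks: "is_block P P D" "is_block P M E" "is_block M P F" "is_block M M G"
    and signs: "metzler D" "0 \<le> E" "0 \<le> F" "metzler G"
    and row_sums: "D *v 1 + E *v 1 \<le> 0" "F *v 1 + G *v 1 \<le> 0"
begin

definition nare :: "real ^ 's ^ 's \<Rightarrow> real ^ 's ^ 's"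
  where "nare X = E + D ** X + X ** G + X ** F ** X"

text \<open>Shifting \<open>D\<close> and \<open>G\<close> by the same large multiple of the identity makes all coefficients nonnegative, so that
the Riccati equation becomes the fixed point equation of a monotone map.\<close>

lemma monotone_fixed_point_form:
  obtains d D' G' where "0 < d" "0 \<le> D'" "0 \<le> G'" "D = D' - d *\<^sub>R mat 1" "G = G' - d *\<^sub>R mat 1"
proof -
  define d where "d = 1 + (\<Sum>i\<in>UNIV. \<bar>D $ i $ i\<bar>) + (\<Sum>i\<in>UNIV. \<bar>G $ i $ i\<bar>)"
  have D: "\<bar>D $ i $ i\<bar> \<le> (\<Sum>i\<in>UNIV. \<bar>D $ i $ i\<bar>)" and G: "\<bar>G $ i $ i\<bar> \<le> (\<Sum>i\<in>UNIV. \<bar>G $ i $ i\<bar>)" for i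
    by (rule member_le_sum; simp)+
  have d: "0 \<le> D $ i $ i + d" "0 \<le> G $ i $ i + d" for i
    using D[of i] G[of i] by (auto simp: d_def)
  show ?thesis
  proof (rule that[of d "D + d *\<^sub>R mat 1" "G + d *\<^sub>R mat 1"])
    show "0 < d" unfolding d_def by (intro add_pos_nonneg sum_nonneg) auto
    show "0 \<le> D + d *\<^sub>R mat 1" "0 \<le> G + d *\<^sub>R mat 1"
      using signs d by (auto simp: less_eq_vec_def metzler_def mat_def)
  qed auto
qed

text \<open>Iterating this monotone map from zero produces an increasing sequence. It preserves the
substochastic matrices, hence converges, and it stays below every nonnegative solution, so the
limit is minimal.\<close>

lemma minimal_solution_exists:
  "\<exists>X. minimal_nonneg_solution P M nare X \<and> X \<in> substochastic P M"
proof -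
  obtain d D' G' where d: "0 < d" and nonneg: "0 \<le> D'" "0 \<le> G'"
    and DG: "D = D' - d *\<^sub>R mat 1" "G = G' - d *\<^sub>R mat 1"
    by (rule monotone_fixed_point_form)
  define step where "step X = (1 / (2 * d)) *\<^sub>R (E + D' ** X + X ** G' + X ** F ** X)" for X
  have nare_eq: "nare X = (2 * d) *\<^sub>R (step X - X)" for X
  proof -
    have "D ** X = D' ** X - d *\<^sub>R X" "X ** G = X ** G' - d *\<^sub>R X"
      unfolding DG by (simp_all add: matrix_algebra)
    moreover have "(2 * d) *\<^sub>R step X = E + D' ** X + X ** G' + X ** F ** X"
      using d by (simp add: step_def)
    moreover have "(2 * d) *\<^sub>R X = d *\<^sub>R X + d *\<^sub>R X"
      by (simp flip: scaleR_add_left)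
    ultimately show ?thesis
      by (simp add: nare_def scaleR_diff_right)
  qed
  have fixed: "nare X = 0 \<longleftrightarrow> step X = X" for X
    using d by (simp add: nare_eq)
  have step_mono: "step X \<le> step Y" if "0 \<le> X" "X \<le> Y" for X Y
  proof -
    have Y: "0 \<le> Y" using that by (rule order_trans)
    have "0 \<le> D' ** (Y - X) + (Y - X) ** G' + ((Y - X) ** F ** Y + X ** F ** (Y - X))"
      using that Y nonneg signs by (intro add_nonneg_nonneg matrix_nonneg_mult) auto
    then have "E + D' ** X + X ** G' + X ** F ** X \<le> E + D' ** Y + Y ** G' + Y ** F ** Y"
      by (simp add: matrix_algebra algebra_simps)
    then show ?thesis unfolding step_def using d by (intro scaleR_left_mono) auto
  qed
  have step_block: "is_block P M (step X)" if "is_block P M X" for X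
  proof -
    have "step X = (1 / (2 * d)) *\<^sub>R nare X + X"
      using d by (simp add: nare_eq)
    also have "is_block P M \<dots>"
      unfolding nare_def using that blocks by (intro is_block_intros) 
    finally show ?thesis .
  qed
  \<comment> \<open>The row sums of the shifted blocks are at most \<open>d\<close>, which accounts for half of the normalization \<open>2 * d\<close> each.\<close>
  have step_sub: "step X \<in> substochastic P M" if X: "X \<in> substochastic P M" for X
  proof -
    have X': "0 \<le> X" "X *v 1 \<le> 1" "is_block P M X" using X by (auto simp: substochastic_def)
    have rs: "D' *v 1 + E *v 1 \<le> d *\<^sub>R 1" "F *v 1 + G' *v 1 \<le> d *\<^sub>R 1"
      using row_sums by (simp_all add: DG matrix_vector_algebra algebra_simps)
    have "(E + D' ** X + X ** G' + X ** F ** X) *v 1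
        = E *v 1 + D' *v (X *v 1) + X *v (G' *v 1 + F *v (X *v 1))"
      by (simp add: matrix_vector_algebra algebra_simps)
    also have "\<dots> \<le> E *v 1 + D' *v 1 + X *v (G' *v 1 + F *v 1)"
      using X' nonneg signs by (intro add_mono order_refl matrix_vector_mono) auto
    also have "\<dots> \<le> E *v 1 + D' *v 1 + X *v (d *\<^sub>R 1)"
      using X' rs by (intro add_mono order_refl matrix_vector_mono) (auto simp: add.commute)
    also have "\<dots> \<le> d *\<^sub>R 1 + d *\<^sub>R 1"
      using rs X' d by (intro add_mono) (auto simp: add.commute matrix_vector_mult_scaleR intro!: scaleR_left_mono)
    finally have "step X *v 1 \<le> (1 / (2 * d)) *\<^sub>R (d *\<^sub>R 1 + d *\<^sub>R 1)"
      unfolding step_def matrix_vector_scaleR_left using d by (intro scaleR_left_mono) auto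
    also have "\<dots> = 1" using d by (simp add: vec_eq_iff one_nth)
    finally have "step X *v 1 \<le> 1" .
    moreover have "0 \<le> step X"
      unfolding step_def using X' nonneg signs d
      by (intro scaleR_nonneg_nonneg add_nonneg_nonneg matrix_nonneg_mult) auto
    ultimately show ?thesis
      using step_block[OF X'(3)] by (simp add: substochastic_def)
  qed
  define X where "X n = (step ^^ n) 0" for n
  have X_sub: "X n \<in> substochastic P M" for n
  proof (induction n)
    case 0
    show ?case
      by (simp add: X_def substochastic_def is_block_zero less_eq_vec_def one_nth)
  next
    case (Suc n)
    then show ?case using step_sub by (simp add: X_def)
  qed
  have X_nonneg: "0 \<le> X n" for n using X_sub[of n] by (simp add: substochastic_def)
  have X_Suc: "X n \<le> X (Suc n)" for n
  proof (induction n)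
    case 0
    show ?case using X_nonneg[of 1] by (simp add: X_def)
  next
    case (Suc n)
    then have "step (X n) \<le> step (X (Suc n))" by (rule step_mono[OF X_nonneg])
    then show ?case by (simp add: X_def)
  qed
  have "\<exists>L. (\<lambda>n. X n $ i $ j) \<longlonglongrightarrow> L" for i j
  proof -
    have "incseq (\<lambda>n. X n $ i $ j)"
      using X_Suc by (intro incseq_SucI) (simp add: less_eq_vec_def)
    moreover have "bounded (range X)"
      using X_sub compact_imp_bounded[OF compact_substochastic]
      by (meson bounded_subset image_subsetI)
    then obtain B where "norm (X n) \<le> B" for n
      by (auto simp: bounded_iff)
    then have B: "norm (X n) \<le> B" for n .
    have "X n $ i $ j \<le> B" for n
      using component_le_norm_cart[of "X n $ i" j] Finite_Cartesian_Product.norm_nth_le[of "X n" i] B[of n]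
      by linarith
    ultimately show ?thesis using incseq_convergent by metis
  qed
  then obtain L where "\<And>i j. (\<lambda>n. X n $ i $ j) \<longlonglongrightarrow> L i j" by metis
  then have lim: "X \<longlonglongrightarrow> (\<chi> i j. L i j)"
    by (intro vec_tendstoI) simp
  define Z where "Z = (\<chi> i j. L i j)"
  have lim: "X \<longlonglongrightarrow> Z" using lim by (simp add: Z_def)
  have "(\<lambda>n. step (X n)) \<longlonglongrightarrow> step Z"
    unfolding step_def by (intro tendsto_intros lim)
  moreover have "(\<lambda>n. step (X n)) \<longlonglongrightarrow> Z"
    using LIMSEQ_Suc[OF lim] by (simp add: X_def)
  ultimately have "step Z = Z" by (rule LIMSEQ_unique)
  moreover have Zsub: "Z \<in> substochastic P M"
    using closed_sequentially[OF compact_imp_closed[OF compact_substochastic]] X_sub lim by blast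
  moreover have "Z \<le> Y" if Y: "is_block P M Y" "0 \<le> Y" "nare Y = 0" for Y
  proof -
    have "X n \<le> Y" for n
    proof (induction n)
      case 0
      show ?case using Y by (simp add: X_def)
    next
      case (Suc n)
      then have "step (X n) \<le> step Y" by (rule step_mono[OF X_nonneg])
      then show ?case using Y fixed by (simp add: X_def)
    qed
    then have "L i j \<le> Y $ i $ j" for i j
      using \<open>(\<lambda>n. X n $ i $ j) \<longlonglongrightarrow> L i j\<close>
      by (intro LIMSEQ_le_const2) (auto simp: less_eq_vec_def)
    then show ?thesis by (simp add: Z_def less_eq_vec_def)
  qed
  ultimately show ?thesis
    unfolding minimal_nonneg_solution_def substochastic_def fixed by auto
qed

end

text \<open>No killing, and negative drift. The assumption \<open>left_null\<close> says that the generator has, up to scaling,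
one invariant measure, whose parts on \<open>P\<close> and \<open>M\<close> are \<open>a\<close> and \<open>b\<close>; in the changed time the drift is
\<open>a \<bullet> 1 - b \<bullet> 1\<close>.\<close>

locale recurrent_nare = nare_blocks P M D E F G
  for P M :: "'s::finite set" and D E F G :: "real ^ 's ^ 's" +
  fixes a b :: "real ^ 's"
  assumes conservative: "D *v 1 + E *v 1 = 0" "F *v 1 + G *v 1 = 0"
    and drift: "0 \<le> a" "a \<bullet> 1 < b \<bullet> 1"
    and left_null: "\<And>y w. (\<And>i. i \<notin> P \<Longrightarrow> y $ i = 0) \<Longrightarrow> (\<And>i. i \<notin> M \<Longrightarrow> w $ i = 0) \<Longrightarrow>
      y v* D + w v* F = 0 \<Longrightarrow> y v* E + w v* G = 0 \<Longrightarrow> \<exists>t. y = t *\<^sub>R a \<and> w = t *\<^sub>R b"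
begin

text \<open>The matrix \<open>K\<close> of a solution, completed by minus the identity outside \<open>P\<close>, so that statements about
the \<open>P \<times> P\<close> matrix \<open>K\<close> become statements about an invertible matrix on all phases.\<close>

definition Kfull :: "real ^ 's ^ 's \<Rightarrow> real ^ 's ^ 's"
  where "Kfull X = D + X ** F - block (- P) (- P) (mat 1)"

lemma is_block_K: "is_block P M X \<Longrightarrow> is_block P P (D + X ** F)"
  using blocks by (intro is_block_intros)

lemma Kfull_mult_P:
  assumes "is_block P M X" "\<And>i. i \<notin> P \<Longrightarrow> v $ i = 0"
  shows "Kfull X *v v = (D + X ** F) *v v"
proof -
  have "block (- P) (- P) (mat 1) *v v = 0"
    using assms(2) by (auto simp: vec_eq_iff matrix_vector_mult_def block_nth mat_def intro!: sum.neutral)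
  then show ?thesis by (simp add: Kfull_def matrix_vector_algebra)
qed

text \<open>If \<open>x K = 0\<close>, then by the Riccati equation the pair \<open>(x, x X)\<close> is a left null vector of the generator, hence
equal to \<open>t (a, b)\<close>. As \<open>X\<close> is substochastic, \<open>t \<noteq> 0\<close> would give \<open>b \<bullet> 1 = a \<bullet> (X 1) \<le> a \<bullet> 1\<close>,
contrary to the drift condition.\<close>

lemma Kfull_left_injective:
  assumes X: "X \<in> substochastic P M" "nare X = 0" and x: "x v* Kfull X = 0"
  shows "x = 0"
proof -
  have X': "0 \<le> X" "X *v 1 \<le> 1" "is_block P M X" using X by (auto simp: substochastic_def)
  have supp: "x $ j = 0" if "j \<notin> P" for j
  proof -
    have Kj: "Kfull X $ i $ j = (if i = j then - 1 else 0)" for i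
      using that is_blockD[OF is_block_K[OF X'(3)], of i j]
      by (auto simp: Kfull_def block_nth mat_def)
    have "(x v* Kfull X) $ j = - x $ j"
      by (simp add: vector_matrix_mult_def Kj if_distrib[where f = "\<lambda>x. _ * x"]
          if_distrib[where f = "\<lambda>x. x * _"] cong: if_cong)
    then show ?thesis using x by simp
  qed
  have "x v* block (- P) (- P) (mat 1) = 0"
    using supp by (auto simp: vec_eq_iff vector_matrix_mult_def block_nth mat_def intro!: sum.neutral)
  then have xK: "x v* (D + X ** F) = 0"
    using x by (simp add: Kfull_def vector_matrix_mult_diff_rdistrib vector_matrix_mult_add_rdistrib)
  have EXG: "E + X ** G = - ((D + X ** F) ** X)"
    using X(2) by (simp add: nare_def matrix_algebra add_eq_0_iff2 algebra_simps)
  have "\<exists>t. x = t *\<^sub>R a \<and> x v* X = t *\<^sub>R b"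
  proof (rule left_null[OF supp])
    show "(x v* X) $ i = 0" if "i \<notin> M" for i
      using that X'(3) by (auto simp: is_block_def vector_matrix_mult_def)
    show "x v* D + (x v* X) v* F = 0"
      using xK by (simp add: vector_matrix_mult_add_rdistrib vector_matrix_mul_assoc)
    have "x v* E + (x v* X) v* G = x v* (E + X ** G)"
      by (simp add: vector_matrix_mult_add_rdistrib vector_matrix_mul_assoc)
    also have "\<dots> = - ((x v* (D + X ** F)) v* X)"
      unfolding EXG vector_matrix_mul_assoc by (rule vector_matrix_minus_right)
    also have "\<dots> = 0" unfolding xK by simp
    finally show "x v* E + (x v* X) v* G = 0" .
  qed
  then obtain t where t: "x = t *\<^sub>R a" "x v* X = t *\<^sub>R b" by blast
  have "t * (b \<bullet> 1) = (x v* X) \<bullet> 1" by (simp add: t(2))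
  also have "\<dots> = t * (a \<bullet> (X *v 1))" by (simp add: dot_lmul_matrix t(1))
  finally have "t = 0 \<or> b \<bullet> 1 = a \<bullet> (X *v 1)" by simp
  moreover have "a \<bullet> (X *v 1) \<le> a \<bullet> 1"
    using drift(1) X'(2) by (rule inner_nonneg_mono)
  ultimately have "t = 0" using drift(2) by auto
  then show ?thesis using t(1) by simp
qed

lemma Kfull_injective:
  assumes X: "X \<in> substochastic P M" "nare X = 0" and x: "Kfull X *v x = 0"
  shows "x = 0"
proof -
  obtain B where "B ** transpose (Kfull X) = mat 1"
    using Kfull_left_injective[OF X] matrix_left_invertible_ker[of "transpose (Kfull X)"] by auto
  then have "Kfull X ** transpose B = mat 1"
    by (metis matrix_transpose_mul transpose_mat transpose_transpose)
  then have "transpose B ** Kfull X = mat 1" by (simp add: matrix_left_right_inverse)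
  then show ?thesis
    using x by (metis matrix_vector_mul_assoc matrix_vector_mul_lid matrix_vector_mult_0_right)
qed

text \<open>The Riccati equation applied to the vector of ones, with the row sums of the generator inserted. For
an exact solution it says that \<open>K\<close> annihilates the deficit of the row sums.\<close>

lemma K_mult_deficit:
  assumes "is_block P M X"
  shows "Kfull X *v (ind P - X *v 1) = - (nare X *v 1)"
proof -
  have "Kfull X *v (ind P - X *v 1) = (D + X ** F) *v (ind P - X *v 1)"
    by (rule Kfull_mult_P[OF assms]) (simp add: block_mult_vector_outside[OF assms])
  also have "\<dots> = (D + X ** F) *v 1 - (D + X ** F) *v (X *v 1)"
    using is_block_mult_ind[OF is_block_K[OF assms]] by (simp add: matrix_vector_mult_diff_distrib)
  also have "\<dots> = (D *v 1 + E *v 1) + X *v (F *v 1 + G *v 1) - nare X *v 1"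
    by (simp add: nare_def matrix_vector_algebra)
  finally show ?thesis by (simp add: conservative)
qed

lemma solution_stochastic:
  assumes X: "X \<in> substochastic P M" "nare X = 0"
  shows "X *v 1 = ind P"
proof -
  have "Kfull X *v (ind P - X *v 1) = 0"
    using K_mult_deficit[of X] X by (simp add: substochastic_def)
  from Kfull_injective[OF X this] show ?thesis by simp
qed

text \<open>The minimal solution lies below every other one and has the same row sums.\<close>

lemma substochastic_solution_unique:
  assumes "X \<in> substochastic P M" "nare X = 0" "Y \<in> substochastic P M" "nare Y = 0"
  shows "X = Y"
proof -
  obtain Z where Z: "minimal_nonneg_solution P M nare Z" "Z \<in> substochastic P M"
    using minimal_solution_exists by blast
  have "Z = X" if X: "X \<in> substochastic P M" "nare X = 0" for X
  proof (rule nonneg_row_sums_eq_imp_eq)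
    show "Z \<le> X" using Z(1) X by (auto simp: minimal_nonneg_solution_def substochastic_def)
    show "Z *v 1 = X *v 1"
      using solution_stochastic[OF X] solution_stochastic[OF Z(2)] Z(1)
      by (simp add: minimal_nonneg_solution_def)
  qed
  then show ?thesis using assms by metis
qed

text \<open>The first return probabilities of the process that is killed at rate \<open>s\<close>: replacing \<open>D\<close> and \<open>G\<close> by
\<open>D - s\<close> and \<open>G - s\<close> changes \<open>nare X\<close> by \<open>- 2 s X\<close>.\<close>

definition discounted_solution :: "real \<Rightarrow> real ^ 's ^ 's"
  where "discounted_solution s = (SOME X. X \<in> substochastic P M \<and> nare X = (2 * s) *\<^sub>R X)"

lemma discounted_solution:
  assumes "0 < s"
  shows "discounted_solution s \<in> substochastic P M"
    and "nare (discounted_solution s) = (2 * s) *\<^sub>R discounted_solution s"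
proof -
  let ?I = "\<lambda>S. block S S (mat 1) :: real ^ 's ^ 's"
  have I: "0 \<le> ?I S *v 1" for S
    by (intro matrix_vector_nonneg_mult) (auto simp: less_eq_vec_def block_nth mat_def one_nth)
  interpret d: nare_blocks P M "D - s *\<^sub>R ?I P" E F "G - s *\<^sub>R ?I M"
  proof unfold_locales
    show "P \<inter> M = {}" "is_block P M E" "is_block M P F" "0 \<le> E" "0 \<le> F"
      by (fact disjoint blocks signs)+
    show "is_block P P (D - s *\<^sub>R ?I P)" "is_block M M (G - s *\<^sub>R ?I M)"
      using blocks by (simp_all add: is_block_diff is_block_scaleR)
    show "metzler (D - s *\<^sub>R ?I P)" "metzler (G - s *\<^sub>R ?I M)"
      using signs(1,4) by (simp_all add: metzler_def block_nth mat_def)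
    have "(D - s *\<^sub>R ?I P) *v 1 + E *v 1 = (D *v 1 + E *v 1) - s *\<^sub>R (?I P *v 1)"
      by (simp add: matrix_vector_mult_diff_rdistrib matrix_vector_scaleR_left)
    then show "(D - s *\<^sub>R ?I P) *v 1 + E *v 1 \<le> 0"
      unfolding conservative using scaleR_nonneg_nonneg[OF less_imp_le[OF assms] I[of P]] by simp
    have "F *v 1 + (G - s *\<^sub>R ?I M) *v 1 = (F *v 1 + G *v 1) - s *\<^sub>R (?I M *v 1)"
      by (simp add: matrix_vector_mult_diff_rdistrib matrix_vector_scaleR_left)
    then show "F *v 1 + (G - s *\<^sub>R ?I M) *v 1 \<le> 0"
      unfolding conservative using scaleR_nonneg_nonneg[OF less_imp_le[OF assms] I[of M]] by simp
  qed
  obtain X where X: "X \<in> substochastic P M" "d.nare X = 0"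
    using d.minimal_solution_exists unfolding minimal_nonneg_solution_def by blast
  have bX: "?I P ** X = X" "X ** ?I M = X"
    using X(1) by (simp_all add: substochastic_def is_block_mat_mult_left[of P M] is_block_mat_mult_right[of P M])
  have "d.nare X = nare X - s *\<^sub>R (?I P ** X) - s *\<^sub>R (X ** ?I M)"
    unfolding nare_def d.nare_def by (simp add: matrix_algebra)
  also have "\<dots> = nare X - (2 * s) *\<^sub>R X"
    unfolding bX mult_2 scaleR_add_left by (rule diff_diff_eq)
  finally have "nare X = (2 * s) *\<^sub>R X" using X(2) by simp
  with X(1) have "\<exists>X. X \<in> substochastic P M \<and> nare X = (2 * s) *\<^sub>R X" by blast
  from someI_ex[OF this] show "discounted_solution s \<in> substochastic P M"
    "nare (discounted_solution s) = (2 * s) *\<^sub>R discounted_solution s"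
    unfolding discounted_solution_def by (rule conjunct1, rule conjunct2)
qed

lemma continuous_on_nare:
  "continuous_on S (\<lambda>x. nare (f x))" if "continuous_on S f"
  unfolding nare_def by (intro continuous_intros that)

lemma discounted_solution_tendsto:
  assumes X: "X \<in> substochastic P M" "nare X = 0"
  shows "(discounted_solution \<longlongrightarrow> X) (at_right 0)"
proof (rule tendsto_unique_zero_in_compact[where \<Phi> = "\<lambda>s Y. nare Y - (2 * s) *\<^sub>R Y" and e = 1])
  show "continuous_on ({0..1} \<times> substochastic P M) (\<lambda>(s, Y). nare Y - (2 * s) *\<^sub>R Y)"
    unfolding case_prod_unfold by (intro continuous_intros continuous_on_nare)
qed (use X discounted_solution in \<open>auto intro: compact_substochastic substochastic_solution_unique\<close>)

text \<open>For the killed process \<open>K_mult_deficit\<close> reads \<open>K\<^sub>s v\<^sub>s = - 2 X\<^sub>s 1\<close>, where \<open>v\<^sub>s \<ge> 0\<close> is the deficit divided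
by \<open>s\<close>. Because \<open>K\<close> is invertible, \<open>v\<^sub>s\<close> converges to the solution \<open>h\<close> of \<open>K h = - 2 X 1\<close>, which is
therefore nonnegative. This replaces an analysis of the eigenvalues of \<open>K\<close>.\<close>

lemma K_decreased_vector:
  assumes X: "X \<in> substochastic P M" "nare X = 0"
  obtains h where "0 \<le> h" "Kfull X *v h = - 2 *\<^sub>R ind P"
proof -
  have "inj ((*v) (Kfull X))"
    using Kfull_injective[OF X] by (simp add: linear_injective_0)
  then have "surj ((*v) (Kfull X))"
    by (intro linear_injective_imp_surjective) auto
  then obtain h where h: "Kfull X *v h = - 2 *\<^sub>R ind P" by (metis surjD)
  let ?Y = "discounted_solution"
  define v where "v s = (1 / s) *\<^sub>R (ind P - ?Y s *v 1)" for s
  have Y: "?Y s \<in> substochastic P M" "is_block P M (?Y s)" "nare (?Y s) = (2 * s) *\<^sub>R ?Y s" if "0 < s" for s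
    using discounted_solution[OF that] by (auto simp: substochastic_def)
  have pos: "\<forall>\<^sub>F s in at_right 0. 0 < (s::real)"
    by (rule eventually_at_right_less)
  have "(v \<longlongrightarrow> h) (at_right 0)"
  proof (rule linear_solution_tendsto[where \<Lambda> = "\<lambda>s. (*v) (Kfull (?Y s))" and L = "(*v) (Kfull X)"])
    show "((\<lambda>s. Kfull (?Y s) *v H) \<longlongrightarrow> Kfull X *v H) (at_right 0)" for H
      unfolding Kfull_def by (intro tendsto_intros discounted_solution_tendsto[OF X])
    have "((\<lambda>s. - 2 *\<^sub>R (?Y s *v 1)) \<longlongrightarrow> - 2 *\<^sub>R (X *v 1)) (at_right 0)"
      by (intro tendsto_intros discounted_solution_tendsto[OF X])
    moreover have "\<forall>\<^sub>F s in at_right 0. - 2 *\<^sub>R (?Y s *v 1) = Kfull (?Y s) *v v s"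
      using pos
    proof eventually_elim
      case (elim s)
      then show ?case
        using K_mult_deficit[OF Y(2)] Y(3)
        by (simp add: v_def matrix_vector_mult_scaleR matrix_vector_scaleR_left)
    qed
    ultimately show "((\<lambda>s. Kfull (?Y s) *v v s) \<longlongrightarrow> Kfull X *v h) (at_right 0)"
      unfolding h by (subst (asm) tendsto_cong) (auto simp: solution_stochastic[OF X])
  qed (use Kfull_injective[OF X] in auto)
  moreover have "0 \<le> v s" if "0 < s" for s
  proof -
    have "(?Y s *v 1) $ i \<le> ind P $ i" for i
      using Y(1,2)[OF that] block_mult_vector_outside[of P M "?Y s" i 1]
      by (auto simp: substochastic_def less_eq_vec_def one_nth)
    then show ?thesis using that by (simp add: v_def less_eq_vec_def)
  qed
  ultimately have "0 \<le> h $ i" for i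
    using pos
    by (intro tendsto_lowerbound[of "\<lambda>s. v s $ i" _ "at_right 0"] tendsto_vec_nth)
      (auto simp: less_eq_vec_def elim!: eventually_mono)
  then show ?thesis using that[OF _ h] by (simp add: less_eq_vec_def)
qed

lemma metzler_Kfull:
  assumes "0 \<le> X"
  shows "metzler (Kfull X)"
proof -
  have "metzler (D + X ** F)"
    by (rule metzler_add_nonneg[OF signs(1) matrix_nonneg_mult[OF assms signs(3)]])
  then have "0 \<le> (D + X ** F) $ i $ j" if "i \<noteq> j" for i j
    using that unfolding metzler_def by blast
  then show ?thesis
    unfolding metzler_def Kfull_def by (simp add: block_nth mat_def)
qed

text \<open>By \<open>K_decreased_vector\<close> the vector \<open>h\<close>, set to one outside \<open>P\<close>, is positive and is made negative by \<open>Kfull X\<close>.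
Hence \<open>- Kfull X\<close> has a nonnegative inverse, and \<open>y\<close> is the vector of its column sums.\<close>

lemma positive_left_weight:
  assumes X: "X \<in> substochastic P M" "nare X = 0"
  shows "\<exists>y. (\<forall>i. 0 < y $ i) \<and> y v* Kfull X = - 1"
proof -
  obtain h where h: "0 \<le> h" "Kfull X *v h = - 2 *\<^sub>R ind P"
    by (rule K_decreased_vector[OF X])
  have X0: "is_block P M X" "0 \<le> X" using X by (auto simp: substochastic_def)
  note T = metzler_Kfull[OF X0(2)]
  define g where "g = h + ind (- P)"
  have "Kfull X *v ind (- P) = - ind (- P)"
  proof -
    have "(D + X ** F) *v ind (- P) = 0"
      using is_block_K[OF X0(1)] by (auto simp: is_block_def vec_eq_iff matrix_vector_mult_def intro!: sum.neutral)
    moreover have "block (- P) (- P) (mat 1) *v ind (- P) = ind (- P)"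
    proof -
      have "(\<Sum>j\<in>UNIV. block (- P) (- P) (mat 1) $ i $ j * ind (- P) $ j)
          = (\<Sum>j\<in>UNIV. if j = i then ind (- P) $ i else 0)" for i
        by (rule sum.cong) (auto simp: block_nth mat_def)
      then show ?thesis by (simp add: vec_eq_iff matrix_vector_mult_def)
    qed
    ultimately show ?thesis by (simp add: Kfull_def matrix_vector_algebra)
  qed
  then have Kg: "Kfull X *v g = - 2 *\<^sub>R ind P - ind (- P)"
    by (simp add: g_def matrix_vector_right_distrib h(2))
  have "0 < g $ i" for i
  proof (rule metzler_positive_right[OF T])
    show "0 \<le> g" using h(1) by (auto simp: g_def less_eq_vec_def)
    show "(Kfull X *v g) $ i < 0" by (simp add: Kg)
  qed
  moreover have "Kfull X *v g \<le> 0" by (simp add: Kg less_eq_vec_def)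
  ultimately obtain N where N: "0 \<le> N" "N ** Kfull X = - mat 1"
    by (rule metzler_inverse_nonneg[OF T _ _ Kfull_left_injective[OF X]])
  define y where "y = 1 v* N"
  have y: "y v* Kfull X = - 1"
    by (simp add: y_def vector_matrix_mul_assoc N)
      (simp add: vec_eq_iff vector_matrix_mult_def mat_def one_nth sum_negf if_distrib cong: if_cong)
  have "0 < y $ i" for i
  proof (rule metzler_positive_right[OF metzler_transpose[OF T]])
    show "0 \<le> y" using N(1) by (auto simp: y_def less_eq_vec_def vector_matrix_mult_def one_nth intro!: sum_nonneg)
    show "(transpose (Kfull X) *v y) $ i < 0" using y by (simp add: one_nth)
  qed
  then show ?thesis using y by blast
qed

text \<open>Since \<open>K\<close> and \<open>U\<close> are Metzler matrices, \<open>K H + H U = 0\<close> implies \<open>0 \<le> K \<bar>H\<bar> + \<bar>H\<bar> U\<close>. Multiplying by \<open>y\<close> from the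
left and by the vector of ones from the right removes the second term, because \<open>U 1 = 0\<close>, and turns
the first into minus the sum of the moduli of all entries of \<open>H\<close>.\<close>

lemma sylvester_injective:
  assumes X: "X \<in> substochastic P M" "nare X = 0"
    and H: "is_block P M H" "(D + X ** F) ** H + H ** (G + F ** X) = 0"
  shows "H = 0"
proof -
  let ?K = "Kfull X" and ?U = "G + F ** X"
  have X0: "is_block P M X" "0 \<le> X" using X by (auto simp: substochastic_def)
  obtain y where y: "\<And>i. 0 < y $ i" "y v* ?K = - 1"
    using positive_left_weight[OF X] by blast
  have "block (- P) (- P) (mat 1) ** H = 0"
    by (rule block_mult_disjoint[OF is_block_block H(1)]) simp
  then have eq: "?K ** H + H ** ?U = 0"
    using H(2) by (simp add: Kfull_def matrix_algebra)
  have K: "metzler ?K" using X0(2) by (rule metzler_Kfull)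
  have U: "metzler ?U" by (rule metzler_add_nonneg[OF signs(4) matrix_nonneg_mult[OF signs(3) X0(2)]])
  have "?U *v 1 = G *v 1 + F *v (X *v 1)" by (simp add: matrix_vector_algebra)
  also have "\<dots> = 0"
    using is_block_mult_ind[OF blocks(3)] conservative(2) by (simp add: solution_stochastic[OF X] add.commute)
  finally have U1: "?U *v 1 = 0" .
  have nonneg: "0 \<le> ?K ** \<bar>H\<bar> + \<bar>H\<bar> ** ?U"
  proof -
    have "0 \<le> (\<Sum>k\<in>UNIV. ?K $ i $ k * \<bar>H $ k $ j\<bar>) + (\<Sum>k\<in>UNIV. \<bar>H $ i $ k\<bar> * ?U $ k $ j)" for i j
    proof -
      define s where "s = sgn (H $ i $ j)"
      have s: "s * H $ i $ j = \<bar>H $ i $ j\<bar>" "\<bar>s\<bar> \<le> 1"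
        by (auto simp: s_def abs_sgn mult.commute abs_sgn_eq)
      have s': "s * x \<le> \<bar>x\<bar>" for x
        using s(2) mult_right_mono[of "\<bar>s\<bar>" 1 "\<bar>x\<bar>"] abs_ge_self[of "s * x"] by (simp add: abs_mult)
      have "0 = s * (?K ** H + H ** ?U) $ i $ j" by (simp add: eq)
      also have "\<dots> = (\<Sum>k\<in>UNIV. ?K $ i $ k * (s * H $ k $ j)) + (\<Sum>k\<in>UNIV. (s * H $ i $ k) * ?U $ k $ j)"
        by (simp add: matrix_matrix_mult_def sum_distrib_left distrib_left mult.left_commute mult.assoc)
      also have "\<dots> \<le> (\<Sum>k\<in>UNIV. ?K $ i $ k * \<bar>H $ k $ j\<bar>) + (\<Sum>k\<in>UNIV. \<bar>H $ i $ k\<bar> * ?U $ k $ j)"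
      proof (intro add_mono sum_mono)
        fix k
        show "?K $ i $ k * (s * H $ k $ j) \<le> ?K $ i $ k * \<bar>H $ k $ j\<bar>"
          using K s s' by (cases "k = i") (auto simp: metzler_def intro!: mult_left_mono)
        show "(s * H $ i $ k) * ?U $ k $ j \<le> \<bar>H $ i $ k\<bar> * ?U $ k $ j"
          using U s s' by (cases "k = j") (auto simp: metzler_def intro!: mult_right_mono)
      qed
      finally show ?thesis .
    qed
    then show ?thesis by (simp add: less_eq_vec_def matrix_matrix_mult_def abs_vec_def)
  qed
  have "0 \<le> y" using y(1) by (simp add: less_eq_vec_def less_imp_le)
  then have "y \<bullet> 0 \<le> y \<bullet> ((?K ** \<bar>H\<bar> + \<bar>H\<bar> ** ?U) *v 1)"
    using nonneg by (intro inner_nonneg_mono matrix_vector_nonneg_mult) (auto simp: less_eq_vec_def one_nth)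
  also have "\<dots> = (y v* ?K) \<bullet> (\<bar>H\<bar> *v 1) + y \<bullet> (\<bar>H\<bar> *v (?U *v 1))"
    unfolding matrix_vector_mult_add_rdistrib matrix_vector_mul_assoc[symmetric] inner_add_right
    by (simp only: dot_lmul_matrix)
  also have "\<dots> = - (\<Sum>i\<in>UNIV. \<Sum>j\<in>UNIV. \<bar>H $ i $ j\<bar>)"
    by (simp add: y(2) U1 inner_commute[of 1] inner_one matrix_vector_one_nth abs_vec_def)
  finally have "(\<Sum>i\<in>UNIV. \<Sum>j\<in>UNIV. \<bar>H $ i $ j\<bar>) = 0"
    by (intro order.antisym sum_nonneg) auto
  then have "\<bar>H $ i $ j\<bar> = 0" for i j
    by (auto simp: sum_nonneg_eq_0_iff sum_nonneg)
  then show ?thesis by (simp add: vec_eq_iff)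
qed

text \<open>Blocks are embedded in square matrices, on which \<open>H \<mapsto> K H + H U\<close> is not injective; it is completed by the
identity on the entries outside \<open>P \<times> M\<close>.\<close>

lemma sylvester_unique_solution:
  assumes X: "X \<in> substochastic P M" "nare X = 0" and R: "is_block P M R"
  shows "\<exists>!H. is_block P M H \<and> (D + X ** F) ** H + H ** (G + F ** X) = R"
proof -
  have X0: "is_block P M X" using X by (simp add: substochastic_def)
  define S where "S H = (D + X ** F) ** H + H ** (G + F ** X)" for H
  define L where "L H = S (block P M H) + (H - block P M H)" for H
  have bS: "is_block P M (S H)" if "is_block P M H" for H
    unfolding S_def using blocks X0 that by (intro is_block_intros)
  have S_add: "S (H + H') = S H + S H'" and S_scale: "S (r *\<^sub>R H) = r *\<^sub>R S H" for H H' r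
    by (simp_all add: S_def matrix_algebra scaleR_add_right)
  have S_diff: "S (H - H') = S H - S H'" for H H'
    by (simp add: S_def matrix_algebra)
  interpret B: linear "block P M" by (rule linear_block)
  have L: "linear L"
    by (rule linearI) (simp_all add: L_def B.add B.scale S_add S_scale scaleR_add_right scaleR_diff_right)
  have bL: "block P M (L H) = S (block P M H)" for H
    unfolding L_def B.add B.diff
    by (simp add: block_id bS)
  have "inj L"
    unfolding linear_injective_0[OF L]
  proof (intro allI impI)
    fix H assume H: "L H = 0"
    then have "S (block P M H) = 0" using bL[of H] B.zero by simp
    then have "block P M H = 0"
      using sylvester_injective[OF X is_block_block] by (simp add: S_def)
    then show "H = 0" using H \<open>S (block P M H) = 0\<close> by (simp add: L_def)
  qed
  then obtain H where H: "L H = R" using linear_inj_imp_surj[OF L] by (metis surjD)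
  then have "S (block P M H) = R" using bL[of H] R by (simp add: block_id)
  moreover have "H' = H''" if "is_block P M H'" "S H' = R" "is_block P M H''" "S H'' = R" for H' H''
  proof -
    have "S (H' - H'') = 0" using that by (simp add: S_diff)
    then have "H' - H'' = 0"
      unfolding S_def by (rule sylvester_injective[OF X is_block_diff[OF that(1,3)]])
    then show ?thesis by simp
  qed
  ultimately show ?thesis using is_block_block[of P M H] unfolding S_def by blast
qed

end

section \<open>Analytic branches of solutions\<close>

text \<open>The secant identity replaces differentiability in the state: \<open>\<Lambda> z X Y\<close> is a linear map that
takes the increment of the state to the increment of \<open>F z\<close>. With the inverse \<open>J\<close> of
\<open>\<Lambda> 0 X0 X0\<close>, the map \<open>X \<mapsto> X - J (F z X)\<close> is a contraction of a small ball around \<open>X0\<close>. The uniform lower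
bound on the secant maps is what gives uniqueness and regularity of the branch.\<close>

lemma solution_branch_exists:
  fixes F :: "complex \<Rightarrow> 'v::euclidean_space \<Rightarrow> 'v" and \<Lambda> :: "complex \<Rightarrow> 'v \<Rightarrow> 'v \<Rightarrow> 'v \<Rightarrow> 'v"
  assumes lin: "\<And>z X Y. linear (\<Lambda> z X Y)"
    and secant: "\<And>z X Y. F z X - F z Y = \<Lambda> z X Y (X - Y)"
    and cont: "\<And>H. ((\<lambda>(z, X, Y). \<Lambda> z X Y H) \<longlongrightarrow> \<Lambda> 0 X0 X0 H) (nhds (0, X0, X0))"
    and inj: "\<And>H. \<Lambda> 0 X0 X0 H = 0 \<Longrightarrow> H = 0"
    and zero: "F 0 X0 = 0" "((\<lambda>z. F z X0) \<longlongrightarrow> 0) (nhds 0)"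
  obtains \<rho> r \<kappa> X where "0 < \<rho>" "0 < r" "0 < \<kappa>"
    "\<And>z. z \<in> ball 0 \<rho> \<Longrightarrow> X z \<in> cball X0 r" "\<And>z. z \<in> ball 0 \<rho> \<Longrightarrow> F z (X z) = 0"
    "\<And>z A B H. z \<in> ball 0 \<rho> \<Longrightarrow> A \<in> cball X0 r \<Longrightarrow> B \<in> cball X0 r \<Longrightarrow> \<kappa> * norm H \<le> norm (\<Lambda> z A B H)"
proof -
  let ?L = "\<Lambda> 0 X0 X0"
  have "inj ?L" using inj linear_injective_0[OF lin] by blast
  then obtain J where J: "linear J" "\<And>H. J (?L H) = H" "\<And>H. ?L (J H) = H"
    using linear_injective_isomorphism[OF lin] by metis
  obtain B where B: "0 < B" "\<And>H. norm (J H) \<le> B * norm H"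
    using linear_bounded_pos[OF J(1)] by metis
  \<comment> \<open>With this bound on the deviation of the secant maps, the contraction has constant one half.\<close>
  define e where "e = 1 / (2 * B)"
  have e: "0 < e" using B by (simp add: e_def)
  have "\<forall>\<^sub>F x in nhds (0, X0, X0). \<forall>H. norm ((case x of (z, X, Y) \<Rightarrow> \<Lambda> z X Y) H - ?L H) \<le> e * norm H"
    by (rule eventually_linear_close)
      (use lin cont e in \<open>auto simp: case_prod_unfold\<close>)
  then obtain d where d: "0 < d"
    "\<And>z X Y H. dist (z, X, Y) (0, X0, X0) < d \<Longrightarrow> norm (\<Lambda> z X Y H - ?L H) \<le> e * norm H"
    unfolding eventually_nhds_metric by auto
  \<comment> \<open>The three distances of the parameter and the two states then add up to less than the radius of validity.\<close>
  define r where "r = d / 4"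
  have r: "0 < r" using d by (simp add: r_def)
  have "\<forall>\<^sub>F z in nhds 0. dist (F z X0) 0 < e * r"
    using zero(2) by (rule tendstoD) (use e r in simp)
  then obtain \<delta> where \<delta>: "0 < \<delta>" "\<And>z. dist z 0 < \<delta> \<Longrightarrow> norm (F z X0) < e * r"
    unfolding eventually_nhds_metric by auto
  define \<rho> where "\<rho> = min \<delta> r"
  have close: "norm (\<Lambda> z X Y H - ?L H) \<le> e * norm H"
    if "z \<in> ball 0 \<rho>" "X \<in> cball X0 r" "Y \<in> cball X0 r" for z X Y H
  proof (rule d(2))
    have "dist (X, Y) (X0, X0) \<le> dist X X0 + dist Y X0"
      unfolding dist_Pair_Pair by (rule sqrt_sum_squares_le_sum) auto
    moreover have "dist (z, X, Y) (0, X0, X0) \<le> dist z 0 + dist (X, Y) (X0, X0)"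
      by (subst dist_Pair_Pair) (rule sqrt_sum_squares_le_sum; simp)
    ultimately have "dist (z, X, Y) (0, X0, X0) \<le> dist z 0 + dist X X0 + dist Y X0" by simp
    also have "\<dots> < d"
      using that r unfolding \<rho>_def mem_ball mem_cball dist_commute[of X0] dist_commute[of 0]
      by (simp add: r_def)
    finally show "dist (z, X, Y) (0, X0, X0) < d" .
  qed
  have "\<exists>X. X \<in> cball X0 r \<and> F z X = 0" if z: "z \<in> ball 0 \<rho>" for z
  proof -
    define T where "T X = X - J (F z X)" for X
    have contr: "norm (T X - T Y) \<le> 1/2 * norm (X - Y)" if "X \<in> cball X0 r" "Y \<in> cball X0 r" for X Y
    proof -
      have "T X - T Y = J (?L (X - Y) - \<Lambda> z X Y (X - Y))"
        by (simp add: T_def J linear_diff[OF J(1)] flip: secant)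
      also have "norm \<dots> \<le> B * norm (\<Lambda> z X Y (X - Y) - ?L (X - Y))"
        using B(2) by (metis norm_minus_commute)
      also have "\<dots> \<le> B * (e * norm (X - Y))"
        using B close[OF z that] by (intro mult_left_mono) auto
      finally show ?thesis using B by (simp add: e_def)
    qed
    have "norm (T X - X0) \<le> r" if "X \<in> cball X0 r" for X
    proof -
      have "norm (T X - X0) \<le> norm (T X - T X0) + norm (T X0 - X0)"
        using norm_triangle_ineq[of "T X - T X0" "T X0 - X0"] by simp
      also have "norm (T X - T X0) \<le> 1/2 * norm (X - X0)"
        using that r by (intro contr) auto
      also have "norm (X - X0) \<le> r" using that by (simp add: dist_norm norm_minus_commute)
      also have "norm (T X0 - X0) \<le> B * norm (F z X0)" using B(2)[of "F z X0"] by (simp add: T_def)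
      also have "\<dots> \<le> B * (e * r)"
        using B \<delta>(2)[of z] z by (intro mult_left_mono) (auto simp: \<rho>_def less_imp_le)
      also have "\<dots> = r / 2" using B by (simp add: e_def)
      finally show ?thesis by simp
    qed
    then have "T ` cball X0 r \<subseteq> cball X0 r"
      by (auto simp: dist_norm norm_minus_commute)
    then have "\<exists>!X\<in>cball X0 r. T X = X"
      using contr r by (intro Banach_fix[where c = "1/2"]) (auto simp: dist_norm complete_eq_closed)
    then obtain X where "X \<in> cball X0 r" "T X = X" by blast
    then have "J (F z X) = 0" by (simp add: T_def)
    then have "F z X = 0" using J(3)[of "F z X"] linear_0[OF lin] by simp
    then show ?thesis using \<open>X \<in> cball X0 r\<close> by blast
  qed
  then obtain X where X: "\<And>z. z \<in> ball 0 \<rho> \<Longrightarrow> X z \<in> cball X0 r" "\<And>z. z \<in> ball 0 \<rho> \<Longrightarrow> F z (X z) = 0"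
    by metis
  have lower: "e * norm H \<le> norm (\<Lambda> z A C H)"
    if "z \<in> ball 0 \<rho>" "A \<in> cball X0 r" "C \<in> cball X0 r" for z A C H
  proof -
    have "norm H \<le> B * norm (?L H)" using B(2)[of "?L H"] by (simp add: J)
    then have "2 * e * norm H \<le> norm (?L H)" using B(1) by (simp add: e_def field_simps)
    moreover have "norm (?L H) \<le> norm (\<Lambda> z A C H) + norm (\<Lambda> z A C H - ?L H)"
      using norm_triangle_sub[of "?L H" "\<Lambda> z A C H"] by (simp add: norm_minus_commute)
    ultimately show ?thesis using close[OF that, of H] by simp
  qed
  show ?thesis
    by (rule that[of \<rho> r e X]) (use \<delta>(1) r e X lower in \<open>auto simp: \<rho>_def\<close>)
qed

text \<open>Here \<open>\<Delta> w z X\<close> is the divided difference of \<open>F\<close> in the parameter, and multiplication by a complex number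
is multiplication by \<open>mat a\<close>. Along the branch,
\<open>\<Lambda> w (X w) (X z) (X w - X z) = - (w - z) \<Delta> w z (X z)\<close>, so the difference quotient solves a linear
equation whose coefficients converge as \<open>w\<close> tends to \<open>z\<close>. This gives complex differentiability at every
point of a disc, hence holomorphy, and identifies the derivative at zero with \<open>D\<close>.\<close>

lemma analytic_solution_branch:
  fixes F :: "complex \<Rightarrow> complex ^ 'n ^ 'm \<Rightarrow> complex ^ 'n ^ 'm"
    and \<Lambda> :: "complex \<Rightarrow> complex ^ 'n ^ 'm \<Rightarrow> complex ^ 'n ^ 'm \<Rightarrow> complex ^ 'n ^ 'm \<Rightarrow> complex ^ 'n ^ 'm"
    and \<Delta> :: "complex \<Rightarrow> complex \<Rightarrow> complex ^ 'n ^ 'm \<Rightarrow> complex ^ 'n ^ 'm"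
  assumes \<delta>: "0 < \<delta>"
    and lin: "\<And>z X Y. linear (\<Lambda> z X Y)" "\<And>z X Y a H. \<Lambda> z X Y (mat a ** H) = mat a ** \<Lambda> z X Y H"
    and secant: "\<And>z X Y. F z X - F z Y = \<Lambda> z X Y (X - Y)"
    and secant_z: "\<And>w z X. w \<in> ball 0 \<delta> \<Longrightarrow> z \<in> ball 0 \<delta> \<Longrightarrow> F w X - F z X = mat (w - z) ** \<Delta> w z X"
    and cont: "\<And>z X Y H. z \<in> ball 0 \<delta> \<Longrightarrow> ((\<lambda>(z, X, Y). \<Lambda> z X Y H) \<longlongrightarrow> \<Lambda> z X Y H) (nhds (z, X, Y))"
    and cont_z: "\<And>z X. z \<in> ball 0 \<delta> \<Longrightarrow> ((\<lambda>w. \<Delta> w z X) \<longlongrightarrow> \<Delta> z z X) (nhds z)"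
    and inj: "\<And>H. \<Lambda> 0 X0 X0 H = 0 \<Longrightarrow> H = 0"
    and zero: "F 0 X0 = 0" and deriv: "\<Lambda> 0 X0 X0 D = - \<Delta> 0 0 X0"
  obtains \<rho> r X where "0 < \<rho>" "0 < r" "X 0 = X0"
    "\<And>z Y. z \<in> ball 0 \<rho> \<Longrightarrow> Y \<in> cball X0 r \<Longrightarrow> F z Y = 0 \<Longrightarrow> Y = X z"
    "\<And>i j. (\<lambda>z. X z $ i $ j) holomorphic_on ball 0 \<rho>"
    "\<And>i j. ((\<lambda>z. X z $ i $ j) has_field_derivative D $ i $ j) (at 0)"
proof -
  have scale_0: "((\<lambda>w. mat (w - z) ** \<Delta> w z X) \<longlongrightarrow> 0) (nhds z)" if z: "z \<in> ball 0 \<delta>" for z X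
  proof (rule vec_tendstoI, rule vec_tendstoI)
    fix i j
    have "((\<lambda>w. (w - z) * \<Delta> w z X $ i $ j) \<longlongrightarrow> (z - z) * \<Delta> z z X $ i $ j) (nhds z)"
      by (intro tendsto_intros cont_z z filterlim_ident)
    then show "((\<lambda>w. (mat (w - z) ** \<Delta> w z X) $ i $ j) \<longlongrightarrow> 0 $ i $ j) (nhds z)"
      by (simp add: mat_mult_nth)
  qed
  have F_cont: "((\<lambda>w. F w X) \<longlongrightarrow> F z X) (nhds z)" if z: "z \<in> ball 0 \<delta>" for z X
  proof -
    have "\<forall>\<^sub>F w in nhds z. w \<in> ball 0 \<delta>"
      using z by (intro eventually_nhds_in_open) auto
    then have "\<forall>\<^sub>F w in nhds z. mat (w - z) ** \<Delta> w z X = F w X - F z X"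
      by eventually_elim (use secant_z z in auto)
    from Lim_transform_eventually[OF scale_0[OF z] this]
    have "((\<lambda>w. F w X - F z X) \<longlongrightarrow> 0) (nhds z)" .
    then show ?thesis by (simp add: LIM_zero_iff)
  qed
  have "0 \<in> ball (0::complex) \<delta>" using \<delta> by simp
  note at0 = cont[OF this] F_cont[OF this, of X0, unfolded zero]
  obtain \<rho>' r \<kappa> X where pos: "0 < \<rho>'" "0 < r" "0 < \<kappa>"
    and X': "\<And>z. z \<in> ball 0 \<rho>' \<Longrightarrow> X z \<in> cball X0 r" "\<And>z. z \<in> ball 0 \<rho>' \<Longrightarrow> F z (X z) = 0"
    and lower': "\<And>z A B H. z \<in> ball 0 \<rho>' \<Longrightarrow> A \<in> cball X0 r \<Longrightarrow> B \<in> cball X0 r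
      \<Longrightarrow> \<kappa> * norm H \<le> norm (\<Lambda> z A B H)"
    using solution_branch_exists[OF lin(1) secant at0(1) inj zero at0(2)] by metis
  define \<rho> where "\<rho> = min \<rho>' \<delta>"
  have \<rho>: "0 < \<rho>" using pos \<delta> by (simp add: \<rho>_def)
  have X: "X z \<in> cball X0 r" "F z (X z) = 0" if "z \<in> ball 0 \<rho>" for z
    using X' that by (auto simp: \<rho>_def)
  have lower: "\<kappa> * norm H \<le> norm (\<Lambda> z A B H)"
    if "z \<in> ball 0 \<rho>" "A \<in> cball X0 r" "B \<in> cball X0 r" for z A B H
    using lower' that by (auto simp: \<rho>_def)
  have unique: "Y = X z" if "z \<in> ball 0 \<rho>" "Y \<in> cball X0 r" "F z Y = 0" for z Y
  proof -
    have "\<Lambda> z Y (X z) (Y - X z) = 0"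
      using that X(2)[OF that(1)] by (simp flip: secant)
    then have "\<kappa> * norm (Y - X z) \<le> 0"
      using lower[OF that(1,2) X(1)[OF that(1)], of "Y - X z"] by simp
    then show ?thesis using pos(3) by (simp add: mult_le_0_iff)
  qed
  have X_0: "X 0 = X0"
    using unique[of 0 X0] \<rho> pos zero by simp
  have quotient: "((\<lambda>w. mat (1 / (w - z)) ** (X w - X z)) \<longlongrightarrow> q) (at z)"
    if z: "z \<in> ball 0 \<rho>" and q: "\<Lambda> z (X z) (X z) q = - \<Delta> z z (X z)" for z q
  proof -
    have z\<delta>: "z \<in> ball 0 \<delta>" using z by (simp add: \<rho>_def)
    have near: "\<forall>\<^sub>F w in at z. w \<in> ball 0 \<rho>"
      using z by (intro eventually_at_in_open') auto
    have near': "\<forall>\<^sub>F w in at z. w \<in> ball 0 \<rho> \<and> w \<noteq> z"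
      using near eventually_neq_at_within[of z z UNIV] by eventually_elim auto
    have "((\<lambda>w. X w - X z) \<longlongrightarrow> 0) (at z)"
    proof (rule Lim_null_comparison)
      show "\<forall>\<^sub>F w in at z. norm (X w - X z) \<le> norm (F w (X z)) / \<kappa>"
        using near
      proof eventually_elim
        case (elim w)
        have "\<kappa> * norm (X w - X z) \<le> norm (\<Lambda> w (X w) (X z) (X w - X z))"
          by (rule lower[OF elim X(1)[OF elim] X(1)[OF z]])
        also have "\<dots> = norm (F w (X z))"
          using X(2)[OF elim] by (simp flip: secant)
        finally show ?case using pos(3) by (simp add: field_simps)
      qed
      have "((\<lambda>w. norm (F w (X z)) / \<kappa>) \<longlongrightarrow> norm (F z (X z)) / \<kappa>) (at z)"
        using pos(3) by (intro tendsto_intros tendsto_mono[OF at_within_le_nhds F_cont[OF z\<delta>]]) auto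
      then show "((\<lambda>w. norm (F w (X z)) / \<kappa>) \<longlongrightarrow> 0) (at z)"
        using X(2)[OF z] by simp
    qed
    then have X_cont: "(X \<longlongrightarrow> X z) (at z)" by (simp add: LIM_zero_iff)
    show ?thesis
    proof (rule linear_solution_tendsto[where \<Lambda> = "\<lambda>w. \<Lambda> w (X w) (X z)" and L = "\<Lambda> z (X z) (X z)"])
      show "((\<lambda>w. \<Lambda> w (X w) (X z) H) \<longlongrightarrow> \<Lambda> z (X z) (X z) H) (at z)" for H
      proof -
        have "((\<lambda>w. (w, X w, X z)) \<longlongrightarrow> (z, X z, X z)) (at z)"
          by (intro tendsto_intros X_cont)
        from filterlim_compose[OF cont[OF z\<delta>, where X = "X z" and Y = "X z" and H = H] this] show ?thesis by simp
      qed
      show "H = 0" if "\<Lambda> z (X z) (X z) H = 0" for H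
      proof -
        have "\<kappa> * norm H \<le> 0" using lower[OF z X(1)[OF z] X(1)[OF z], of H] that by simp
        then show ?thesis using pos(3) by (simp add: mult_le_0_iff)
      qed
      have "((\<lambda>w. - \<Delta> w z (X z)) \<longlongrightarrow> - \<Delta> z z (X z)) (at z)"
        by (intro tendsto_intros tendsto_mono[OF at_within_le_nhds cont_z[OF z\<delta>]])
      moreover have "\<forall>\<^sub>F w in at z. - \<Delta> w z (X z) = \<Lambda> w (X w) (X z) (mat (1 / (w - z)) ** (X w - X z))"
        using near'
      proof eventually_elim
        case (elim w)
        then have w: "w \<in> ball 0 \<rho>" "w \<in> ball 0 \<delta>" "w \<noteq> z" by (auto simp: \<rho>_def)
        have "F w (X w) - F w (X z) = - (F w (X z) - F z (X z))"
          using X(2)[OF w(1)] X(2)[OF z] by simp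
        also have "\<dots> = - (mat (w - z) ** \<Delta> w z (X z))"
          by (simp only: secant_z[OF w(2) z\<delta>])
        finally have "\<Lambda> w (X w) (X z) (mat (1 / (w - z)) ** (X w - X z))
            = mat (1 / (w - z)) ** - (mat (w - z) ** \<Delta> w z (X z))"
          by (simp add: lin(2) flip: secant)
        also have "\<dots> = - \<Delta> w z (X z)"
          using w(3) by (simp add: vec_eq_iff matrix_minus_right mat_mult_nth)
        finally show ?case by simp
      qed
      ultimately show "((\<lambda>w. \<Lambda> w (X w) (X z) (mat (1 / (w - z)) ** (X w - X z))) \<longlongrightarrow> \<Lambda> z (X z) (X z) q) (at z)"
        unfolding q by (rule Lim_transform_eventually)
    qed (fact lin)+
  qed
  have has_deriv: "((\<lambda>z. X z $ i $ j) has_field_derivative q $ i $ j) (at z)"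
    if "z \<in> ball 0 \<rho>" "\<Lambda> z (X z) (X z) q = - \<Delta> z z (X z)" for z q i j
  proof -
    have "((\<lambda>w. (mat (1 / (w - z)) ** (X w - X z)) $ i $ j) \<longlongrightarrow> q $ i $ j) (at z)"
      by (intro tendsto_vec_nth quotient that)
    then show ?thesis by (simp add: has_field_derivative_iff mat_mult_nth)
  qed
  show ?thesis
  proof (rule that[of \<rho> r X])
    show "(\<lambda>z. X z $ i $ j) holomorphic_on ball 0 \<rho>" for i j
    proof (rule holomorphic_onI)
      fix z :: complex assume z: "z \<in> ball 0 \<rho>"
      have "H = 0" if "\<Lambda> z (X z) (X z) H = 0" for H
      proof -
        have "\<kappa> * norm H \<le> 0" using lower[OF z X(1)[OF z] X(1)[OF z], of H] that by simp
        then show ?thesis using pos(3) by (simp add: mult_le_0_iff)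
      qed
      then have "inj (\<Lambda> z (X z) (X z))" using linear_injective_0[OF lin(1)] by blast
      then have "surj (\<Lambda> z (X z) (X z))" by (rule linear_inj_imp_surj[OF lin(1)])
      then obtain q where "\<Lambda> z (X z) (X z) q = - \<Delta> z z (X z)" by (metis surjD)
      then show "(\<lambda>z. X z $ i $ j) field_differentiable at z within ball 0 \<rho>"
        using has_deriv[OF z] field_differentiable_at_within unfolding field_differentiable_def
        by (metis DERIV_subset subset_UNIV)
    qed
    show "((\<lambda>z. X z $ i $ j) has_field_derivative D $ i $ j) (at 0)" for i j
      by (rule has_deriv) (use \<rho> deriv X_0 in auto)
  qed (use \<rho> pos X_0 unique in auto)
qed

text \<open>The quotient \<open>(f z - f 0) / z\<close> is holomorphic after its singularity is removed, hence differentiable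
at zero.\<close>

lemma holomorphic_quadratic_remainder:
  assumes f: "f holomorphic_on ball 0 \<rho>" "0 < \<rho>" and d: "(f has_field_derivative d) (at 0)"
  shows "(\<lambda>\<epsilon>. norm (f (of_real \<epsilon>) - (f 0 + of_real \<epsilon> * d))) \<in> O[at_right 0](\<lambda>\<epsilon>::real. \<epsilon> ^ 2)"
proof -
  \<comment> \<open>The value at zero is the one that removes the singularity.\<close>
  define g where "g = (\<lambda>z. if z = 0 then deriv f 0 else (f z - f 0) / (z - 0))"
  have "g holomorphic_on ball 0 \<rho>"
    unfolding g_def by (rule pole_lemma_open[OF f(1)]) simp
  then obtain g' where "(g has_field_derivative g') (at 0)"
    using f(2) by (metis holomorphic_on_open centre_in_ball open_ball)
  then have "((\<lambda>z. (g z - g 0) / (z - 0)) \<longlongrightarrow> g') (at 0)"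
    by (simp add: has_field_derivative_iff)
  then have "\<forall>\<^sub>F z in at 0. norm ((g z - g 0) / (z - 0)) < norm g' + 1"
    by (intro order_tendstoD(2)[where y = "norm g'"] tendsto_norm) auto
  then obtain e where e: "0 < e" "\<And>z. z \<noteq> 0 \<Longrightarrow> norm z < e \<Longrightarrow> norm ((g z - g 0) / (z - 0)) < norm g' + 1"
    unfolding eventually_at by (auto simp: dist_norm)
  have "norm (f (of_real \<epsilon>) - (f 0 + of_real \<epsilon> * d)) \<le> (norm g' + 1) * \<epsilon> ^ 2" if "0 < \<epsilon>" "\<epsilon> < e" for \<epsilon> :: real
  proof -
    have "f (of_real \<epsilon>) - (f 0 + of_real \<epsilon> * d) = of_real (\<epsilon> ^ 2) * ((g (of_real \<epsilon>) - g 0) / (of_real \<epsilon> - 0))"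
      using that DERIV_imp_deriv[OF d] by (simp add: g_def field_simps power2_eq_square)
    also have "norm \<dots> = \<epsilon> ^ 2 * norm ((g (of_real \<epsilon>) - g 0) / (of_real \<epsilon> - 0))"
      by (simp only: norm_mult norm_of_real) simp
    also have "\<dots> \<le> \<epsilon> ^ 2 * (norm g' + 1)"
      using e(2)[of "of_real \<epsilon>"] that by (intro mult_left_mono) auto
    finally show ?thesis by (simp add: mult.commute)
  qed
  then have "\<forall>\<^sub>F \<epsilon> in at_right 0. norm (norm (f (of_real \<epsilon>) - (f 0 + of_real \<epsilon> * d))) \<le> (norm g' + 1) * norm (\<epsilon> ^ 2)"
    unfolding eventually_at_right_field using e(1) by (intro exI[of _ e]) auto
  then show ?thesis by (rule bigoI)
qed

section \<open>The fluid model\<close>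

locale perturbed_fluid = perturbed_fluid_notation A c ct
  for A :: "'s::finite rmat" and c ct :: "real ^ 's" +
  fixes \<xi> :: "real ^ 's"
  assumes generator: "generator A"
    and stationary: "stationary_vector A \<xi>"
    and drift_negative: "(\<xi> v* diag c) \<bullet> 1 < 0"
    and ct_positive: "\<And>i. c $ i = 0 \<Longrightarrow> ct $ i > 0"
begin

abbreviation I :: "'s set \<Rightarrow> 's rmat" where "I S \<equiv> block S S (mat 1)"

lemma A_offdiag: "i \<noteq> j \<Longrightarrow> 0 \<le> A $ i $ j"
  using generator by (simp add: generator_def)

lemma A_one: "A *v 1 = 0"
  using generator by (simp add: generator_def)

text \<open>Uniqueness of the stationary vector among all real vectors of total mass one makes the left null space of
\<open>A\<close> one-dimensional, including null vectors of mass zero.\<close>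

lemma left_null_multiple:
  assumes "\<eta> v* A = 0"
  shows "\<eta> = (\<eta> \<bullet> 1) *\<^sub>R \<xi>"
proof -
  let ?\<zeta> = "\<eta> + (1 - \<eta> \<bullet> 1) *\<^sub>R \<xi>"
  have \<xi>: "\<xi> v* A = 0" "\<xi> \<bullet> 1 = 1" using stationary by (auto simp: stationary_vector_def)
  have "?\<zeta> v* A = 0"
    using assms \<xi> by (simp add: vector_matrix_left_distrib scaleR_vector_matrix_assoc)
  moreover have "?\<zeta> \<bullet> 1 = 1"
    using \<xi> by (simp add: inner_add_left)
  ultimately have "?\<zeta> = \<xi>" using stationary unfolding stationary_vector_def by blast
  then show ?thesis by (simp add: scaleR_diff_left)
qed

lemma drift_sum: "(\<Sum>i\<in>UNIV. \<xi> $ i * c $ i) < 0"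
proof -
  have "(\<xi> v* diag c) $ j = \<xi> $ j * c $ j" for j
    by (simp add: vector_matrix_mult_def diag_nth if_distrib[where f = "\<lambda>x. _ * x"]
        if_distrib[where f = "\<lambda>x. x * _"] cong: if_cong)
  then show ?thesis using drift_negative by (simp add: inner_one)
qed

lemma \<xi>_nonneg: "0 \<le> \<xi> $ i"
  using stationary by (simp add: stationary_vector_def less_eq_vec_def)

lemma \<xi>_charges_negative_phase: "\<exists>k\<in>m. \<xi> $ k \<noteq> 0"
proof (rule ccontr)
  assume "\<not> (\<exists>k\<in>m. \<xi> $ k \<noteq> 0)"
  then have "0 \<le> \<xi> $ i * c $ i" for i
    using \<xi>_nonneg[of i] by (cases "c $ i < 0") auto
  then show False using drift_sum sum_nonneg[of UNIV "\<lambda>i. \<xi> $ i * c $ i"] by simp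
qed

text \<open>If \<open>x\<close> is supported on \<open>z\<close> and \<open>x A\<close> vanishes on \<open>z\<close>, then \<open>0 \<le> \<bar>x\<bar> A\<close>, and equality holds because the row
sums of \<open>A\<close> are zero. So \<open>\<bar>x\<bar>\<close> is a multiple of \<open>\<xi>\<close>; but \<open>\<xi>\<close> charges \<open>m\<close>, where \<open>x\<close> vanishes.\<close>

lemma zero_block_left_injective:
  assumes supp: "\<And>j. j \<notin> z \<Longrightarrow> x $ j = 0" and x: "x v* block z z A = 0"
  shows "x = 0"
proof -
  define u where "u = (\<chi> i. \<bar>x $ i\<bar>)"
  have uA: "0 \<le> u v* A"
  proof -
    have "0 \<le> (\<Sum>i\<in>UNIV. \<bar>x $ i\<bar> * A $ i $ j)" for j
    proof (cases "j \<in> z")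
      case True
      have "(\<Sum>i\<in>UNIV. x $ i * A $ i $ j) = (\<Sum>i\<in>UNIV. x $ i * block z z A $ i $ j)"
        using supp True by (intro sum.cong) (auto simp: block_nth)
      also have "\<dots> = (x v* block z z A) $ j"
        by (simp add: vector_matrix_mult_def mult.commute)
      finally have "0 = sgn (x $ j) * (\<Sum>i\<in>UNIV. x $ i * A $ i $ j)" using x by simp
      also have "\<dots> = (\<Sum>i\<in>UNIV. (sgn (x $ j) * x $ i) * A $ i $ j)"
        by (simp add: sum_distrib_left mult.assoc)
      also have "\<dots> \<le> (\<Sum>i\<in>UNIV. \<bar>x $ i\<bar> * A $ i $ j)"
      proof (rule sum_mono)
        fix i
        show "(sgn (x $ j) * x $ i) * A $ i $ j \<le> \<bar>x $ i\<bar> * A $ i $ j"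
        proof (cases "i = j")
          case True
          then show ?thesis by (simp add: sgn_mult_self_eq abs_sgn mult.commute)
        next
          case False
          have "sgn (x $ j) * x $ i \<le> \<bar>x $ i\<bar>" by (simp add: sgn_if abs_if)
          then show ?thesis using A_offdiag[OF False] by (rule mult_right_mono)
        qed
      qed
      finally show ?thesis .
    next
      case False
      have "0 \<le> \<bar>x $ i\<bar> * A $ i $ j" for i
        using A_offdiag[of i j] supp[OF False] by (cases "i = j") auto
      then show ?thesis by (rule sum_nonneg)
    qed
    then show ?thesis by (simp add: u_def less_eq_vec_def vector_matrix_mult_def mult.commute)
  qed
  have "(u v* A) \<bullet> 1 = 0" by (simp add: dot_lmul_matrix A_one)
  then have "u v* A = 0"
    using nonneg_inner_nonpos_imp_zero[OF uA, of 1] by (simp add: one_nth)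
  then have u: "u = (u \<bullet> 1) *\<^sub>R \<xi>" by (rule left_null_multiple)
  obtain k where k: "c $ k < 0" "\<xi> $ k \<noteq> 0" using \<xi>_charges_negative_phase by blast
  have "u $ k = 0" using supp[of k] k by (simp add: u_def)
  moreover have "u $ k = (u \<bullet> 1) * \<xi> $ k" using u by (metis vector_scaleR_component real_scaleR_def)
  ultimately have "u \<bullet> 1 = 0" using k(2) by simp
  then have "u = 0" using u by simp
  then show ?thesis by (simp add: u_def vec_eq_iff)
qed

text \<open>The block of \<open>A\<close> on \<open>z\<close>, completed by minus the identity on the other phases, has nonpositive row sums, so
\<open>metzler_inverse_nonneg\<close> applies with \<open>h = 1\<close>.\<close>

lemma zero_block_inverse:
  shows "is_block z z N" "0 \<le> N" "block z z A ** N = - I z" "N ** block z z A = - I z"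
proof -
  let ?Z = "block z z A"
  define T where "T = ?Z - I (- z)"
  have T: "metzler T" using A_offdiag by (auto simp: T_def metzler_def block_nth mat_def)
  have "(T *v 1) $ i \<le> 0" for i
  proof (cases "i \<in> z")
    case True
    have "(T *v 1) $ i = (\<Sum>j\<in>UNIV. ?Z $ i $ j)"
      using True unfolding matrix_vector_one_nth by (intro sum.cong) (auto simp: T_def block_nth)
    also have "\<dots> \<le> (\<Sum>j\<in>UNIV. A $ i $ j)"
      using True by (intro sum_mono) (auto simp: block_nth intro!: A_offdiag)
    also have "\<dots> = 0" using A_one by (simp add: vec_eq_iff matrix_vector_one_nth)
    finally show ?thesis .
  next
    case False
    have "(T *v 1) $ i = (\<Sum>j\<in>UNIV. - I (- z) $ i $ j)"
      using False unfolding matrix_vector_one_nth by (intro sum.cong) (auto simp: T_def block_nth)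
    also have "\<dots> \<le> 0" by (intro sum_nonpos) (auto simp: block_nth mat_def)
    finally show ?thesis .
  qed
  then have "T *v 1 \<le> 0" by (simp add: less_eq_vec_def)
  moreover have "x = 0" if x: "x v* T = 0" for x
  proof -
    have supp: "x $ j = 0" if "j \<notin> z" for j
    proof -
      have Tj: "T $ i $ j = (if i = j then - 1 else 0)" for i
        using that by (auto simp: T_def block_nth mat_def)
      have "(x v* T) $ j = - x $ j"
        by (simp add: vector_matrix_mult_def Tj if_distrib[where f = "\<lambda>x. _ * x"]
            if_distrib[where f = "\<lambda>x. x * _"] cong: if_cong)
      then show ?thesis using x by simp
    qed
    have "x v* I (- z) = 0"
      using supp by (auto simp: vec_eq_iff vector_matrix_mult_def block_nth mat_def intro!: sum.neutral)
    then have "x v* ?Z = 0" using x by (simp add: T_def vector_matrix_mult_diff_rdistrib)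
    from zero_block_left_injective[OF supp this] show ?thesis .
  qed
  ultimately obtain B where B: "0 \<le> B" "T ** B = - mat 1" "B ** T = - mat 1"
    by (rule metzler_inverse_nonneg[OF T, rotated]) (auto simp: one_nth)
  have IT: "I z ** T = ?Z" "T ** I z = ?Z"
    unfolding T_def matrix_diff_ldistrib matrix_diff_rdistrib
    by (simp_all add: is_block_mat_mult_left[OF is_block_block] is_block_mat_mult_right[OF is_block_block]
        block_mult_disjoint[OF is_block_block is_block_block])
  have II: "I z ** I z = I z" by (rule is_block_mat_mult_left[OF is_block_block])
  define B' where "B' = I z ** B ** I z"
  have bB: "is_block z z B'"
    by (auto simp: B'_def is_block_def mat_1_eq_diag block_diag_mult_left block_diag_mult_right)
  have "?Z ** B' = (?Z ** I z) ** B ** I z" by (simp add: B'_def matrix_mul_assoc)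
  also have "\<dots> = I z ** (T ** B) ** I z"
    by (simp add: is_block_mat_mult_right[OF is_block_block] matrix_mul_assoc IT)
  finally have ZB: "?Z ** B' = - I z" by (simp add: B matrix_minus_left matrix_minus_right II)
  have "B' ** ?Z = I z ** B ** (I z ** ?Z)" by (simp add: B'_def matrix_mul_assoc)
  also have "\<dots> = I z ** B ** (T ** I z)"
    by (simp add: is_block_mat_mult_left[OF is_block_block] IT)
  also have "\<dots> = I z ** (B ** T) ** I z" by (simp add: matrix_mul_assoc)
  finally have BZ: "B' ** ?Z = - I z" by (simp add: B matrix_minus_left matrix_minus_right II)
  have "block_inv z A = - B'"
    by (rule block_inv_eqI) (simp_all add: bB is_block_minus ZB BZ matrix_minus_left matrix_minus_right)
  then have N: "N = B'" by simp
  have "0 \<le> I z" by (auto simp: less_eq_vec_def block_nth mat_def)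
  then show "is_block z z N" "0 \<le> N" "?Z ** N = - I z" "N ** ?Z = - I z"
    unfolding N using bB ZB BZ B(1) by (auto simp: B'_def intro!: matrix_nonneg_mult)
qed

lemma Cp_inv_eq: "Cp_inv = block p p (diag (\<chi> i. 1 / c $ i))"
  by (rule block_inv_diag) auto

lemma abs_Cm_inv_eq: "abs_Cm_inv = block m m (diag (\<chi> i. 1 / \<bar>c $ i\<bar>))"
proof -
  have "block_inv m (diag c) = block m m (diag (\<chi> i. 1 / c $ i))"
    by (rule block_inv_diag) auto
  then show ?thesis by (simp add: vec_eq_iff abs_vec_def block_nth diag_nth)
qed

lemma rates_nonneg: "0 \<le> Cp_inv" "0 \<le> abs_Cm_inv"
  by (auto simp: Cp_inv_eq abs_Cm_inv_eq less_eq_vec_def block_nth diag_nth)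

lemma is_block_rates: "is_block p p Cp_inv" "is_block m m abs_Cm_inv"
  unfolding Cp_inv_eq abs_Cm_inv_eq by simp_all

lemma offdiag_blocks_nonneg: "R \<inter> S = {} \<Longrightarrow> 0 \<le> block R S A"
  by (auto simp: less_eq_vec_def block_nth intro!: A_offdiag)

lemma metzler_diag_mult:
  assumes "metzler X" "\<And>i. i \<in> R \<Longrightarrow> 0 \<le> v $ i"
  shows "metzler (block R R (diag v) ** X)"
  using assms by (auto simp: metzler_def block_diag_mult_left)

lemma metzler_block: "metzler (block R R A)"
  by (simp add: metzler_def block_nth A_offdiag)

lemma is_block_Q: "is_block p p Qpp" "is_block p m Qpm" "is_block m p Qmp" "is_block m m Qmm"
  unfolding Qpp_def Qpm_def Qmp_def Qmm_def
  by (simp_all add: is_block_add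
      is_block_mult[OF is_block_mult[OF is_block_block zero_block_inverse(1)] is_block_block])

lemma Q_signs: "metzler Qpp" "0 \<le> Qpm" "0 \<le> Qmp" "metzler Qmm"
proof -
  have "0 \<le> block R z A ** N ** block z S A" if "R \<inter> z = {}" "S \<inter> z = {}" for R S
    using that zero_block_inverse(2) offdiag_blocks_nonneg
    by (intro matrix_nonneg_mult) (auto simp: Int_commute)
  note * = this
  have "p \<inter> z = {}" "m \<inter> z = {}" "p \<inter> m = {}" "m \<inter> p = {}" by auto
  then show "metzler Qpp" "0 \<le> Qpm" "0 \<le> Qmp" "metzler Qmm"
    unfolding Qpp_def Qpm_def Qmp_def Qmm_def
    by (auto intro!: metzler_add_nonneg metzler_block * add_nonneg_nonneg offdiag_blocks_nonneg)
qed

lemma block_rows_one: "block R UNIV A *v 1 = 0"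
proof -
  have "(block R UNIV A *v 1) $ i = (if i \<in> R then (A *v 1) $ i else 0)" for i
    by (simp add: matrix_vector_one_nth block_nth)
  then show ?thesis unfolding A_one by (simp add: vec_eq_iff)
qed

lemma phases_split: "block R UNIV A = block R p A + block R z A + block R m A"
  by (auto simp: vec_eq_iff block_nth)

text \<open>Entering \<open>z\<close> and leaving it again conserves mass: \<open>N (Azp 1 + Azm 1)\<close> is the vector of ones on \<open>z\<close>.\<close>

lemma censored_row_sums: "Qpp *v 1 + Qpm *v 1 = 0" "Qmp *v 1 + Qmm *v 1 = 0"
proof -
  have row: "block R p A *v 1 + block R z A *v 1 + block R m A *v 1 = 0" for R
  proof -
    from block_rows_one[of R] show ?thesis
      unfolding phases_split by (simp add: matrix_vector_mult_add_rdistrib)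
  qed
  have "Azp *v 1 + Azm *v 1 = - (block z z A *v 1)"
    using row[of z] by (simp add: eq_neg_iff_add_eq_0 add_ac)
  then have "N *v (Azp *v 1 + Azm *v 1) = - ((N ** block z z A) *v 1)"
    by (simp add: matrix_vector_mul_assoc vec.neg)
  then have N1: "N *v (Azp *v 1 + Azm *v 1) = I z *v 1"
    unfolding zero_block_inverse(4) by (simp add: matrix_vector_minus_left)
  have "(block R p A + block R z A ** N ** Azp) *v 1 + (block R m A + block R z A ** N ** Azm) *v 1 = 0" for R
  proof -
    have "block R z A *v (N *v (Azp *v 1)) + block R z A *v (N *v (Azm *v 1)) = block R z A *v 1"
      unfolding matrix_vector_right_distrib[symmetric] N1
      by (simp add: matrix_vector_mul_assoc is_block_mat_mult_right[OF is_block_block])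
    then have "(block R p A *v 1 + block R m A *v 1)
        + (block R z A *v (N *v (Azp *v 1)) + block R z A *v (N *v (Azm *v 1))) = 0"
      using row[of R] by (simp only: add_ac)
    then show ?thesis
      by (simp only: matrix_vector_mult_add_rdistrib matrix_vector_mul_assoc[symmetric] add_ac)
  qed
  then show "Qpp *v 1 + Qpm *v 1 = 0" "Qmp *v 1 + Qmm *v 1 = 0"
    unfolding Qpp_def Qpm_def Qmp_def Qmm_def by blast+
qed

end

context perturbed_fluid
begin

text \<open>The stationary mass of the increasing and of the decreasing phases, weighted with the modulus of the
rates; their difference is the drift.\<close>

definition mass_up :: "real ^ 's" where "mass_up = (\<chi> i. if 0 < c $ i then \<xi> $ i * c $ i else 0)"
definition mass_down :: "real ^ 's" where "mass_down = (\<chi> i. if c $ i < 0 then - (\<xi> $ i * c $ i) else 0)"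

lemma mass_drift: "0 \<le> mass_up" "mass_up \<bullet> 1 < mass_down \<bullet> 1"
proof -
  show "0 \<le> mass_up" using \<xi>_nonneg by (simp add: mass_up_def less_eq_vec_def)
  have "mass_up \<bullet> 1 - mass_down \<bullet> 1 = (\<Sum>i\<in>UNIV. \<xi> $ i * c $ i)"
    unfolding inner_one sum_subtractf[symmetric] by (rule sum.cong) (auto simp: mass_up_def mass_down_def)
  then show "mass_up \<bullet> 1 < mass_down \<bullet> 1" using drift_sum by simp
qed

text \<open>An invariant measure of the process censored on \<open>p \<union> m\<close> extends to one of \<open>A\<close>: the mass that enters
\<open>z\<close> is distributed there by \<open>N\<close>. Hence it is a multiple of the restriction of \<open>\<xi>\<close>.\<close>

lemma censored_left_null:
  assumes supp: "\<And>i. i \<notin> p \<Longrightarrow> y $ i = 0" "\<And>i. i \<notin> m \<Longrightarrow> w $ i = 0"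
    and null: "y v* (Cp_inv ** Qpp) + w v* (abs_Cm_inv ** Qmp) = 0"
      "y v* (Cp_inv ** Qpm) + w v* (abs_Cm_inv ** Qmm) = 0"
  shows "\<exists>t. y = t *\<^sub>R mass_up \<and> w = t *\<^sub>R mass_down"
proof -
  define y' where "y' = y v* Cp_inv"
  define w' where "w' = w v* abs_Cm_inv"
  define u where "u = y' v* Apz + w' v* Amz"
  define \<eta> where "\<eta> = y' + w' + u v* N"
  have y'_nth: "y' $ i = (if i \<in> p then y $ i / c $ i else 0)" for i
    by (simp add: y'_def Cp_inv_eq vector_block_diag)
  have w'_nth: "w' $ i = (if i \<in> m then w $ i / \<bar>c $ i\<bar> else 0)" for i
    by (simp add: w'_def abs_Cm_inv_eq vector_block_diag)
  have uN_supp: "(u v* N) $ i = 0" if "i \<notin> z" for i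
    by (rule vector_mult_block_outside[OF zero_block_inverse(1) that])
  have u_supp: "u $ i = 0" if "i \<notin> z" for i
    unfolding u_def by (simp add: vector_mult_block_outside[OF is_block_block that])
  have uI: "u v* I z = u"
    using u_supp by (auto simp: vec_eq_iff mat_1_eq_diag vector_block_diag one_nth)
  have split: "x v* A = x v* block R p A + x v* block R z A + x v* block R m A"
    if "\<And>i. i \<notin> R \<Longrightarrow> x $ i = 0" for x R
    using vector_mult_supported[of R x A, OF that] unfolding phases_split vector_matrix_mult_add_rdistrib .
  have null': "y' v* Qpp + w' v* Qmp = 0" "y' v* Qpm + w' v* Qmm = 0"
    using null by (simp_all add: y'_def w'_def vector_matrix_mul_assoc)
  have uX: "(u v* N) v* X = y' v* (Apz ** N ** X) + w' v* (Amz ** N ** X)" for X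
    by (simp only: u_def vector_matrix_left_distrib vector_matrix_mul_assoc)
  have p_part: "y' v* App + w' v* Amp + (u v* N) v* Azp = 0"
    using null'(1) unfolding Qpp_def Qmp_def vector_matrix_mult_add_rdistrib uX by (simp only: add_ac)
  have m_part: "y' v* Apm + w' v* Amm + (u v* N) v* Azm = 0"
    using null'(2) unfolding Qpm_def Qmm_def vector_matrix_mult_add_rdistrib uX by (simp only: add_ac)
  have "(u v* N) v* block z z A = u v* (- I z)"
    by (simp only: vector_matrix_mul_assoc zero_block_inverse)
  also have "\<dots> = - u" unfolding vector_matrix_minus_right uI ..
  finally have z_part: "y' v* Apz + w' v* Amz + (u v* N) v* block z z A = 0"
    by (simp add: u_def)
  have "\<eta> v* A = y' v* A + w' v* A + (u v* N) v* A"
    by (simp only: \<eta>_def vector_matrix_left_distrib)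
  also have "\<dots> = (y' v* App + w' v* Amp + (u v* N) v* Azp) + (y' v* Apz + w' v* Amz + (u v* N) v* block z z A)
      + (y' v* Apm + w' v* Amm + (u v* N) v* Azm)"
    using split[of p y'] split[of m w'] split[of z "u v* N"] uN_supp
    by (simp add: y'_nth w'_nth add_ac)
  also have "\<dots> = 0" unfolding p_part m_part z_part by simp
  finally have "\<eta> = (\<eta> \<bullet> 1) *\<^sub>R \<xi>" by (rule left_null_multiple)
  then have \<eta>: "\<eta> $ i = (\<eta> \<bullet> 1) * \<xi> $ i" for i by (metis vector_scaleR_component real_scaleR_def)
  have "y $ i = (\<eta> \<bullet> 1) * mass_up $ i" for i
  proof (cases "0 < c $ i")
    case True
    then have "\<eta> $ i = y $ i / c $ i"
      using uN_supp[of i] by (simp add: \<eta>_def y'_nth w'_nth)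
    then show ?thesis using \<eta>[of i] True by (simp add: mass_up_def field_simps)
  qed (use supp(1) in \<open>simp add: mass_up_def\<close>)
  moreover have "w $ i = (\<eta> \<bullet> 1) * mass_down $ i" for i
  proof (cases "c $ i < 0")
    case True
    then have "\<eta> $ i = w $ i / \<bar>c $ i\<bar>"
      using uN_supp[of i] by (simp add: \<eta>_def y'_nth w'_nth)
    then show ?thesis using \<eta>[of i] True by (simp add: mass_down_def field_simps)
  qed (use supp(2) in \<open>simp add: mass_down_def\<close>)
  ultimately show ?thesis by (intro exI[of _ "\<eta> \<bullet> 1"]) (simp add: vec_eq_iff)
qed

text \<open>The unperturbed equation is the Riccati equation of the censored process in the time scale in which all
rates have modulus one.\<close>

sublocale censored: recurrent_nare p m "Cp_inv ** Qpp" "Cp_inv ** Qpm" "abs_Cm_inv ** Qmp" "abs_Cm_inv ** Qmm"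
  mass_up mass_down
proof
  show "p \<inter> m = {}" by auto
  show "is_block p p (Cp_inv ** Qpp)" "is_block p m (Cp_inv ** Qpm)"
    "is_block m p (abs_Cm_inv ** Qmp)" "is_block m m (abs_Cm_inv ** Qmm)"
    by (rule is_block_mult[OF is_block_rates(1) is_block_Q(1)] is_block_mult[OF is_block_rates(1) is_block_Q(2)]
        is_block_mult[OF is_block_rates(2) is_block_Q(3)] is_block_mult[OF is_block_rates(2) is_block_Q(4)])+
  show "metzler (Cp_inv ** Qpp)"
    unfolding Cp_inv_eq by (rule metzler_diag_mult[OF Q_signs(1)]) simp
  show "metzler (abs_Cm_inv ** Qmm)"
    unfolding abs_Cm_inv_eq by (rule metzler_diag_mult[OF Q_signs(4)]) simp
  show "0 \<le> Cp_inv ** Qpm" "0 \<le> abs_Cm_inv ** Qmp"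
    by (rule matrix_nonneg_mult[OF rates_nonneg(1) Q_signs(2)] matrix_nonneg_mult[OF rates_nonneg(2) Q_signs(3)])+
  show cons: "Cp_inv ** Qpp *v 1 + Cp_inv ** Qpm *v 1 = 0" "abs_Cm_inv ** Qmp *v 1 + abs_Cm_inv ** Qmm *v 1 = 0"
    by (simp_all only: matrix_vector_mul_assoc[symmetric] matrix_vector_right_distrib[symmetric]
        censored_row_sums matrix_vector_mult_0_right)
  show "Cp_inv ** Qpp *v 1 + Cp_inv ** Qpm *v 1 \<le> 0" "abs_Cm_inv ** Qmp *v 1 + abs_Cm_inv ** Qmm *v 1 \<le> 0"
    unfolding cons by simp_all
qed (use mass_drift censored_left_null in auto)

lemma riccati_eq_nare: "riccati X = censored.nare X"
  by (simp add: riccati_def censored.nare_def matrix_mul_assoc)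

lemma Psi_solution: "Psi \<in> substochastic p m" "censored.nare Psi = 0" "is_block p m Psi"
proof -
  obtain X where X: "minimal_nonneg_solution p m censored.nare X" "X \<in> substochastic p m"
    using censored.minimal_solution_exists by blast
  have ric: "riccati = censored.nare" by (rule ext) (rule riccati_eq_nare)
  have "Psi = X"
    unfolding Psi_def ric using X(1) minimal_nonneg_solution_unique by (intro the_equality) blast+
  then show "Psi \<in> substochastic p m" "censored.nare Psi = 0" "is_block p m Psi"
    using X by (auto simp: minimal_nonneg_solution_def)
qed

lemma K_eq: "K = Cp_inv ** Qpp + Psi ** (abs_Cm_inv ** Qmp)"
  by (simp add: K_def matrix_mul_assoc)

lemma U_eq: "U = abs_Cm_inv ** Qmm + (abs_Cm_inv ** Qmp) ** Psi"
  by (simp add: U_def)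

lemma is_block_U: "is_block m m U"
  unfolding U_eq by (rule is_block_add[OF censored.blocks(4) is_block_mult[OF censored.blocks(3) Psi_solution(3)]])

lemma is_block_Psi_z: "is_block z m Psi_z"
  unfolding Psi_z_def
  using is_block_mult[OF zero_block_inverse(1) is_block_add[OF is_block_block is_block_mult[OF is_block_block Psi_solution(3)]]] .

lemma is_block_Kpz: "is_block p z Kpz"
  unfolding Kpz_def
  using is_block_add[OF is_block_mult[OF is_block_rates(1) is_block_block]
      is_block_mult[OF is_block_mult[OF Psi_solution(3) is_block_rates(2)] is_block_block]] .

lemma Pz_eq: "Pz = Kpz ** (N ** Ctz ** Psi_z)"
  by (simp add: Pz_def Psi_z_def matrix_mul_assoc)

lemma is_block_Pz: "is_block p m Pz"
  unfolding Pz_eq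
  using is_block_mult[OF is_block_Kpz is_block_mult[OF is_block_mult[OF zero_block_inverse(1) is_block_block] is_block_Psi_z]] .

lemma sylvester_unique: "\<exists>!X. sylvester_solution X"
proof -
  let ?R = "- (Psi ** abs_Cm_inv ** Ctm ** U) - Cp_inv ** Ctp ** Psi ** U - Pz ** U"
  have "is_block p m ?R"
    by (rule is_block_diff[OF is_block_diff[OF is_block_minus]]; rule is_block_mult[OF _ is_block_U])
      (rule is_block_mult[OF is_block_mult[OF Psi_solution(3) is_block_rates(2)] is_block_block]
        is_block_mult[OF is_block_mult[OF is_block_rates(1) is_block_block] Psi_solution(3)] is_block_Pz)+
  from censored.sylvester_unique_solution[OF Psi_solution(1,2) this]
  show ?thesis unfolding sylvester_solution_def K_eq U_eq[symmetric] .
qed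

lemma Psi1_p_solution: "sylvester_solution Psi1_p"
  unfolding Psi1_p_def by (rule theI'[OF sylvester_unique])

lemma is_block_Psi1_p: "is_block p m Psi1_p"
  using Psi1_p_solution by (simp add: sylvester_solution_def)

lemma is_block_Psi1_z: "is_block z m Psi1_z"
  unfolding Psi1_z_def
  by (rule is_block_add is_block_mult[OF is_block_mult[OF is_block_mult[OF zero_block_inverse(1) is_block_block]
        is_block_Psi_z] is_block_U]
      is_block_mult[OF is_block_mult[OF zero_block_inverse(1) is_block_block] is_block_Psi1_p])+

abbreviation pz :: "'s set" where "pz \<equiv> p \<union> z"

lemma is_block_Psi_bar: "is_block pz m Psi_bar"
  unfolding Psi_bar_def using Psi_solution(3) is_block_Psi_z
  by (intro is_block_add) (erule is_block_mono; auto)+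

lemma is_block_Psi1: "is_block pz m Psi1"
  unfolding Psi1_def using is_block_Psi1_p is_block_Psi1_z
  by (intro is_block_add) (erule is_block_mono; auto)+

end

context perturbed_fluid
begin

abbreviation "A_PM \<equiv> block pz m A"
abbreviation "A_PP \<equiv> block pz pz A"
abbreviation "A_MP \<equiv> block m pz A"

definition Cpz_eps :: "real \<Rightarrow> 's rmat" where "Cpz_eps \<epsilon> = block pz pz (C_eps \<epsilon>)"
text \<open>On \<open>m\<close> the rates stay negative, so \<open>- 1 / x\<close> is the reciprocal of the modulus; in this form it is a rational
function of \<open>\<epsilon>\<close>.\<close>

definition abs_Cm_inv_eps :: "real \<Rightarrow> 's rmat"
  where "abs_Cm_inv_eps \<epsilon> = block m m (diag (\<chi> i. - 1 / (c $ i + \<epsilon> * ct $ i)))"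
text \<open>The perturbed Riccati equation multiplied by the rates of the phases in \<open>p \<union> z\<close>. The factor \<open>1 / \<epsilon>\<close> of the
rows in \<open>z\<close> disappears, and the equation makes sense at \<open>\<epsilon> = 0\<close>.\<close>

definition scaled_riccati :: "real \<Rightarrow> 's rmat \<Rightarrow> 's rmat"
  where "scaled_riccati \<epsilon> X = A_PM + A_PP ** X + Cpz_eps \<epsilon> ** X ** abs_Cm_inv_eps \<epsilon> ** (Amm + A_MP ** X)"

lemma C_eps_diag: "C_eps \<epsilon> = diag (\<chi> i. c $ i + \<epsilon> * ct $ i)"
  by (simp add: C_eps_def vec_eq_iff diag_nth)

definition admissible :: "real \<Rightarrow> bool"
  where "admissible \<epsilon> \<longleftrightarrow> (\<forall>i. (c $ i > 0 \<longrightarrow> c $ i + \<epsilon> * ct $ i > 0) \<and> (c $ i < 0 \<longrightarrow> c $ i + \<epsilon> * ct $ i < 0))"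

lemma admissible_near_zero:
  obtains e where "0 < e" "\<And>\<epsilon>. 0 \<le> \<epsilon> \<Longrightarrow> \<epsilon> \<le> e \<Longrightarrow> admissible \<epsilon>"
proof -
  have "\<forall>\<^sub>F \<epsilon> in nhds 0. (c $ i > 0 \<longrightarrow> c $ i + \<epsilon> * ct $ i > 0) \<and> (c $ i < 0 \<longrightarrow> c $ i + \<epsilon> * ct $ i < 0)" for i
  proof -
    have lim: "((\<lambda>\<epsilon>. c $ i + \<epsilon> * ct $ i) \<longlongrightarrow> c $ i + 0 * ct $ i) (nhds 0)"
      by (intro tendsto_intros filterlim_ident)
    show ?thesis
    proof (cases "c $ i" "0 :: real" rule: linorder_cases)
      case less
      with order_tendstoD(2)[OF lim, of 0] show ?thesis by (auto elim: eventually_mono)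
    next
      case greater
      with order_tendstoD(1)[OF lim, of 0] show ?thesis by (auto elim: eventually_mono)
    qed simp
  qed
  then have "\<forall>\<^sub>F \<epsilon> in nhds 0. admissible \<epsilon>"
    unfolding admissible_def by (rule eventually_all_finite)
  then obtain d where "0 < d" "\<And>\<epsilon>. dist \<epsilon> 0 < d \<Longrightarrow> admissible \<epsilon>"
    unfolding eventually_nhds_metric by blast
  then show ?thesis by (intro that[of "d / 2"]) auto
qed

lemma block_inv_abs_C:
  assumes "admissible \<epsilon>"
  shows "block_inv m \<bar>C_eps \<epsilon>\<bar> = abs_Cm_inv_eps \<epsilon>"
proof -
  have abs_C: "\<bar>C_eps \<epsilon>\<bar> = diag (\<chi> i. \<bar>c $ i + \<epsilon> * ct $ i\<bar>)"
    by (simp add: C_eps_diag vec_eq_iff diag_nth abs_vec_def)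
  have neg: "c $ i + \<epsilon> * ct $ i < 0" if "i \<in> m" for i
    using assms that by (auto simp: admissible_def)
  have "block_inv m \<bar>C_eps \<epsilon>\<bar> = block m m (diag (\<chi> i. 1 / \<bar>c $ i + \<epsilon> * ct $ i\<bar>))"
  proof -
    have "(\<chi> i. \<bar>c $ i + \<epsilon> * ct $ i\<bar>) $ i \<noteq> 0" if "i \<in> m" for i
      using neg[OF that] by simp
    from block_inv_diag[of m, OF this] show ?thesis unfolding abs_C by simp
  qed
  also have "\<dots> = abs_Cm_inv_eps \<epsilon>"
  proof -
    have abs_neg: "1 / \<bar>x\<bar> = - 1 / x" if "x < 0" for x :: real
      using that by (simp add: abs_of_neg)
    have "1 / \<bar>c $ i + \<epsilon> * ct $ i\<bar> = - 1 / (c $ i + \<epsilon> * ct $ i)" if "i \<in> m" for i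
      by (rule abs_neg[OF neg[OF that]])
    then show ?thesis unfolding abs_Cm_inv_eps_def by (simp add: vec_eq_iff block_nth diag_nth)
  qed
  finally show ?thesis .
qed

lemma rate_up_positive:
  assumes "admissible \<epsilon>" "0 < \<epsilon>" "i \<in> pz"
  shows "0 < c $ i + \<epsilon> * ct $ i"
  using assms ct_positive[of i] by (cases "c $ i = 0") (auto simp: admissible_def)

text \<open>For \<open>\<epsilon> > 0\<close> no rate vanishes, and the perturbed equation is of the general form without
censoring, with rates scaled to modulus one.\<close>

lemma Psi_eps_solution:
  assumes "admissible \<epsilon>" "0 < \<epsilon>"
  shows "Psi_eps \<epsilon> \<in> substochastic pz m" "scaled_riccati \<epsilon> (Psi_eps \<epsilon>) = 0"
proof -
  define r where "r = block pz pz (diag (\<chi> i. 1 / (c $ i + \<epsilon> * ct $ i)))"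
  have pos: "0 < c $ i + \<epsilon> * ct $ i" if "i \<in> pz" for i
    by (rule rate_up_positive[OF assms that])
  have neg: "c $ i + \<epsilon> * ct $ i < 0" if "i \<in> m" for i
    using assms that by (auto simp: admissible_def)
  have r: "block_inv pz (C_eps \<epsilon>) = r"
  proof -
    have "(\<chi> i. c $ i + \<epsilon> * ct $ i) $ i \<noteq> 0" if "i \<in> pz" for i
      using pos[OF that] by simp
    from block_inv_diag[of pz, OF this] show ?thesis unfolding C_eps_diag r_def by simp
  qed
  have br: "is_block pz pz r" "is_block m m (abs_Cm_inv_eps \<epsilon>)"
    by (simp_all add: r_def abs_Cm_inv_eps_def)
  have r_nonneg: "0 \<le> r" "0 \<le> abs_Cm_inv_eps \<epsilon>"
  proof -
    have "0 \<le> 1 / (c $ i + \<epsilon> * ct $ i)" if "i \<in> pz" for i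
      using pos[OF that] by simp
    then show "0 \<le> r" unfolding r_def less_eq_vec_def block_nth diag_nth by simp
    have "0 \<le> - 1 / (c $ i + \<epsilon> * ct $ i)" if "i \<in> m" for i
      using neg[OF that] by (intro divide_nonpos_neg) auto
    then show "0 \<le> abs_Cm_inv_eps \<epsilon>" unfolding abs_Cm_inv_eps_def less_eq_vec_def block_nth diag_nth by simp
  qed
  have disj: "pz \<inter> m = {}" "m \<inter> pz = {}" and union: "pz \<union> m = UNIV" "m \<union> pz = UNIV" by auto
  interpret q: nare_blocks pz m "r ** A_PP" "r ** A_PM" "abs_Cm_inv_eps \<epsilon> ** A_MP" "abs_Cm_inv_eps \<epsilon> ** Amm"
  proof
    show "pz \<inter> m = {}" by (rule disj)
    show "is_block pz pz (r ** A_PP)" "is_block pz m (r ** A_PM)"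
      "is_block m pz (abs_Cm_inv_eps \<epsilon> ** A_MP)" "is_block m m (abs_Cm_inv_eps \<epsilon> ** Amm)"
      by (rule is_block_mult[OF br(1) is_block_block] is_block_mult[OF br(2) is_block_block])+
    show "metzler (r ** A_PP)"
      unfolding r_def by (rule metzler_diag_mult[OF metzler_block]) (use pos in \<open>auto intro: less_imp_le\<close>)
    show "metzler (abs_Cm_inv_eps \<epsilon> ** Amm)"
      unfolding abs_Cm_inv_eps_def by (rule metzler_diag_mult[OF metzler_block]) (use neg in \<open>auto intro: less_imp_le\<close>)
    show "0 \<le> r ** A_PM" "0 \<le> abs_Cm_inv_eps \<epsilon> ** A_MP"
      by (rule matrix_nonneg_mult[OF r_nonneg(1) offdiag_blocks_nonneg[OF disj(1)]]
          matrix_nonneg_mult[OF r_nonneg(2) offdiag_blocks_nonneg[OF disj(2)]])+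
    have "A_PP *v 1 + A_PM *v 1 = 0"
      using block_rows_one[of pz] unfolding union(1)[symmetric] block_Un_cols[OF disj(1)] matrix_vector_mult_add_rdistrib .
    then have "r ** A_PP *v 1 + r ** A_PM *v 1 = 0"
      by (simp only: matrix_vector_mul_assoc[symmetric] matrix_vector_right_distrib[symmetric] matrix_vector_mult_0_right)
    then show "r ** A_PP *v 1 + r ** A_PM *v 1 \<le> 0" by simp
    have "A_MP *v 1 + Amm *v 1 = 0"
      using block_rows_one[of m] unfolding union(1)[symmetric] block_Un_cols[OF disj(1)] matrix_vector_mult_add_rdistrib .
    then have "abs_Cm_inv_eps \<epsilon> ** A_MP *v 1 + abs_Cm_inv_eps \<epsilon> ** Amm *v 1 = 0"
      by (simp only: matrix_vector_mul_assoc[symmetric] matrix_vector_right_distrib[symmetric] matrix_vector_mult_0_right)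
    then show "abs_Cm_inv_eps \<epsilon> ** A_MP *v 1 + abs_Cm_inv_eps \<epsilon> ** Amm *v 1 \<le> 0" by simp
  qed
  have ric: "riccati_eps \<epsilon> X = q.nare X" for X
    unfolding riccati_eps_def q.nare_def r block_inv_abs_C[OF assms(1)] by (simp add: matrix_algebra add_ac)
  obtain X where X: "minimal_nonneg_solution pz m q.nare X" "X \<in> substochastic pz m"
    using q.minimal_solution_exists by blast
  have "riccati_eps \<epsilon> = q.nare" by (rule ext) (rule ric)
  then have Psi: "Psi_eps \<epsilon> = X"
    unfolding Psi_eps_def using X(1) minimal_nonneg_solution_unique by (intro the_equality) fastforce+
  show "Psi_eps \<epsilon> \<in> substochastic pz m" unfolding Psi by (rule X(2))
  have Cr: "Cpz_eps \<epsilon> ** r = I pz"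
  proof -
    have "block pz pz (diag (\<chi> i. (c $ i + \<epsilon> * ct $ i) * (1 / (c $ i + \<epsilon> * ct $ i)))) = I pz"
    proof -
      have "(c $ i + \<epsilon> * ct $ i) * (1 / (c $ i + \<epsilon> * ct $ i)) = 1" if "i \<in> pz" for i
        using pos[OF that] by simp
      then show ?thesis unfolding vec_eq_iff block_nth diag_nth mat_def by simp
    qed
    then show ?thesis unfolding Cpz_eps_def r_def C_eps_diag block_diag_mult_diag by simp
  qed
  have bX: "is_block pz m X" using X(2) by (simp add: substochastic_def)
  have "scaled_riccati \<epsilon> X = (Cpz_eps \<epsilon> ** r) ** A_PM + (Cpz_eps \<epsilon> ** r) ** (A_PP ** X)
      + Cpz_eps \<epsilon> ** X ** abs_Cm_inv_eps \<epsilon> ** (Amm + A_MP ** X)"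
    unfolding Cr scaled_riccati_def
    using is_block_mat_mult_left[OF is_block_block[of pz m A]]
      is_block_mat_mult_left[OF is_block_mult[OF is_block_block[of pz pz A] bX]] by simp
  also have "\<dots> = Cpz_eps \<epsilon> ** riccati_eps \<epsilon> X"
    unfolding riccati_eps_def r block_inv_abs_C[OF assms(1)] by (simp add: matrix_algebra)
  also have "\<dots> = 0"
    unfolding ric using X(1) by (simp add: minimal_nonneg_solution_def matrix_zero_right)
  finally show "scaled_riccati \<epsilon> (Psi_eps \<epsilon>) = 0" unfolding Psi .
qed

section \<open>The limiting equation and its linearization\<close>

abbreviation "Cp \<equiv> block p p (diag c)"

lemma Cpz_eps_0: "Cpz_eps 0 = Cp"
  by (auto simp: Cpz_eps_def C_eps_def vec_eq_iff block_nth diag_nth)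

lemma abs_Cm_inv_eps_0: "abs_Cm_inv_eps 0 = abs_Cm_inv"
  unfolding abs_Cm_inv_eq abs_Cm_inv_eps_def by (auto simp: vec_eq_iff block_nth diag_nth)

lemma Cp_inverse: "Cp_inv ** Cp = I p" "Cp ** Cp_inv = I p"
  unfolding Cp_inv_eq block_diag_mult_diag by (auto simp: vec_eq_iff block_nth diag_nth mat_def)

lemma Cp_Cp_inv_mult: "is_block p S Y \<Longrightarrow> Cp ** (Cp_inv ** Y) = Y"
  by (simp add: matrix_mul_assoc Cp_inverse(2) is_block_mat_mult_left)

lemma block_split:
  "A_PM = Apm + Azm" "A_PP = (App + Azp) + (Apz + block z z A)" "A_MP = Amp + Amz"
  "is_block pz m X \<Longrightarrow> X = block p m X + block z m X"
  by (auto simp: vec_eq_iff block_nth is_block_def)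

lemma stacked_products:
  assumes "is_block p m Xp" "is_block z m Xz"
  shows "A_PP ** (Xp + Xz) = (App ** Xp + Apz ** Xz) + (Azp ** Xp + block z z A ** Xz)"
    "A_MP ** (Xp + Xz) = Amp ** Xp + Amz ** Xz"
    "Cp ** (Xp + Xz) = Cp ** Xp"
proof -
  have "block R p X ** Xz = 0" "block R z X ** Xp = 0" for R X
    by (rule block_mult_disjoint[OF is_block_block assms(2)] block_mult_disjoint[OF is_block_block assms(1)]; auto)+
  then show "A_PP ** (Xp + Xz) = (App ** Xp + Apz ** Xz) + (Azp ** Xp + block z z A ** Xz)"
    "A_MP ** (Xp + Xz) = Amp ** Xp + Amz ** Xz"
    "Cp ** (Xp + Xz) = Cp ** Xp"
    unfolding block_split(2,3) by (simp_all add: matrix_add_ldistrib matrix_add_rdistrib)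
qed

text \<open>With \<open>zero_rows_solution\<close> this eliminates the rows in \<open>z\<close>, from the limiting equation as well as from its
linearization.\<close>

lemma zero_rows_solve:
  assumes "is_block z m Y" "B + block z z A ** Y = 0"
  shows "Y = N ** B"
proof -
  have "N ** B + (N ** block z z A) ** Y = 0"
    using arg_cong[OF assms(2), of "(**) N"] by (simp add: matrix_algebra)
  then show ?thesis
    unfolding zero_block_inverse(4) by (simp add: matrix_minus_left is_block_mat_mult_left[OF assms(1)])
qed

lemma zero_rows_solution:
  assumes "is_block z m B"
  shows "B + block z z A ** (N ** B) = 0"
proof -
  have "block z z A ** (N ** B) = (block z z A ** N) ** B" by (rule matrix_mul_assoc)
  also have "\<dots> = - B"
    unfolding zero_block_inverse(3) by (simp add: matrix_minus_left is_block_mat_mult_left[OF assms])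
  finally show ?thesis by (simp only: add.right_inverse)
qed

lemma up_zero_disjoint: "p \<inter> z = {}"
  by auto

text \<open>At \<open>\<epsilon> = 0\<close> the quadratic term has no rows in \<open>z\<close>. Inserting the rows in \<open>z\<close>, which the linear equation
there determines, into the rows in \<open>p\<close> produces the censored generator.\<close>

lemma limit_equation_iff:
  assumes X: "is_block p m Xp" "is_block z m Xz"
  shows "scaled_riccati 0 (Xp + Xz) = 0 \<longleftrightarrow> Xz = N ** (Azm + Azp ** Xp) \<and> censored.nare Xp = 0"
proof -
  \<comment> \<open>The rows in \<open>z\<close> and in \<open>p\<close> of the equation.\<close>
  define Rz where "Rz = (Azm + Azp ** Xp) + block z z A ** Xz"
  define Rp where "Rp = Apm + App ** Xp + Apz ** Xz + Cp ** (Xp ** abs_Cm_inv ** (Amm + (Amp ** Xp + Amz ** Xz)))"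
  have eq: "scaled_riccati 0 (Xp + Xz) = Rp + Rz"
    unfolding scaled_riccati_def Cpz_eps_0 abs_Cm_inv_eps_0 stacked_products[OF X] block_split(1) Rp_def Rz_def
    by (simp only: matrix_mul_assoc add_ac)
  have bz: "is_block z m (Azm + Azp ** Xp)"
    by (rule is_block_add[OF is_block_block is_block_mult[OF is_block_block X(1)]])
  have bRz: "is_block z m Rz"
    unfolding Rz_def by (rule is_block_add[OF bz is_block_mult[OF is_block_block X(2)]])
  have bW: "is_block m m (Amm + (Amp ** Xp + Amz ** Xz))"
    by (intro is_block_add is_block_block is_block_mult[OF is_block_block X(1)] is_block_mult[OF is_block_block X(2)])
  have bXVW: "is_block p m (Xp ** abs_Cm_inv ** (Amm + (Amp ** Xp + Amz ** Xz)))"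
    by (rule is_block_mult[OF is_block_mult[OF X(1) is_block_rates(2)] bW])
  have bRp: "is_block p m Rp"
    unfolding Rp_def
    by (intro is_block_add is_block_block is_block_mult[OF is_block_block X(1)] is_block_mult[OF is_block_block X(2)]
        is_block_mult[OF is_block_block bXVW])
  have "Rp + Rz = 0 \<longleftrightarrow> Rp = 0 \<and> Rz = 0"
    using block_add_eq_0[OF bRp bRz up_zero_disjoint] by auto
  also have "\<dots> \<longleftrightarrow> Cp_inv ** Rp = 0 \<and> Rz = 0"
    using Cp_Cp_inv_mult[OF bRp] by (metis matrix_zero_right)
  also have "Rz = 0 \<longleftrightarrow> Xz = N ** (Azm + Azp ** Xp)"
    using zero_rows_solve[OF X(2)] zero_rows_solution[OF bz] unfolding Rz_def by blast
  also have "(Cp_inv ** Rp = 0 \<and> Xz = N ** (Azm + Azp ** Xp)) \<longleftrightarrow>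
      (Xz = N ** (Azm + Azp ** Xp) \<and> censored.nare Xp = 0)"
  proof -
    have "Cp_inv ** Rp = censored.nare Xp" if Xz: "Xz = N ** (Azm + Azp ** Xp)"
    proof -
      have "Cp_inv ** Rp = Cp_inv ** (Apm + App ** Xp + Apz ** Xz) + (Cp_inv ** Cp) ** (Xp ** abs_Cm_inv ** (Amm + (Amp ** Xp + Amz ** Xz)))"
        by (simp add: Rp_def matrix_algebra)
      also have "\<dots> = Cp_inv ** (Apm + App ** Xp + Apz ** Xz) + Xp ** abs_Cm_inv ** (Amm + (Amp ** Xp + Amz ** Xz))"
        unfolding Cp_inverse(1) by (simp add: is_block_mat_mult_left[OF bXVW])
      also have "\<dots> = censored.nare Xp"
        unfolding Xz censored.nare_def unfolding Qpp_def Qpm_def Qmp_def Qmm_def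
        by (simp add: matrix_algebra add_ac)
      finally show ?thesis .
    qed
    then show ?thesis by auto
  qed
  finally show ?thesis unfolding eq .
qed

lemma Psi_bar_solution: "scaled_riccati 0 Psi_bar = 0"
  unfolding Psi_bar_def
  using limit_equation_iff[OF Psi_solution(3) is_block_Psi_z] Psi_solution(2) by (simp add: Psi_z_def)

lemma limit_solution_unique:
  assumes X: "X \<in> substochastic pz m" "scaled_riccati 0 X = 0"
  shows "X = Psi_bar"
proof -
  let ?Xp = "block p m X" and ?Xz = "block z m X"
  have X0: "is_block pz m X" "0 \<le> X" "X *v 1 \<le> 1" using X(1) by (auto simp: substochastic_def)
  have split: "X = ?Xp + ?Xz" by (rule block_split(4)[OF X0(1)])
  have sol: "?Xz = N ** (Azm + Azp ** ?Xp)" "censored.nare ?Xp = 0"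
    using limit_equation_iff[of ?Xp ?Xz] X(2) split by auto
  have "?Xp \<in> substochastic p m"
  proof -
    have "0 \<le> ?Xp" using X0(2) by (auto simp: less_eq_vec_def block_nth)
    have "(?Xp *v 1) $ i \<le> (X *v 1) $ i" for i
      using X0(2) unfolding matrix_vector_one_nth by (intro sum_mono) (auto simp: less_eq_vec_def block_nth)
    then have "?Xp *v 1 \<le> 1" using X0(3) by (meson less_eq_vec_def order_trans)
    with \<open>0 \<le> ?Xp\<close> show ?thesis by (simp add: substochastic_def)
  qed
  then have "?Xp = Psi"
    using censored.substochastic_solution_unique Psi_solution(1,2) sol(2) by blast
  then show ?thesis using split sol(1) by (simp add: Psi_bar_def Psi_z_def)
qed

lemma continuous_on_scaled_riccati:
  assumes "\<And>\<epsilon>. \<epsilon> \<in> T \<Longrightarrow> admissible \<epsilon>"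
  shows "continuous_on (T \<times> S) (\<lambda>(\<epsilon>, X). scaled_riccati \<epsilon> X)"
proof -
  have "continuous_on (T \<times> S) (\<lambda>x. if i = j \<and> i \<in> m then - 1 / (c $ i + fst x * ct $ i) else 0)" for i j
  proof (cases "i = j \<and> i \<in> m")
    case True
    have "c $ i + fst x * ct $ i < 0" if "x \<in> T \<times> S" for x
      using assms[of "fst x"] that True by (auto simp: admissible_def)
    then have "c $ i + fst x * ct $ i \<noteq> 0" if "x \<in> T \<times> S" for x
      using that by fastforce
    then show ?thesis using True by (auto intro!: continuous_intros)
  next
    case False
    then have "(if i = j \<and> i \<in> m then u else 0) = (0 :: real)" for u by auto
    then show ?thesis by (simp only: continuous_on_const)
  qed
  moreover have "abs_Cm_inv_eps \<epsilon> = (\<chi> i j. if i = j \<and> i \<in> m then - 1 / (c $ i + \<epsilon> * ct $ i) else 0)" for \<epsilon>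
    by (auto simp: abs_Cm_inv_eps_def vec_eq_iff block_nth diag_nth)
  ultimately have V: "continuous_on (T \<times> S) (\<lambda>x. abs_Cm_inv_eps (fst x))"
    by (simp add: continuous_on_vec_lambda)
  have "Cpz_eps \<epsilon> = block pz pz (diag c) + \<epsilon> *\<^sub>R block pz pz (diag ct)" for \<epsilon>
    by (auto simp: Cpz_eps_def C_eps_def vec_eq_iff block_nth)
  then have "continuous_on (T \<times> S) (\<lambda>x. Cpz_eps (fst x))"
    by (auto intro!: continuous_intros)
  with V show ?thesis
    unfolding scaled_riccati_def case_prod_unfold by (intro continuous_intros)
qed

lemma Psi_eps_tendsto: "(Psi_eps \<longlongrightarrow> Psi_bar) (at_right 0)"
proof -
  obtain e where e: "0 < e" "\<And>\<epsilon>. 0 \<le> \<epsilon> \<Longrightarrow> \<epsilon> \<le> e \<Longrightarrow> admissible \<epsilon>"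
    using admissible_near_zero by blast
  show ?thesis
  proof (rule tendsto_unique_zero_in_compact[OF compact_substochastic e(1)])
    show "continuous_on ({0..e} \<times> substochastic pz m) (\<lambda>(\<epsilon>, X). scaled_riccati \<epsilon> X)"
      by (rule continuous_on_scaled_riccati) (use e in auto)
    show "X = Psi_bar" if "X \<in> substochastic pz m" "scaled_riccati 0 X = 0" for X
      by (rule limit_solution_unique[OF that])
    show "Psi_eps t \<in> substochastic pz m \<and> scaled_riccati t (Psi_eps t) = 0" if "0 < t" "t \<le> e" for t
      using Psi_eps_solution[OF e(2)] that by auto
  qed
qed

definition W_bar :: "'s rmat" where "W_bar = Amm + A_MP ** Psi_bar"

text \<open>The derivative of \<open>scaled_riccati 0\<close> at \<open>Psi_bar\<close>.\<close>

definition linearized :: "'s rmat \<Rightarrow> 's rmat"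
  where "linearized H = A_PP ** H + Cp ** H ** abs_Cm_inv ** W_bar + Cp ** Psi_bar ** abs_Cm_inv ** A_MP ** H"

lemma U_eq_W_bar: "abs_Cm_inv ** W_bar = U"
  unfolding W_bar_def Psi_bar_def stacked_products[OF Psi_solution(3) is_block_Psi_z]
  unfolding U_def Qmm_def Qmp_def Psi_z_def
  by (simp add: matrix_algebra add_ac)

lemma linearized_stacked:
  assumes H: "is_block p m Hp" "is_block z m Hz"
  shows "linearized (Hp + Hz) = (App ** Hp + Apz ** Hz + Cp ** (Hp ** U + Psi ** abs_Cm_inv ** (Amp ** Hp + Amz ** Hz)))
      + (Azp ** Hp + block z z A ** Hz)"
proof -
  have "Cp ** Psi_bar = Cp ** Psi"
    unfolding Psi_bar_def by (rule stacked_products[OF Psi_solution(3) is_block_Psi_z])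
  moreover have "Cp ** Psi_bar ** abs_Cm_inv ** A_MP ** (Hp + Hz) = Cp ** Psi_bar ** abs_Cm_inv ** (Amp ** Hp + Amz ** Hz)"
    unfolding stacked_products(2)[OF H, symmetric] by (simp only: matrix_mul_assoc)
  moreover have "Cp ** (Hp + Hz) ** abs_Cm_inv ** W_bar = Cp ** Hp ** U"
    unfolding stacked_products(3)[OF H] U_eq_W_bar[symmetric] by (simp only: matrix_mul_assoc)
  ultimately show ?thesis
    unfolding linearized_def stacked_products(1)[OF H]
    by (simp add: matrix_add_ldistrib matrix_mul_assoc add_ac)
qed

text \<open>Elimination of the rows in \<open>z\<close> of the increment, with a general right-hand side: the zero right-hand side
gives injectivity, another one gives the first-order coefficient. The operator that is left on the
rows in \<open>p\<close> is the one of the Sylvester equation, and \<open>Kpz\<close> carries the sources in \<open>z\<close> over to \<open>p\<close>.\<close>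

lemma linearized_eq_iff:
  assumes H: "is_block p m Hp" "is_block z m Hz" and S: "is_block p m Sp" "is_block z m Sz"
  shows "linearized (Hp + Hz) = Cp ** Sp + Sz \<longleftrightarrow>
    Hz = N ** (Azp ** Hp - Sz) \<and> K ** Hp + Hp ** U = Sp + Kpz ** (N ** Sz)"
proof -
  define Rz where "Rz = (Azp ** Hp - Sz) + block z z A ** Hz"
  define Y where "Y = Hp ** U + Psi ** abs_Cm_inv ** (Amp ** Hp + Amz ** Hz) - Sp"
  define Rp where "Rp = App ** Hp + Apz ** Hz + Cp ** Y"
  have eq: "linearized (Hp + Hz) - (Cp ** Sp + Sz) = Rp + Rz"
    unfolding linearized_stacked[OF H] Rp_def Rz_def Y_def by (simp add: matrix_diff_ldistrib)
  have bz: "is_block z m (Azp ** Hp - Sz)"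
    by (rule is_block_diff[OF is_block_mult[OF is_block_block H(1)] S(2)])
  have bRz: "is_block z m Rz"
    unfolding Rz_def by (rule is_block_add[OF bz is_block_mult[OF is_block_block H(2)]])
  have bW: "is_block m m (Amp ** Hp + Amz ** Hz)"
    by (rule is_block_add[OF is_block_mult[OF is_block_block H(1)] is_block_mult[OF is_block_block H(2)]])
  have bY: "is_block p m Y"
    unfolding Y_def
    by (rule is_block_diff[OF is_block_add[OF is_block_mult[OF H(1) is_block_U]
        is_block_mult[OF is_block_mult[OF Psi_solution(3) is_block_rates(2)] bW]] S(1)])
  have bRp: "is_block p m Rp"
    unfolding Rp_def
    by (intro is_block_add is_block_mult[OF is_block_block H(1)] is_block_mult[OF is_block_block H(2)]
        is_block_mult[OF is_block_block bY])
  have "linearized (Hp + Hz) = Cp ** Sp + Sz \<longleftrightarrow> Rp + Rz = 0"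
    unfolding eq[symmetric] by simp
  also have "\<dots> \<longleftrightarrow> Rp = 0 \<and> Rz = 0"
    using block_add_eq_0[OF bRp bRz up_zero_disjoint] by auto
  also have "\<dots> \<longleftrightarrow> Cp_inv ** Rp = 0 \<and> Rz = 0"
    using Cp_Cp_inv_mult[OF bRp] by (metis matrix_zero_right)
  also have "Rz = 0 \<longleftrightarrow> Hz = N ** (Azp ** Hp - Sz)"
    using zero_rows_solve[OF H(2)] zero_rows_solution[OF bz] unfolding Rz_def by blast
  also have "(Cp_inv ** Rp = 0 \<and> Hz = N ** (Azp ** Hp - Sz)) \<longleftrightarrow>
      (Hz = N ** (Azp ** Hp - Sz) \<and> K ** Hp + Hp ** U = Sp + Kpz ** (N ** Sz))"
  proof -
    have "Cp_inv ** Rp = K ** Hp + Hp ** U - (Sp + Kpz ** (N ** Sz))" if Hz: "Hz = N ** (Azp ** Hp - Sz)"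
    proof -
      have "Cp_inv ** Rp = Cp_inv ** (App ** Hp + Apz ** Hz) + (Cp_inv ** Cp) ** Y"
        by (simp add: Rp_def matrix_algebra)
      also have "\<dots> = Cp_inv ** (App ** Hp + Apz ** Hz) + Y"
        unfolding Cp_inverse(1) by (simp add: is_block_mat_mult_left[OF bY])
      also have "\<dots> = K ** Hp + Hp ** U - (Sp + Kpz ** (N ** Sz))"
        unfolding Hz Y_def K_def Kpz_def Qpp_def Qmp_def
        by (simp add: matrix_algebra)
      finally show ?thesis .
    qed
    then show ?thesis by auto
  qed
  finally show ?thesis .
qed

lemma linearized_injective:
  assumes "is_block pz m H" "linearized H = 0"
  shows "H = 0"
proof -
  let ?Hp = "block p m H" and ?Hz = "block z m H"
  have split: "H = ?Hp + ?Hz" by (rule block_split(4)[OF assms(1)])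
  have "linearized (?Hp + ?Hz) = Cp ** 0 + 0"
    using assms(2) split by (simp add: matrix_zero_right)
  then have *: "?Hz = N ** (Azp ** ?Hp - 0) \<and> K ** ?Hp + ?Hp ** U = 0 + Kpz ** (N ** 0)"
    by (subst (asm) linearized_eq_iff) (simp_all add: is_block_zero)
  then have "K ** ?Hp + ?Hp ** U = 0" by (simp add: matrix_zero_right)
  then have "?Hp = 0"
    unfolding K_eq U_eq by (rule censored.sylvester_injective[OF Psi_solution(1,2) is_block_block])
  moreover from this have "?Hz = 0" using * by (simp add: matrix_zero_right)
  ultimately show ?thesis using split by simp
qed

text \<open>The equation for \<open>Psi1\<close> that results from differentiating \<open>scaled_riccati \<epsilon> X\<close> along the branch: the
right-hand side is minus the derivative with respect to \<open>\<epsilon>\<close> at \<open>Psi_bar\<close>, where the two terms come from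
the rates of \<open>p \<union> z\<close> and from the reciprocal rates of \<open>m\<close>.\<close>

lemma linearized_Psi1:
  "linearized Psi1 = - (block pz pz (diag ct) ** Psi_bar ** abs_Cm_inv ** W_bar
      + Cp ** Psi_bar ** (abs_Cm_inv ** Ctm ** abs_Cm_inv) ** W_bar)"
proof -
  \<comment> \<open>Right-hand side with the rates of \<open>p\<close> divided out, which is the scaling of the Sylvester equation.\<close>
  define Sp where "Sp = - (Psi ** abs_Cm_inv ** Ctm ** U) - Cp_inv ** Ctp ** Psi ** U"
  define Sz where "Sz = - (Ctz ** Psi_z ** U)"
  have bSp: "is_block p m Sp" unfolding Sp_def
    by (rule is_block_diff[OF is_block_minus]; rule is_block_mult[OF _ is_block_U])
      (rule is_block_mult[OF is_block_mult[OF Psi_solution(3) is_block_rates(2)] is_block_block]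
        is_block_mult[OF is_block_mult[OF is_block_rates(1) is_block_block] Psi_solution(3)])+
  have bSz: "is_block z m Sz" unfolding Sz_def
    by (intro is_block_minus is_block_mult[OF is_block_mult[OF is_block_block is_block_Psi_z] is_block_U])
  have "Psi1_z = N ** (Azp ** Psi1_p - Sz)"
    by (simp add: Psi1_z_def Sz_def matrix_algebra add.commute)
  moreover have "K ** Psi1_p + Psi1_p ** U = Sp + Kpz ** (N ** Sz)"
    using Psi1_p_solution by (simp add: sylvester_solution_def Sp_def Sz_def Pz_eq matrix_algebra)
  ultimately have "linearized Psi1 = Cp ** Sp + Sz"
    unfolding Psi1_def linearized_eq_iff[OF is_block_Psi1_p is_block_Psi1_z bSp bSz] by blast
  also have "Cp ** Sp = - (Ctp ** Psi ** U + Cp ** Psi ** abs_Cm_inv ** Ctm ** U)"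
  proof -
    have "Cp ** (Cp_inv ** Ctp ** Psi ** U) = Ctp ** Psi ** U"
      unfolding matrix_mul_assoc Cp_inverse(2) is_block_mat_mult_left[OF is_block_block] ..
    then show ?thesis
      by (simp add: Sp_def matrix_diff_ldistrib matrix_minus_right) (simp add: matrix_mul_assoc add.commute)
  qed
  also have "- (Ctp ** Psi ** U + Cp ** Psi ** abs_Cm_inv ** Ctm ** U) + Sz
     = - ((Ctp ** Psi + Ctz ** Psi_z) ** U + Cp ** Psi ** abs_Cm_inv ** Ctm ** U)"
    by (simp add: Sz_def matrix_algebra)
  also have "Ctp ** Psi + Ctz ** Psi_z = block pz pz (diag ct) ** Psi_bar"
    using is_blockD[OF Psi_solution(3)] is_blockD[OF is_block_Psi_z]
    by (auto simp: Psi_bar_def vec_eq_iff block_diag_mult_left)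
  also have "Cp ** Psi = Cp ** Psi_bar"
    unfolding Psi_bar_def by (rule stacked_products(3)[OF Psi_solution(3) is_block_Psi_z, symmetric])
  finally show ?thesis unfolding U_eq_W_bar[symmetric] by (simp add: matrix_mul_assoc)
qed

end

section \<open>Complexification\<close>

definition cmat :: "real ^ 'n ^ 'm \<Rightarrow> complex ^ 'n ^ 'm"
  where "cmat X = (\<chi> i j. complex_of_real (X $ i $ j))"

text \<open>Used with the real and the imaginary part, to reduce complex linear equations with real coefficients to
real ones.\<close>

definition rmap :: "(complex \<Rightarrow> real) \<Rightarrow> complex ^ 'n ^ 'm \<Rightarrow> real ^ 'n ^ 'm"
  where "rmap f X = (\<chi> i j. f (X $ i $ j))"

lemma cmat_nth: "cmat X $ i $ j = complex_of_real (X $ i $ j)"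
  by (simp add: cmat_def)

lemma cmat_algebra:
  "cmat (X + Y) = cmat X + cmat Y" "cmat (X - Y) = cmat X - cmat Y" "cmat (- X) = - cmat X" "cmat 0 = 0"
  by (simp_all add: cmat_def vec_eq_iff)

lemma cmat_mult: "cmat (X ** Y) = cmat X ** cmat Y"
  by (simp add: cmat_def vec_eq_iff matrix_matrix_mult_def)

lemma rmap_algebra:
  assumes "linear f"
  shows "rmap f (X + Y) = rmap f X + rmap f Y" "rmap f (X - Y) = rmap f X - rmap f Y"
    "rmap f (cmat Z ** X) = Z ** rmap f X" "rmap f (X ** cmat Z) = rmap f X ** Z" "rmap f 0 = 0"
proof -
  interpret f: linear f by fact
  have *: "f (complex_of_real a * w) = a * f w" "f (w * complex_of_real a) = f w * a" for a w
    using f.scale[of a w] by (simp_all add: scaleR_conv_of_real mult.commute)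
  show "rmap f (X + Y) = rmap f X + rmap f Y" "rmap f (X - Y) = rmap f X - rmap f Y" "rmap f 0 = 0"
    by (simp_all add: rmap_def vec_eq_iff f.add f.diff f.zero)
  show "rmap f (cmat Z ** X) = Z ** rmap f X" "rmap f (X ** cmat Z) = rmap f X ** Z"
    by (simp_all add: rmap_def vec_eq_iff matrix_matrix_mult_def cmat_nth f.sum *)
qed

lemma rmap_eq_0: "rmap Re X = 0 \<Longrightarrow> rmap Im X = 0 \<Longrightarrow> X = 0"
  by (simp add: rmap_def vec_eq_iff complex_eq_iff)

lemma norm_le_entry_sum:
  fixes X :: "real ^ 'n ^ 'm"
  shows "norm X \<le> (\<Sum>i\<in>UNIV. \<Sum>j\<in>UNIV. \<bar>X $ i $ j\<bar>)"
proof -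
  have "norm X \<le> (\<Sum>i\<in>UNIV. norm (X $ i))"
    unfolding norm_vec_def by (rule L2_set_le_sum) simp
  also have "\<dots> \<le> (\<Sum>i\<in>UNIV. \<Sum>j\<in>UNIV. \<bar>X $ i $ j\<bar>)"
    by (intro sum_mono norm_le_l1_cart)
  finally show ?thesis .
qed

context perturbed_fluid
begin

definition V_c :: "complex \<Rightarrow> complex ^ 's ^ 's"
  where "V_c w = (\<chi> i j. if i = j \<and> i \<in> m then - 1 / (of_real (c $ i) + w * of_real (ct $ i)) else 0)"

text \<open>The divided difference of \<open>V_c\<close>, see \<open>V_c_diff\<close>.\<close>

definition V_diff :: "complex \<Rightarrow> complex \<Rightarrow> complex ^ 's ^ 's"
  where "V_diff w v = (\<chi> i j. if i = j \<and> i \<in> m then of_real (ct $ i) /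
    ((of_real (c $ i) + w * of_real (ct $ i)) * (of_real (c $ i) + v * of_real (ct $ i))) else 0)"

definition C_c :: "complex \<Rightarrow> complex ^ 's ^ 's"
  where "C_c w = cmat Cp + mat w ** cmat (block pz pz (diag ct))"

text \<open>The block with rows in \<open>p \<union> z\<close> and columns in \<open>m\<close>, as a product, which makes it visibly complex linear and
continuous.\<close>

definition phase_proj :: "complex ^ 's ^ 's \<Rightarrow> complex ^ 's ^ 's"
  where "phase_proj X = cmat (I pz) ** X ** cmat (I m)"

definition W_c :: "complex ^ 's ^ 's \<Rightarrow> complex ^ 's ^ 's"
  where "W_c X = cmat Amm + cmat A_MP ** phase_proj X"

text \<open>The complexified equation. The last term forces the entries outside the block to vanish, which makes the
linearization invertible on all square matrices.\<close>

definition equation :: "complex \<Rightarrow> complex ^ 's ^ 's \<Rightarrow> complex ^ 's ^ 's"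
  where "equation w X = cmat A_PM + cmat A_PP ** phase_proj X + C_c w ** phase_proj X ** V_c w ** W_c X + (X - phase_proj X)"

definition secant :: "complex \<Rightarrow> complex ^ 's ^ 's \<Rightarrow> complex ^ 's ^ 's \<Rightarrow> complex ^ 's ^ 's \<Rightarrow> complex ^ 's ^ 's"
  where "secant w X Y H = cmat A_PP ** phase_proj H + C_c w ** phase_proj H ** V_c w ** W_c X
    + C_c w ** phase_proj Y ** V_c w ** cmat A_MP ** phase_proj H + (H - phase_proj H)"

text \<open>The divided difference of \<open>equation\<close> in the parameter, see \<open>equation_secant_param\<close>.\<close>

definition secant_param :: "complex \<Rightarrow> complex \<Rightarrow> complex ^ 's ^ 's \<Rightarrow> complex ^ 's ^ 's"
  where "secant_param w v X = cmat (block pz pz (diag ct)) ** phase_proj X ** V_c w ** W_c X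
    + C_c v ** phase_proj X ** V_diff w v ** W_c X"

lemma phase_proj_algebra: "phase_proj (X + Y) = phase_proj X + phase_proj Y" "phase_proj (X - Y) = phase_proj X - phase_proj Y"
  "phase_proj (r *\<^sub>R X) = r *\<^sub>R phase_proj X" "phase_proj 0 = 0"
  by (simp_all add: phase_proj_def matrix_algebra)

lemma phase_proj_cmat: "is_block pz m X \<Longrightarrow> phase_proj (cmat X) = cmat X"
  unfolding phase_proj_def cmat_mult[symmetric] by (simp add: is_block_mat_mult_left is_block_mat_mult_right)

lemma phase_proj_mat: "phase_proj (mat a ** H) = mat a ** phase_proj H"
  unfolding phase_proj_def mat_mult_left_commute by (simp only: matrix_mul_assoc)

lemma linear_secant: "linear (secant w X Y)"
  by (rule linearI) (simp_all add: secant_def phase_proj_algebra matrix_algebra scaleR_add_right scaleR_diff_right)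

lemma secant_mat: "secant w X Y (mat a ** H) = mat a ** secant w X Y H"
  unfolding secant_def phase_proj_mat
  by (simp only: matrix_mul_assoc[symmetric] mat_mult_left_commute matrix_add_ldistrib matrix_diff_ldistrib)

lemma equation_secant: "equation w X - equation w Y = secant w X Y (X - Y)"
  unfolding equation_def secant_def W_c_def by (simp add: phase_proj_algebra matrix_algebra)

lemma V_c_diff:
  assumes "\<And>i. i \<in> m \<Longrightarrow> of_real (c $ i) + w * of_real (ct $ i) \<noteq> 0"
    "\<And>i. i \<in> m \<Longrightarrow> of_real (c $ i) + v * of_real (ct $ i) \<noteq> 0"
  shows "V_c w - V_c v = mat (w - v) ** V_diff w v"
proof -
  have "- 1 / a - - 1 / b = (w - v) * (t / (a * b))"
    if "a \<noteq> 0" "b \<noteq> 0" "a - b = (w - v) * t" for a b t :: complex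
    using that by (simp add: field_simps)
  note * = this
  have "- 1 / (of_real (c $ i) + w * of_real (ct $ i)) - - 1 / (of_real (c $ i) + v * of_real (ct $ i))
    = (w - v) * (of_real (ct $ i) / ((of_real (c $ i) + w * of_real (ct $ i)) * (of_real (c $ i) + v * of_real (ct $ i))))"
    if "i \<in> m" for i
    by (rule *[OF assms[OF that]]) (simp add: algebra_simps)
  note diff = this
  have "(V_c w - V_c v) $ i $ j = (mat (w - v) ** V_diff w v) $ i $ j" for i j
  proof (cases "i = j \<and> i \<in> m")
    case True
    then have "i \<in> m" by blast
    from diff[OF this] show ?thesis
      unfolding mat_mult_nth V_c_def V_diff_def vector_minus_component vec_lambda_beta if_P[OF True] .
  next
    case False
    show ?thesis
      unfolding mat_mult_nth V_c_def V_diff_def vector_minus_component vec_lambda_beta if_not_P[OF False] by simp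
  qed
  then show ?thesis by (simp add: vec_eq_iff)
qed

lemma equation_secant_param:
  assumes "\<And>i. i \<in> m \<Longrightarrow> of_real (c $ i) + w * of_real (ct $ i) \<noteq> 0"
    "\<And>i. i \<in> m \<Longrightarrow> of_real (c $ i) + v * of_real (ct $ i) \<noteq> 0"
  shows "equation w X - equation v X = mat (w - v) ** secant_param w v X"
proof -
  have V: "V_c w - V_c v = mat (w - v) ** V_diff w v"
    using assms by (rule V_c_diff)
  have C: "C_c w - C_c v = mat (w - v) ** cmat (block pz pz (diag ct))"
    by (simp add: C_c_def vec_eq_iff mat_mult_nth left_diff_distrib)
  have "equation w X - equation v X = C_c w ** phase_proj X ** V_c w ** W_c X - C_c v ** phase_proj X ** V_c v ** W_c X"
    by (simp add: equation_def)
  also have "\<dots> = (C_c w - C_c v) ** (phase_proj X ** V_c w ** W_c X) + C_c v ** (phase_proj X ** ((V_c w - V_c v) ** W_c X))"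
    by (simp add: matrix_algebra)
  also have "\<dots> = mat (w - v) ** secant_param w v X"
    unfolding secant_param_def V C
    by (simp only: matrix_mul_assoc[symmetric] mat_mult_left_commute matrix_add_ldistrib)
  finally show ?thesis .
qed

lemma tendsto_V_c:
  assumes "(f \<longlongrightarrow> w) F" "\<And>i. i \<in> m \<Longrightarrow> of_real (c $ i) + w * of_real (ct $ i) \<noteq> 0"
  shows "((\<lambda>x. V_c (f x)) \<longlongrightarrow> V_c w) F"
  unfolding V_c_def
proof (intro tendsto_vec_lambda)
  fix i j
  show "((\<lambda>x. if i = j \<and> i \<in> m then - 1 / (of_real (c $ i) + f x * of_real (ct $ i)) else 0)
    \<longlongrightarrow> (if i = j \<and> i \<in> m then - 1 / (of_real (c $ i) + w * of_real (ct $ i)) else 0)) F"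
  proof (cases "i = j \<and> i \<in> m")
    case True
    show ?thesis
      unfolding if_P[OF True] using assms(2)[of i] True by (intro tendsto_intros assms(1)) auto
  next
    case False
    show ?thesis unfolding if_not_P[OF False] by (rule tendsto_const)
  qed
qed

lemma tendsto_V_diff:
  assumes "(f \<longlongrightarrow> w) F" "\<And>i. i \<in> m \<Longrightarrow> of_real (c $ i) + w * of_real (ct $ i) \<noteq> 0"
    "\<And>i. i \<in> m \<Longrightarrow> of_real (c $ i) + v * of_real (ct $ i) \<noteq> 0"
  shows "((\<lambda>x. V_diff (f x) v) \<longlongrightarrow> V_diff w v) F"
  unfolding V_diff_def
proof (intro tendsto_vec_lambda)
  fix i j
  show "((\<lambda>x. if i = j \<and> i \<in> m then of_real (ct $ i) /
      ((of_real (c $ i) + f x * of_real (ct $ i)) * (of_real (c $ i) + v * of_real (ct $ i))) else 0)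
    \<longlongrightarrow> (if i = j \<and> i \<in> m then of_real (ct $ i) /
      ((of_real (c $ i) + w * of_real (ct $ i)) * (of_real (c $ i) + v * of_real (ct $ i))) else 0)) F"
  proof (cases "i = j \<and> i \<in> m")
    case True
    show ?thesis
      unfolding if_P[OF True] using assms(2,3)[of i] True by (intro tendsto_intros assms(1)) auto
  next
    case False
    show ?thesis unfolding if_not_P[OF False] by (rule tendsto_const)
  qed
qed

lemma tendsto_mat: "(f \<longlongrightarrow> a) F \<Longrightarrow> ((\<lambda>x. mat (f x)) \<longlongrightarrow> (mat a :: complex ^ 's ^ 's)) F"
  unfolding mat_def by (intro tendsto_vec_lambda) simp

lemma tendsto_C_c: "(f \<longlongrightarrow> w) F \<Longrightarrow> ((\<lambda>x. C_c (f x)) \<longlongrightarrow> C_c w) F"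
  unfolding C_c_def by (intro tendsto_intros tendsto_mat)

lemma tendsto_phase_proj: "(f \<longlongrightarrow> X) F \<Longrightarrow> ((\<lambda>x. phase_proj (f x)) \<longlongrightarrow> phase_proj X) F"
  unfolding phase_proj_def by (intro tendsto_intros)

lemma tendsto_W_c: "(f \<longlongrightarrow> X) F \<Longrightarrow> ((\<lambda>x. W_c (f x)) \<longlongrightarrow> W_c X) F"
  unfolding W_c_def by (intro tendsto_intros tendsto_phase_proj)

lemma tendsto_secant:
  assumes "\<And>i. i \<in> m \<Longrightarrow> of_real (c $ i) + w * of_real (ct $ i) \<noteq> 0"
  shows "((\<lambda>(w, X, Y). secant w X Y H) \<longlongrightarrow> secant w X Y H) (nhds (w, X, Y))"
proof -
  have id: "((\<lambda>x. x) \<longlongrightarrow> (w, X, Y)) (nhds (w, X, Y))" by (rule filterlim_ident)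
  have 1: "(fst \<longlongrightarrow> w) (nhds (w, X, Y))" "((\<lambda>x. fst (snd x)) \<longlongrightarrow> X) (nhds (w, X, Y))"
    "((\<lambda>x. snd (snd x)) \<longlongrightarrow> Y) (nhds (w, X, Y))"
    using tendsto_fst[OF id] tendsto_fst[OF tendsto_snd[OF id]] tendsto_snd[OF tendsto_snd[OF id]] by simp_all
  show ?thesis
    unfolding secant_def case_prod_unfold
    by (intro tendsto_add tendsto_matrix_mult tendsto_const tendsto_C_c tendsto_V_c tendsto_W_c tendsto_phase_proj 1 assms)
qed

lemma tendsto_secant_param:
  assumes "\<And>i. i \<in> m \<Longrightarrow> of_real (c $ i) + v * of_real (ct $ i) \<noteq> 0"
  shows "((\<lambda>w. secant_param w v X) \<longlongrightarrow> secant_param v v X) (nhds v)"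
  unfolding secant_param_def
  by (intro tendsto_add tendsto_matrix_mult tendsto_const tendsto_V_c tendsto_V_diff filterlim_ident assms)

lemma C_c_0: "C_c 0 = cmat Cp"
  by (simp add: C_c_def vec_eq_iff mat_mult_nth)

lemma C_c_real: "C_c (of_real \<epsilon>) = cmat (Cpz_eps \<epsilon>)"
  unfolding C_c_def Cpz_eps_def by (auto simp: vec_eq_iff mat_mult_nth cmat_nth block_nth C_eps_def diag_nth)

lemma V_c_real: "V_c (of_real \<epsilon>) = cmat (abs_Cm_inv_eps \<epsilon>)"
  by (auto simp: V_c_def abs_Cm_inv_eps_def vec_eq_iff cmat_nth block_nth diag_nth)

lemma V_c_0: "V_c 0 = cmat abs_Cm_inv"
  using V_c_real[of 0] by (simp add: abs_Cm_inv_eps_0)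

lemma V_diff_0: "V_diff 0 0 = cmat (abs_Cm_inv ** Ctm ** abs_Cm_inv)"
  unfolding abs_Cm_inv_eq block_diag_mult_diag
  by (auto simp: V_diff_def vec_eq_iff cmat_nth block_nth diag_nth)

lemma equation_real:
  assumes "is_block pz m X"
  shows "equation (of_real \<epsilon>) (cmat X) = cmat (scaled_riccati \<epsilon> X)"
  unfolding equation_def W_c_def phase_proj_cmat[OF assms] C_c_real V_c_real scaled_riccati_def
  by (simp add: cmat_algebra cmat_mult)

lemma secant_at_limit:
  "secant 0 (cmat Psi_bar) (cmat Psi_bar) H = cmat A_PP ** phase_proj H + cmat Cp ** phase_proj H ** cmat (abs_Cm_inv ** W_bar)
    + cmat (Cp ** Psi_bar ** abs_Cm_inv ** A_MP) ** phase_proj H + (H - phase_proj H)"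
  unfolding secant_def W_c_def phase_proj_cmat[OF is_block_Psi_bar] C_c_0 V_c_0 W_bar_def
  by (simp add: cmat_algebra cmat_mult matrix_algebra)

lemma is_block_linearized: "is_block pz m H \<Longrightarrow> is_block pz m (linearized H)"
proof -
  assume H: "is_block pz m H"
  have Cp: "is_block pz pz Cp" by (rule is_block_mono[OF is_block_block]) auto
  have W: "is_block m m W_bar"
    unfolding W_bar_def by (rule is_block_add[OF is_block_block is_block_mult[OF is_block_block is_block_Psi_bar]])
  show ?thesis
    unfolding linearized_def
    by (rule is_block_add[OF is_block_add[OF is_block_mult[OF is_block_block H]
        is_block_mult[OF is_block_mult[OF is_block_mult[OF Cp H] is_block_rates(2)] W]]
      is_block_mult[OF is_block_mult[OF is_block_mult[OF is_block_mult[OF Cp is_block_Psi_bar] is_block_rates(2)] is_block_block] H]])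
qed

text \<open>The coefficients at the limit are real, so the real and the imaginary part of \<open>H\<close> satisfy the equation
separately. Off the block it says that \<open>H\<close> vanishes, and on the block \<open>linearized_injective\<close>
applies.\<close>

lemma secant_injective:
  assumes "secant 0 (cmat Psi_bar) (cmat Psi_bar) H = 0"
  shows "H = 0"
proof -
  have "rmap f H = 0" if f: "linear f" for f
  proof -
    let ?G = "rmap f H"
    let ?B = "I pz ** ?G ** I m"
    have phase_proj: "rmap f (phase_proj H) = ?B"
      unfolding phase_proj_def by (simp add: rmap_algebra[OF f])
    have bB: "is_block pz m ?B"
      by (auto simp: is_block_def mat_1_eq_diag block_diag_mult_left block_diag_mult_right)
    have "0 = rmap f (secant 0 (cmat Psi_bar) (cmat Psi_bar) H)"
      unfolding assms by (simp add: rmap_algebra[OF f])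
    also have "\<dots> = linearized ?B + (?G - ?B)"
      unfolding secant_at_limit linearized_def
      by (simp add: rmap_algebra[OF f] phase_proj) (simp add: matrix_mul_assoc)
    finally have eq: "?G - ?B = - linearized ?B" by (simp add: eq_neg_iff_add_eq_0 add.commute)
    then have "is_block pz m (?G - ?B)"
      using is_block_minus[OF is_block_linearized[OF bB]] by simp
    then have "is_block pz m (?G - ?B + ?B)" by (rule is_block_add[OF _ bB])
    then have "is_block pz m ?G" by simp
    then have "?B = ?G" by (simp add: is_block_mat_mult_left is_block_mat_mult_right)
    then have "linearized ?B = 0" using eq by simp
    then have "?B = 0" by (rule linearized_injective[OF bB])
    then show ?thesis using \<open>?B = ?G\<close> by simp
  qed
  then show ?thesis by (intro rmap_eq_0) (auto intro: bounded_linear.linear bounded_linear_Re bounded_linear_Im)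
qed

lemma secant_Psi1:
  "secant 0 (cmat Psi_bar) (cmat Psi_bar) (cmat Psi1) = - secant_param 0 0 (cmat Psi_bar)"
proof -
  have "secant 0 (cmat Psi_bar) (cmat Psi_bar) (cmat Psi1) = cmat (linearized Psi1)"
    unfolding secant_at_limit phase_proj_cmat[OF is_block_Psi1] linearized_def
    by (simp add: cmat_algebra cmat_mult matrix_mul_assoc)
  also have "\<dots> = - secant_param 0 0 (cmat Psi_bar)"
    unfolding linearized_Psi1 secant_param_def W_c_def phase_proj_cmat[OF is_block_Psi_bar] C_c_0 V_c_0 V_diff_0 W_bar_def
    by (simp add: cmat_algebra cmat_mult matrix_mul_assoc)
  finally show ?thesis .
qed

lemma complex_rates_nonzero:
  obtains \<delta> where "0 < \<delta>" "\<And>w i. w \<in> ball 0 \<delta> \<Longrightarrow> i \<in> m \<Longrightarrow> complex_of_real (c $ i) + w * of_real (ct $ i) \<noteq> 0"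
proof -
  have "\<forall>\<^sub>F w in nhds 0. i \<in> m \<longrightarrow> complex_of_real (c $ i) + w * of_real (ct $ i) \<noteq> 0" for i
  proof (cases "i \<in> m")
    case True
    have "((\<lambda>w. complex_of_real (c $ i) + w * of_real (ct $ i)) \<longlongrightarrow> complex_of_real (c $ i) + 0 * of_real (ct $ i)) (nhds 0)"
      by (intro tendsto_intros filterlim_ident)
    then have "\<forall>\<^sub>F w in nhds 0. complex_of_real (c $ i) + w * of_real (ct $ i) \<noteq> 0"
      using True by (rule_tac tendsto_imp_eventually_ne) auto
    then show ?thesis by (auto elim: eventually_mono)
  qed auto
  then have "\<forall>\<^sub>F w in nhds 0. \<forall>i. i \<in> m \<longrightarrow> complex_of_real (c $ i) + w * of_real (ct $ i) \<noteq> 0"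
    by (rule eventually_all_finite)
  then obtain d where "0 < d"
    "\<And>w. dist w 0 < d \<Longrightarrow> \<forall>i. i \<in> m \<longrightarrow> complex_of_real (c $ i) + w * of_real (ct $ i) \<noteq> 0"
    unfolding eventually_nhds_metric by blast
  then show ?thesis by (intro that[of d]) (auto simp: dist_commute)
qed

text \<open>Convergence to \<open>Psi_bar\<close> places the minimal solution inside the ball in which the analytic branch is the
only solution.\<close>

lemma perturbed_first_return:
  shows "analytic_near_zero Psi_eps"
    and "(\<lambda>\<epsilon>. norm (Psi_eps \<epsilon> - (Psi_bar + \<epsilon> *\<^sub>R Psi1))) \<in> O[at_right 0](\<lambda>\<epsilon>. \<epsilon> ^ 2)"
proof -
  obtain \<delta> where \<delta>: "0 < \<delta>" "\<And>w i. w \<in> ball 0 \<delta> \<Longrightarrow> i \<in> m \<Longrightarrow> complex_of_real (c $ i) + w * of_real (ct $ i) \<noteq> 0"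
    using complex_rates_nonzero by blast
  have zero: "equation 0 (cmat Psi_bar) = 0"
    using equation_real[OF is_block_Psi_bar, of 0] by (simp add: Psi_bar_solution cmat_algebra)
  have branch: "\<exists>\<rho> r X. 0 < \<rho> \<and> 0 < r \<and> X 0 = cmat Psi_bar
      \<and> (\<forall>v Y. v \<in> ball 0 \<rho> \<longrightarrow> Y \<in> cball (cmat Psi_bar) r \<longrightarrow> equation v Y = 0 \<longrightarrow> Y = X v)
      \<and> (\<forall>i j. (\<lambda>v. X v $ i $ j) holomorphic_on ball 0 \<rho>)
      \<and> (\<forall>i j. ((\<lambda>v. X v $ i $ j) has_field_derivative cmat Psi1 $ i $ j) (at 0))"
    by (rule analytic_solution_branch[OF \<delta>(1) linear_secant secant_mat equation_secant
        equation_secant_param[OF \<delta>(2) \<delta>(2)] tendsto_secant[OF \<delta>(2)] tendsto_secant_param[OF \<delta>(2)]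
        secant_injective zero secant_Psi1]; blast)
  then obtain \<rho> r X where pos: "0 < \<rho>" "0 < r" and X0: "X 0 = cmat Psi_bar"
    and unique: "\<And>v Y. v \<in> ball 0 \<rho> \<Longrightarrow> Y \<in> cball (cmat Psi_bar) r \<Longrightarrow> equation v Y = 0 \<Longrightarrow> Y = X v"
    and holo: "\<And>i j. (\<lambda>v. X v $ i $ j) holomorphic_on ball 0 \<rho>"
    and deriv: "\<And>i j. ((\<lambda>v. X v $ i $ j) has_field_derivative cmat Psi1 $ i $ j) (at 0)"
    by blast
  obtain e where e: "0 < e" "\<And>\<epsilon>. 0 \<le> \<epsilon> \<Longrightarrow> \<epsilon> \<le> e \<Longrightarrow> admissible \<epsilon>"
    using admissible_near_zero by blast
  have "((\<lambda>\<epsilon>. cmat (Psi_eps \<epsilon>)) \<longlongrightarrow> cmat Psi_bar) (at_right 0)"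
    unfolding cmat_def by (intro tendsto_intros Psi_eps_tendsto)
  then have "\<forall>\<^sub>F \<epsilon> in at_right 0. dist (cmat (Psi_eps \<epsilon>)) (cmat Psi_bar) < r"
    by (rule tendstoD) (rule pos)
  moreover have "\<forall>\<^sub>F \<epsilon> in at_right 0. 0 < \<epsilon> \<and> \<epsilon> < min e \<rho>"
    unfolding eventually_at_right_field using e(1) pos(1) by (intro exI[of _ "min e \<rho>"]) auto
  ultimately have eq: "\<forall>\<^sub>F \<epsilon> in at_right 0. cmat (Psi_eps \<epsilon>) = X (of_real \<epsilon>)"
  proof eventually_elim
    case (elim \<epsilon>)
    then have sol: "Psi_eps \<epsilon> \<in> substochastic pz m" "scaled_riccati \<epsilon> (Psi_eps \<epsilon>) = 0"
      using Psi_eps_solution[OF e(2)] by auto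
    then have "equation (of_real \<epsilon>) (cmat (Psi_eps \<epsilon>)) = 0"
      using equation_real[of "Psi_eps \<epsilon>" \<epsilon>] by (simp add: substochastic_def cmat_algebra)
    then show ?case
      using elim by (intro unique) (auto simp: dist_commute)
  qed
  show "analytic_near_zero Psi_eps"
    unfolding analytic_near_zero_def
  proof (intro exI[of _ X] conjI allI)
    show "(\<lambda>v. X v $ i $ j) analytic_on {0}" for i j
      by (rule holomorphic_on_imp_analytic_at[OF holo open_ball]) (use pos in auto)
    show "\<forall>\<^sub>F \<epsilon> in at_right 0. \<forall>i j. complex_of_real (Psi_eps \<epsilon> $ i $ j) = X (of_real \<epsilon>) $ i $ j"
      using eq by eventually_elim (auto simp: cmat_nth[symmetric])
  qed
  show "(\<lambda>\<epsilon>. norm (Psi_eps \<epsilon> - (Psi_bar + \<epsilon> *\<^sub>R Psi1))) \<in> O[at_right 0](\<lambda>\<epsilon>. \<epsilon> ^ 2)"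
  proof -
    let ?rem = "\<lambda>i j \<epsilon>. norm (X (of_real \<epsilon>) $ i $ j - (X 0 $ i $ j + of_real \<epsilon> * cmat Psi1 $ i $ j))"
    have "(\<lambda>\<epsilon>. \<Sum>i\<in>UNIV. \<Sum>j\<in>UNIV. ?rem i j \<epsilon>) \<in> O[at_right 0](\<lambda>\<epsilon>. \<epsilon> ^ 2)"
      by (intro big_sum_in_bigo holomorphic_quadratic_remainder[OF holo pos(1) deriv])
    moreover have "(\<lambda>\<epsilon>. norm (Psi_eps \<epsilon> - (Psi_bar + \<epsilon> *\<^sub>R Psi1)))
        \<in> O[at_right 0](\<lambda>\<epsilon>. \<Sum>i\<in>UNIV. \<Sum>j\<in>UNIV. ?rem i j \<epsilon>)"
    proof (rule landau_o.big_mono)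
      show "\<forall>\<^sub>F \<epsilon> in at_right 0. norm (norm (Psi_eps \<epsilon> - (Psi_bar + \<epsilon> *\<^sub>R Psi1)))
          \<le> norm (\<Sum>i\<in>UNIV. \<Sum>j\<in>UNIV. ?rem i j \<epsilon>)"
        using eq
      proof eventually_elim
        case (elim \<epsilon>)
        have "?rem i j \<epsilon> = \<bar>(Psi_eps \<epsilon> - (Psi_bar + \<epsilon> *\<^sub>R Psi1)) $ i $ j\<bar>" for i j
        proof -
          have "X (of_real \<epsilon>) $ i $ j - (X 0 $ i $ j + of_real \<epsilon> * cmat Psi1 $ i $ j)
              = of_real ((Psi_eps \<epsilon> - (Psi_bar + \<epsilon> *\<^sub>R Psi1)) $ i $ j)"
            unfolding elim[symmetric] X0 by (simp add: cmat_nth)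
          then show ?thesis by (simp only: norm_of_real)
        qed
        then show ?case
          using norm_le_entry_sum[of "Psi_eps \<epsilon> - (Psi_bar + \<epsilon> *\<^sub>R Psi1)"]
          by (simp add: sum_nonneg)
      qed
    qed
    ultimately show ?thesis by (rule landau_o.big_trans[rotated])
  qed
qed

end

theorem theorem3p2:
  fixes A :: "real ^ 's ^ 's::finite" and c ct \<xi> :: "real ^ 's"
  assumes "generator A"
    and "stationary_vector A \<xi>"
    and "(\<xi> v* diag c) \<bullet> 1 < 0"
    and "\<And>i. c $ i = 0 \<Longrightarrow> ct $ i > 0"
  shows "analytic_near_zero (perturbed_fluid_notation.Psi_eps A c ct) \<and>
    (\<exists>!X. perturbed_fluid_notation.sylvester_solution A c ct X) \<and>
    (\<lambda>\<epsilon>. norm (perturbed_fluid_notation.Psi_eps A c ct \<epsilon>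
        - (perturbed_fluid_notation.Psi_bar A c + \<epsilon> *\<^sub>R perturbed_fluid_notation.Psi1 A c ct)))
      \<in> O[at_right 0](\<lambda>\<epsilon>. \<epsilon> ^ 2)"
proof -
  interpret perturbed_fluid A c ct \<xi>
    by unfold_locales (use assms in auto)
  show ?thesis
    using perturbed_first_return sylvester_unique by blast
qed

end
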